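(* Let $n$ be a positive integer, let $\lambda \vdash n$ and $\nu \vdash n$, and let $a,b,c$ be integers with $a \geq b \geq 2$ and $a+b+c=n$. Then $$ g_{\lambda \, (a, b, 1^{c}) \, \nu} = \sum_{\substack{ \eta \vdash n - (b-1) \\ \delta \vdash b-1 \\ \theta \vdash n -(b-1) }} c_{\eta \, \delta}^{\nu}\, g_{\theta \, (a, 1^{c+1}) \, \eta }\, c^{\lambda}_{\theta \, \delta} - \sum_{\substack{ \eta \vdash a \\ \delta \vdash n-a \\ \theta \vdash n-a }} c_{\eta \, \delta}^{\nu}\, g_{\theta \, (b-1, 1^{c+1}) \, \delta }\, c^{\lambda}_{\eta \, \theta}. $$
   Context: Partitions are written as weakly decreasing tuples; $(a,b,1^c)$ denotes the partition with parts $a,b$ followed by $c$ parts equal to $1$, and $(a,1^{k})$ a hook. For partitions $\mu,\nu,\lambda$, the Littlewood--Richardson coefficients $c^{\lambda}_{\mu\,\nu}$ are defined by $s_\mu s_\nu=\sum_\lambda c^{\lambda}_{\mu\,\nu}s_\lambda$ in the ring of symmetric functions ($s$ denoting Schur functions). For partitions $\lambda,\mu,\nu$ of the same integer, the Kronecker coefficient $g_{\lambda\,\mu\,\nu}$ is the multiplicity of the Specht module $S^\lambda$ in $S^\mu\otimes S^\nu$; equivalently $s_\lambda * s_\mu=\sum_\nu g_{\lambda\,\mu\,\nu}s_\nu$ for the Kronecker (internal) product $*$. It is symmetric in its three indices. *)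

theory Defs
  imports Complex_Main "HOL-Library.Poly_Mapping"
begin

subsection \<open>Formal power series in countably many variables\<close>

text \<open>
  The ring of symmetric functions over the rationals is a subring of the ring of formal power
  series in the variables \<open>x\<^sub>0, x\<^sub>1, x\<^sub>2, \<dots>\<close>. A monomial is a
  finitely supported exponent function \<open>nat \<Rightarrow>\<^sub>0 nat\<close>, and a series is an
  arbitrary family of coefficients indexed by monomials.
\<close>

typedef pseries = "UNIV :: ((nat \<Rightarrow>\<^sub>0 nat) \<Rightarrow> rat) set"
  morphisms coeff Abs_pseries ..

setup_lifting type_definition_pseries

lemma pseries_eqI: "(\<And>m. coeff f m = coeff g m) \<Longrightarrow> f = g"
  by transfer auto

lemma finite_monomial_divisors: "finite {u :: nat \<Rightarrow>\<^sub>0 nat. \<exists>v. u + v = m}"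
proof -
  let ?D = "{u :: nat \<Rightarrow>\<^sub>0 nat. \<exists>v. u + v = m}"
  let ?F = "{f. \<forall>i. (i \<in> Poly_Mapping.keys m \<longrightarrow> f i \<in> {..Max (Poly_Mapping.lookup m ` UNIV)})
                   \<and> (i \<notin> Poly_Mapping.keys m \<longrightarrow> f i = (0::nat))}"
  have fin: "finite (Poly_Mapping.lookup m ` UNIV)"
  proof (rule finite_subset)
    show "Poly_Mapping.lookup m ` UNIV \<subseteq> insert 0 (Poly_Mapping.lookup m ` Poly_Mapping.keys m)"
      by (auto simp: in_keys_iff)
  qed simp
  have "Poly_Mapping.lookup u \<in> ?F" if "u \<in> ?D" for u
  proof -
    from that obtain v where v: "u + v = m" by auto
    have le: "Poly_Mapping.lookup u i \<le> Poly_Mapping.lookup m i" for i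
      using v by (auto simp: lookup_add)
    moreover have "Poly_Mapping.lookup m i \<le> Max (Poly_Mapping.lookup m ` UNIV)" for i
      using fin by simp
    ultimately have "Poly_Mapping.lookup u i \<le> Max (Poly_Mapping.lookup m ` UNIV)" for i
      using order_trans by blast
    with le show ?thesis by (auto simp: in_keys_iff) (metis le_zero_eq)
  qed
  then have "Poly_Mapping.lookup ` ?D \<subseteq> ?F" by (rule image_subsetI)
  moreover have "finite ?F" by (rule finite_set_of_finite_funs) auto
  ultimately have "finite (Poly_Mapping.lookup ` ?D)" by (rule finite_subset)
  moreover have "inj_on Poly_Mapping.lookup ?D" by (auto simp: inj_on_def)
  ultimately show ?thesis by (rule finite_imageD)
qed

lemma finite_monomial_splits: "finite {(u, v :: nat \<Rightarrow>\<^sub>0 nat). u + v = m}"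
proof (rule finite_subset)
  show "{(u, v). u + v = m} \<subseteq> {u. \<exists>v. u + v = m} \<times> {v. \<exists>u. v + u = m}"
    by (auto simp: add.commute) (metis add.commute)
qed (use finite_monomial_divisors in auto)

instantiation pseries :: comm_ring_1
begin

lift_definition zero_pseries :: pseries is "\<lambda>_. 0" .

lift_definition one_pseries :: pseries is "\<lambda>m. if m = 0 then 1 else 0" .

lift_definition plus_pseries :: "pseries \<Rightarrow> pseries \<Rightarrow> pseries" is
  "\<lambda>f g m. f m + g m" .

lift_definition uminus_pseries :: "pseries \<Rightarrow> pseries" is "\<lambda>f m. - f m" .

lift_definition minus_pseries :: "pseries \<Rightarrow> pseries \<Rightarrow> pseries" is
  "\<lambda>f g m. f m - g m" .

lift_definition times_pseries :: "pseries \<Rightarrow> pseries \<Rightarrow> pseries" is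
  "\<lambda>f g m. \<Sum>(u, v) \<in> {(u, v). u + v = m}. f u * g v" .

instance
proof
  fix f g h :: pseries
  let ?S = "\<lambda>m. {(u, v :: nat \<Rightarrow>\<^sub>0 nat). u + v = m}"
  note fin = finite_monomial_splits
  show "f + g + h = f + (g + h)" by transfer (simp add: add.assoc)
  show "f + g = g + f" by transfer (simp add: add.commute)
  show "0 + f = f" by transfer simp
  show "- f + f = 0" by transfer simp
  show "f - g = f + - g" by transfer simp
  show "(0 :: pseries) \<noteq> 1" by transfer (auto simp: fun_eq_iff)
  show "(f + g) * h = f * h + g * h"
    by transfer (simp add: distrib_right sum.distrib case_prod_unfold)
  show "f * g = g * f"
  proof (rule pseries_eqI)
    fix m
    show "coeff (f * g) m = coeff (g * f) m"
      unfolding times_pseries.rep_eq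
      by (rule sum.reindex_bij_witness[where i = prod.swap and j = prod.swap])
         (auto simp: add.commute mult.commute)
  qed
  show "1 * f = f"
  proof (rule pseries_eqI)
    fix m
    have "coeff (1 * f) m = (\<Sum>(u, v)\<in>?S m. if u = 0 then coeff f v else 0)"
      unfolding times_pseries.rep_eq one_pseries.rep_eq by (rule sum.cong) auto
    also have "\<dots> = (\<Sum>(u, v)\<in>{(0 :: nat \<Rightarrow>\<^sub>0 nat, m)}. if u = 0 then coeff f v else 0)"
      by (rule sum.mono_neutral_right[OF fin]) (auto split: if_splits)
    finally show "coeff (1 * f) m = coeff f m" by simp
  qed
  show "f * g * h = f * (g * h)"
  proof (rule pseries_eqI)
    fix m
    have "coeff (f * g * h) m =
        (\<Sum>p\<in>?S m. \<Sum>q\<in>?S (fst p). coeff f (fst q) * coeff g (snd q) * coeff h (snd p))"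
      unfolding times_pseries.rep_eq by (simp add: case_prod_unfold sum_distrib_right)
    also have "\<dots> = (\<Sum>(p, q)\<in>(SIGMA p:?S m. ?S (fst p)).
        coeff f (fst q) * coeff g (snd q) * coeff h (snd p))"
      by (rule sum.Sigma) (use fin in auto)
    also have "\<dots> = (\<Sum>(p, q)\<in>(SIGMA p:?S m. ?S (snd p)).
        coeff f (fst p) * (coeff g (fst q) * coeff h (snd q)))"
      by (rule sum.reindex_bij_witness
            [where j = "\<lambda>((w, t), (u, v)). ((u, v + t), (v, t))"
               and i = "\<lambda>((u, w), (v, t)). ((u + v, t), (u, v))"])
         (auto simp: add.assoc mult.assoc)
    also have "\<dots> =
        (\<Sum>p\<in>?S m. \<Sum>q\<in>?S (snd p). coeff f (fst p) * (coeff g (fst q) * coeff h (snd q)))"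
      by (rule sum.Sigma[symmetric]) (use fin in auto)
    also have "\<dots> = coeff (f * (g * h)) m"
      unfolding times_pseries.rep_eq by (simp add: case_prod_unfold sum_distrib_left)
    finally show "coeff (f * g * h) m = coeff (f * (g * h)) m" .
  qed
qed

end

lift_definition scale :: "rat \<Rightarrow> pseries \<Rightarrow> pseries" is "\<lambda>c f m. c * f m" .

interpretation pseries: vector_space scale
  by unfold_locales (transfer; simp add: algebra_simps)+

subsection \<open>Partitions, Schur functions and power sums\<close>

definition is_partition :: "nat list \<Rightarrow> bool" where
  "is_partition \<kappa> \<longleftrightarrow> sorted_wrt (\<ge>) \<kappa> \<and> (\<forall>k\<in>set \<kappa>. 0 < k)"

definition partitions :: "nat \<Rightarrow> nat list set" where
  "partitions n = {\<kappa>. is_partition \<kappa> \<and> sum_list \<kappa> = n}"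

definition diagram :: "nat list \<Rightarrow> (nat \<times> nat) set" where
  "diagram \<kappa> = {(i, j). i < length \<kappa> \<and> j < \<kappa> ! i}"

text \<open>
  Semistandard Young tableaux with entries in the naturals, as the variables are indexed from 0.
  Requiring the value 0 outside the diagram makes tableaux of a given shape correspond to
  functions uniquely.
\<close>

definition ssyt :: "nat list \<Rightarrow> (nat \<times> nat \<Rightarrow> nat) set" where
  "ssyt \<kappa> = {T. (\<forall>p. p \<notin> diagram \<kappa> \<longrightarrow> T p = 0)
      \<and> (\<forall>i j. (i, Suc j) \<in> diagram \<kappa> \<longrightarrow> T (i, j) \<le> T (i, Suc j))
      \<and> (\<forall>i j. (Suc i, j) \<in> diagram \<kappa> \<longrightarrow> T (i, j) < T (Suc i, j))}"

text \<open>
  \<open>s\<^sub>\<kappa>\<close> is the sum over all semistandard tableaux \<open>T\<close> of shape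
  \<open>\<kappa>\<close> of the monomial \<open>\<Prod>\<^bsub>p\<^esub> x\<^bsub>T(p)\<^esub>\<close>. Only finitely many
  tableaux have a given content \<open>m\<close>.
\<close>

lift_definition schur :: "nat list \<Rightarrow> pseries" is
  "\<lambda>\<kappa> m. of_nat (card {T \<in> ssyt \<kappa>. \<forall>k. card {p \<in> diagram \<kappa>. T p = k} = Poly_Mapping.lookup m k})" .

lift_definition power_sum :: "nat \<Rightarrow> pseries" is
  "\<lambda>k m. if \<exists>i. m = Poly_Mapping.single i k then 1 else 0" .

definition power_sum_part :: "nat list \<Rightarrow> pseries" where
  "power_sum_part \<rho> = prod_list (map power_sum \<rho>)"

text \<open>
  The Schur functions and the products of power sums, indexed by all partitions, are bases of
  the space of symmetric functions; the following are the coordinates with respect to them.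
\<close>

definition schur_coeff :: "pseries \<Rightarrow> nat list \<Rightarrow> rat" where
  "schur_coeff f \<kappa> = pseries.representation (schur ` Collect is_partition) f (schur \<kappa>)"

definition power_sum_coeff :: "pseries \<Rightarrow> nat list \<Rightarrow> rat" where
  "power_sum_coeff f \<rho> =
     pseries.representation (power_sum_part ` Collect is_partition) f (power_sum_part \<rho>)"

subsection \<open>Littlewood--Richardson and Kronecker coefficients\<close>

text \<open>\<open>lr_coeff \<mu> \<nu> \<kappa>\<close> is \<open>c\<^sup>\<kappa>\<close> with lower indices \<open>\<mu>, \<nu>\<close>.\<close>

definition lr_coeff :: "nat list \<Rightarrow> nat list \<Rightarrow> nat list \<Rightarrow> rat" where
  "lr_coeff \<mu> \<nu> \<kappa> = schur_coeff (schur \<mu> * schur \<nu>) \<kappa>"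

text \<open>\<open>z\<^sub>\<rho> = \<Prod>\<^bsub>i\<^esub> i\<^bsup>m\<^esup> m!\<close> with \<open>m = m\<^sub>i(\<rho>)\<close> the multiplicity of
  \<open>i\<close> as a part of \<open>\<rho>\<close>; the order of the centralizer of a permutation of cycle type
  \<open>\<rho>\<close>.\<close>

definition z_part :: "nat list \<Rightarrow> nat" where
  "z_part \<rho> = (\<Prod>i\<in>set \<rho>. i ^ count_list \<rho> i * fact (count_list \<rho> i))"

text \<open>
  The Kronecker (internal) product is the bilinear product on symmetric functions with
  \<open>p\<^sub>\<rho> * p\<^sub>\<sigma> = z\<^sub>\<rho> p\<^sub>\<rho>\<close> if \<open>\<rho> = \<sigma>\<close> and \<open>0\<close> otherwise. Under the Frobenius
  characteristic \<open>ch \<chi> = (1/n!) \<Sum>\<^bsub>w\<^esub> \<chi>(w) p\<^bsub>type(w)\<^esub>\<close>, which sends the character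
  of the Specht module \<open>S\<^sup>\<kappa>\<close> to \<open>s\<^sub>\<kappa>\<close>, it is the pointwise product of characters, i.e. the
  tensor product of representations.
\<close>

definition kronecker_product :: "pseries \<Rightarrow> pseries \<Rightarrow> pseries" where
  "kronecker_product f g =
     (\<Sum>\<rho> | is_partition \<rho> \<and> power_sum_coeff f \<rho> \<noteq> 0 \<and> power_sum_coeff g \<rho> \<noteq> 0.
        scale (power_sum_coeff f \<rho> * power_sum_coeff g \<rho> * of_nat (z_part \<rho>))
          (power_sum_part \<rho>))"

definition kronecker_coeff :: "nat list \<Rightarrow> nat list \<Rightarrow> nat list \<Rightarrow> rat" where
  "kronecker_coeff \<kappa> \<mu> \<nu> = schur_coeff (kronecker_product (schur \<kappa>) (schur \<mu>)) \<nu>"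

end

theory Submission
  imports Defs "HOL-Library.Multiset"
begin

text \<open>
  By Pieri's rule, \<open>s\<^bsub>(a,b,1^c)\<^esub> = h\<^bsub>b-1\<^esub> s\<^bsub>(a,1^(c+1))\<^esub> - h\<^bsub>a\<^esub> s\<^bsub>(b-1,1^(c+1))\<^esub>\<close>. Applying the
  Kronecker product with \<open>s\<^bsub>\<lambda>\<^esub>\<close>, the claim follows from two rules: \<open>s\<^bsub>\<lambda>\<^esub> * (f g)\<close> is the sum of the
  \<open>c\<^bsub>\<theta>\<delta>\<^esub> (s\<^bsub>\<theta>\<^esub> * f) (s\<^bsub>\<delta>\<^esub> * g)\<close> with \<open>c\<^bsub>\<theta>\<delta>\<^esub>\<close> the Littlewood-Richardson coefficients of \<open>\<lambda>\<close>, and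
  \<open>f * h\<^bsub>n\<^esub> = f\<close> in degree \<open>n\<close>.

  The first rule expresses that the Schur functions are orthonormal for the Hall product, in which
  \<open>\<langle>p\<^bsub>\<rho>\<^esub>, p\<^bsub>\<sigma>\<^esub>\<rangle> = z\<^bsub>\<rho>\<^esub>\<close> or \<open>0\<close>. To see this, write \<open>h\<^bsub>\<alpha>\<^esub>\<close> for a product of complete homogeneous functions. Newton's
  identities give \<open>h\<^bsub>\<alpha>\<^esub> = \<Sum>\<^bsub>\<rho>\<^esub> [x\<^bsup>\<alpha>\<^esup>]p\<^bsub>\<rho>\<^esub> p\<^bsub>\<rho>\<^esub> / z\<^bsub>\<rho>\<^esub>\<close>, so the Hall product with \<open>h\<^bsub>\<alpha>\<^esub>\<close> extracts the coefficient
  of \<open>x\<^bsup>\<alpha>\<^esup>\<close>, and iterating Pieri's rule gives \<open>h\<^bsub>\<alpha>\<^esub> = \<Sum>\<^bsub>\<mu>\<^esub> K\<^bsub>\<mu>\<alpha>\<^esub> s\<^bsub>\<mu>\<^esub>\<close>, where \<open>K\<^bsub>\<mu>\<alpha>\<^esub> = [x\<^bsup>\<alpha>\<^esup>]s\<^bsub>\<mu>\<^esub>\<close>. Hence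
  \<open>\<Sum>\<^bsub>\<mu>\<^esub> K\<^bsub>\<mu>\<alpha>\<^esub> \<langle>s\<^bsub>\<mu>\<^esub>, s\<^bsub>\<kappa>\<^esub>\<rangle> = K\<^bsub>\<kappa>\<alpha>\<^esub>\<close> for all \<open>\<alpha>\<close>, and \<open>K\<close> is unitriangular. Symmetry of the Schur functions is
  obtained along the way, as they are combinations of the \<open>h\<^bsub>\<alpha>\<^esub>\<close>.
\<close>

subsection \<open>Complete homogeneous functions and Newton identities\<close>

lemma coeff_0 [simp]: "coeff 0 m = 0"
  by transfer simp

lemma coeff_1: "coeff 1 m = (if m = 0 then 1 else 0)"
  by transfer simp

lemma coeff_add [simp]: "coeff (f + g) m = coeff f m + coeff g m"
  by transfer simp

lemma coeff_scale [simp]: "coeff (scale c f) m = c * coeff f m"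
  by transfer simp

lemma coeff_sum [simp]: "coeff (sum f A) m = (\<Sum>i\<in>A. coeff (f i) m)"
  by (induction A rule: infinite_finite_induct) auto

lemma coeff_mult: "coeff (f * g) m = (\<Sum>(u, v)\<in>{(u, v). u + v = m}. coeff f u * coeff g v)"
  unfolding times_pseries.rep_eq by (rule refl)

lemma scale_mult_left [simp]: "scale c f * g = scale c (f * g)"
  by (rule pseries_eqI) (simp add: coeff_mult sum_distrib_left case_prod_unfold mult.assoc)

lemma scale_mult_right [simp]: "f * scale c g = scale c (f * g)"
  by (metis scale_mult_left mult.commute)

section \<open>Total degree of monomials\<close>

definition deg :: "(nat \<Rightarrow>\<^sub>0 nat) \<Rightarrow> nat" where
  "deg m = (\<Sum>i\<in>Poly_Mapping.keys m. Poly_Mapping.lookup m i)"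

lemma deg_superset:
  assumes "finite A" "Poly_Mapping.keys m \<subseteq> A"
  shows "deg m = (\<Sum>i\<in>A. Poly_Mapping.lookup m i)"
  unfolding deg_def by (rule sum.mono_neutral_left) (use assms in \<open>auto simp: in_keys_iff\<close>)

lemma deg_add [simp]: "deg (m + m') = deg m + deg m'"
proof -
  let ?A = "Poly_Mapping.keys m \<union> Poly_Mapping.keys m'"
  have "deg (m + m') = (\<Sum>i\<in>?A. Poly_Mapping.lookup (m + m') i)"
    by (rule deg_superset) (auto simp: in_keys_iff lookup_add)
  also have "\<dots> = deg m + deg m'"
    by (simp add: lookup_add sum.distrib deg_superset[of ?A m] deg_superset[of ?A m'])
  finally show ?thesis .
qed

lemma deg_single [simp]: "deg (Poly_Mapping.single i k) = k"
  by (simp add: deg_def)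

lemma lookup_le_deg: "Poly_Mapping.lookup m i \<le> deg m"
proof (cases "i \<in> Poly_Mapping.keys m")
  case True
  then show ?thesis unfolding deg_def by (intro member_le_sum) auto
qed (simp add: in_keys_iff)

lemma minus_single_add:
  assumes "k \<le> Poly_Mapping.lookup (m :: nat \<Rightarrow>\<^sub>0 nat) i"
  shows "m - Poly_Mapping.single i k + Poly_Mapping.single i k = m"
  by (rule poly_mapping_eqI) (use assms in \<open>auto simp: lookup_add lookup_minus lookup_single when_def\<close>)

lemma deg_minus_single:
  assumes "k \<le> Poly_Mapping.lookup m i"
  shows "deg (m - Poly_Mapping.single i k) = deg m - k"
  by (metis add_diff_cancel_right' assms deg_add deg_single minus_single_add)

lemma deg_eq_0_iff [simp]: "deg m = 0 \<longleftrightarrow> m = 0"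
proof
  assume "deg m = 0"
  then have "Poly_Mapping.lookup m i = 0" for i
    using lookup_le_deg[of m i] by simp
  then show "m = 0" by (intro poly_mapping_eqI) simp
qed (simp add: deg_def)

lemma finite_ge_lookup:
  fixes m :: "nat \<Rightarrow>\<^sub>0 nat"
  assumes "0 < k"
  shows "finite {i. k \<le> Poly_Mapping.lookup m i}"
proof (rule finite_subset)
  show "{i. k \<le> Poly_Mapping.lookup m i} \<subseteq> Poly_Mapping.keys m"
  proof
    fix i assume "i \<in> {i. k \<le> Poly_Mapping.lookup m i}"
    then have "Poly_Mapping.lookup m i \<noteq> 0" using assms by auto
    then show "i \<in> Poly_Mapping.keys m" by (simp add: in_keys_iff)
  qed
qed simp

text \<open>The monomials of \<open>p_k\<close> are the powers \<open>x_i^k\<close>, so a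
  factorization of \<open>m\<close> contributes only if it strips \<open>k\<close> from one
  exponent. For \<open>k > 0\<close> distinct variables give distinct factors.\<close>

lemma coeff_power_sum_mult:
  assumes "0 < k"
  shows "coeff (power_sum k * f) m =
    (\<Sum>i | k \<le> Poly_Mapping.lookup m i. coeff f (m - Poly_Mapping.single i k))"
proof -
  let ?I = "{i. k \<le> Poly_Mapping.lookup m i}"
  let ?j = "\<lambda>i. (Poly_Mapping.single i k, m - Poly_Mapping.single i k)"
  have inj: "inj_on ?j ?I"
  proof (rule inj_onI)
    fix i j assume "?j i = ?j j"
    then have "Poly_Mapping.lookup (Poly_Mapping.single i k) j = k" by simp
    then show "i = j" using assms by (auto simp: lookup_single when_def split: if_splits)
  qed
  have "coeff (power_sum k * f) m =
      (\<Sum>(u, v)\<in>{(u, v). u + v = m}. coeff (power_sum k) u * coeff f v)"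
    by (rule coeff_mult)
  also have "\<dots> = (\<Sum>(u, v)\<in>?j ` ?I. coeff (power_sum k) u * coeff f v)"
  proof (rule sum.mono_neutral_right[OF finite_monomial_splits])
    show "?j ` ?I \<subseteq> {(u, v). u + v = m}"
    proof (rule image_subsetI)
      fix i assume "i \<in> ?I"
      then have "Poly_Mapping.single i k + (m - Poly_Mapping.single i k) = m"
        by (subst add.commute) (simp only: minus_single_add mem_Collect_eq)
      then show "?j i \<in> {(u, v). u + v = m}" by simp
    qed
    show "\<forall>p\<in>{(u, v). u + v = m} - ?j ` ?I.
        (case p of (u, v) \<Rightarrow> coeff (power_sum k) u * coeff f v) = 0"
    proof
      fix p assume p: "p \<in> {(u, v). u + v = m} - ?j ` ?I"
      obtain u v where uv: "p = (u, v)" "u + v = m" using p by auto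
      have "u \<noteq> Poly_Mapping.single i k" for i
      proof
        assume u: "u = Poly_Mapping.single i k"
        then have "v = m - Poly_Mapping.single i k" "k \<le> Poly_Mapping.lookup m i"
          using uv(2) by (auto simp: lookup_add)
        with p uv u show False by auto
      qed
      then show "(case p of (u, v) \<Rightarrow> coeff (power_sum k) u * coeff f v) = 0"
        by (simp add: uv power_sum.rep_eq)
    qed
  qed
  also have "\<dots> = (\<Sum>i\<in>?I. coeff (power_sum k) (Poly_Mapping.single i k) * coeff f (m - Poly_Mapping.single i k))"
    by (subst sum.reindex[OF inj]) simp
  also have "\<dots> = (\<Sum>i\<in>?I. coeff f (m - Poly_Mapping.single i k))"
    by (rule sum.cong) (auto simp: power_sum.rep_eq)
  finally show ?thesis .
qed

text \<open>The complete homogeneous function \<open>h_k\<close>, given by its coefficients so that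
  Newton's identities reduce to counting.\<close>

lift_definition hsym :: "nat \<Rightarrow> pseries" is "\<lambda>k m. if deg m = k then 1 else 0" .

lemma hsym_0: "hsym 0 = 1"
  by (rule pseries_eqI) (simp add: hsym.rep_eq coeff_1)

text \<open>For a monomial of degree \<open>n\<close>, the right side counts the pairs
  \<open>(i, k)\<close> with \<open>k\<close> between 1 and the exponent of \<open>x_i\<close>. An
  exponent \<open>e\<close> is counted \<open>e\<close> times, so there are \<open>n\<close>
  pairs.\<close>

lemma newton: "scale (of_nat n) (hsym n) = (\<Sum>k=1..n. power_sum k * hsym (n - k))"
proof (rule pseries_eqI)
  fix m
  have "coeff (\<Sum>k=1..n. power_sum k * hsym (n - k)) m =
      (\<Sum>k=1..n. \<Sum>i | k \<le> Poly_Mapping.lookup m i. coeff (hsym (n - k)) (m - Poly_Mapping.single i k))"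
    by (simp add: coeff_power_sum_mult)
  also have "\<dots> = (\<Sum>k=1..n. \<Sum>i | k \<le> Poly_Mapping.lookup m i. if deg m = n then 1 else 0)"
  proof (intro sum.cong refl)
    fix k i assume k: "k \<in> {1..n}" "i \<in> {i. k \<le> Poly_Mapping.lookup m i}"
    then have "k \<le> deg m" using lookup_le_deg[of m i] by auto
    then show "coeff (hsym (n - k)) (m - Poly_Mapping.single i k) = (if deg m = n then 1 else 0)"
      using k by (auto simp: hsym.rep_eq deg_minus_single)
  qed
  also have "\<dots> = (if deg m = n then of_nat n else 0)"
  proof (cases "deg m = n")
    case True
    have "(\<Sum>k=1..n. \<Sum>i | k \<le> Poly_Mapping.lookup m i. 1 :: rat) =
        (\<Sum>k=1..n. \<Sum>i\<in>Poly_Mapping.keys m. if k \<le> Poly_Mapping.lookup m i then 1 else 0)"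
    proof (rule sum.cong[OF refl])
      fix k assume "k \<in> {1..n}"
      then have "{i. k \<le> Poly_Mapping.lookup m i} = {i \<in> Poly_Mapping.keys m. k \<le> Poly_Mapping.lookup m i}"
        by (force simp: in_keys_iff)
      then show "(\<Sum>i | k \<le> Poly_Mapping.lookup m i. 1 :: rat) =
          (\<Sum>i\<in>Poly_Mapping.keys m. if k \<le> Poly_Mapping.lookup m i then 1 else 0)"
        by (simp only: sum.inter_filter[OF finite_keys])
    qed
    also have "\<dots> = (\<Sum>i\<in>Poly_Mapping.keys m. \<Sum>k=1..n. if k \<le> Poly_Mapping.lookup m i then 1 else 0)"
      by (rule sum.swap)
    also have "\<dots> = (\<Sum>i\<in>Poly_Mapping.keys m. of_nat (Poly_Mapping.lookup m i))"
    proof (intro sum.cong refl)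
      fix i
      have "Poly_Mapping.lookup m i \<le> n" using True lookup_le_deg by blast
      then have "{k \<in> {1..n}. k \<le> Poly_Mapping.lookup m i} = {1..Poly_Mapping.lookup m i}" by auto
      then show "(\<Sum>k=1..n. if k \<le> Poly_Mapping.lookup m i then 1 else 0) = (of_nat (Poly_Mapping.lookup m i) :: rat)"
        by (subst sum.inter_filter[symmetric]) auto
    qed
    also have "\<dots> = of_nat n" using True by (simp add: deg_def flip: of_nat_sum)
    finally show ?thesis using True by simp
  qed simp
  finally show "coeff (scale (of_nat n) (hsym n)) m = coeff (\<Sum>k=1..n. power_sum k * hsym (n - k)) m"
    by (simp add: hsym.rep_eq)
qed

text \<open>The index is an exponent vector, so that the same \<open>m\<close> serves as the index
  of \<open>h_\<alpha>\<close> and as the monomial whose coefficient the Hall product with it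
  extracts.\<close>

definition hprod :: "(nat \<Rightarrow>\<^sub>0 nat) \<Rightarrow> pseries" where
  "hprod m = (\<Prod>i\<in>Poly_Mapping.keys m. hsym (Poly_Mapping.lookup m i))"

lemma hprod_superset:
  assumes "finite A" "Poly_Mapping.keys m \<subseteq> A"
  shows "hprod m = (\<Prod>i\<in>A. hsym (Poly_Mapping.lookup m i))"
  unfolding hprod_def
  by (rule prod.mono_neutral_left) (use assms in \<open>auto simp: in_keys_iff hsym_0\<close>)

text \<open>\<open>deg m\<close> is the sum of the exponents, so Newton's identity can be applied to
  one factor at a time; the summand for \<open>i\<close> lowers only the exponent of
  \<open>x_i\<close>.\<close>

lemma hprod_newton:
  "scale (of_nat (deg m)) (hprod m) =
    (\<Sum>i\<in>Poly_Mapping.keys m. \<Sum>k=1..Poly_Mapping.lookup m i. power_sum k * hprod (m - Poly_Mapping.single i k))"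
proof -
  let ?K = "Poly_Mapping.keys m"
  have "scale (of_nat (deg m)) (hprod m) = (\<Sum>i\<in>?K. scale (of_nat (Poly_Mapping.lookup m i)) (hprod m))"
    by (simp add: deg_def pseries.scale_sum_left)
  also have "\<dots> = (\<Sum>i\<in>?K. \<Sum>k=1..Poly_Mapping.lookup m i. power_sum k * hprod (m - Poly_Mapping.single i k))"
  proof (intro sum.cong refl)
    fix i assume i: "i \<in> ?K"
    let ?R = "\<Prod>j\<in>?K - {i}. hsym (Poly_Mapping.lookup m j)"
    have "hprod (m - Poly_Mapping.single i k) = hsym (Poly_Mapping.lookup m i - k) * ?R" for k
    proof -
      have "hprod (m - Poly_Mapping.single i k) = (\<Prod>j\<in>?K. hsym (Poly_Mapping.lookup (m - Poly_Mapping.single i k) j))"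
        by (rule hprod_superset) (auto simp: in_keys_iff lookup_minus)
      also have "\<dots> = hsym (Poly_Mapping.lookup m i - k) *
          (\<Prod>j\<in>?K - {i}. hsym (Poly_Mapping.lookup (m - Poly_Mapping.single i k) j))"
        using i by (subst prod.remove[of _ i]) (auto simp: lookup_minus)
      also have "(\<Prod>j\<in>?K - {i}. hsym (Poly_Mapping.lookup (m - Poly_Mapping.single i k) j)) = ?R"
        by (rule prod.cong) (auto simp: lookup_minus lookup_single when_def)
      finally show ?thesis .
    qed
    moreover have "hprod m = hsym (Poly_Mapping.lookup m i) * ?R"
      unfolding hprod_def using i by (subst prod.remove[of _ i]) auto
    ultimately show "scale (of_nat (Poly_Mapping.lookup m i)) (hprod m) =
        (\<Sum>k=1..Poly_Mapping.lookup m i. power_sum k * hprod (m - Poly_Mapping.single i k))"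
      by (simp only: scale_mult_left[symmetric] newton sum_distrib_right mult.assoc)
  qed
  finally show ?thesis .
qed

subsection \<open>Power sum expansions\<close>

lemma deg_zero [simp]: "deg 0 = 0"
  by simp

section \<open>Partitions as multisets of parts\<close>

lemma finite_partitions [simp]: "finite (partitions n)"
proof (rule finite_subset)
  show "partitions n \<subseteq> {xs. set xs \<subseteq> {..n} \<and> length xs \<le> n}"
  proof
    fix xs assume "xs \<in> partitions n"
    then have xs: "sum_list xs = n" "\<forall>x\<in>set xs. 0 < x"
      by (auto simp: partitions_def is_partition_def)
    have "length xs \<le> sum_list xs"
      using xs(2) by (induction xs) auto
    then show "xs \<in> {xs. set xs \<subseteq> {..n} \<and> length xs \<le> n}"
      using xs(1) member_le_sum_list by fastforce
  qed
qed (rule finite_lists_length_le, simp)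

text \<open>Multisets are used because adding or removing a part then needs no sorting.\<close>

definition mpartitions :: "nat \<Rightarrow> nat multiset set" where
  "mpartitions n = {M. 0 \<notin># M \<and> sum_mset M = n}"

definition part_of_mset :: "nat multiset \<Rightarrow> nat list" where
  "part_of_mset M = rev (sorted_list_of_multiset M)"

lemma mset_part_of_mset [simp]: "mset (part_of_mset M) = M"
  by (simp add: part_of_mset_def)

lemma part_of_mset_mset: "is_partition \<rho> \<Longrightarrow> part_of_mset (mset \<rho>) = \<rho>"
  unfolding part_of_mset_def is_partition_def
  by (metis mset_rev properties_for_sort rev_rev_ident sorted_list_of_multiset_mset sorted_wrt_rev
      rev_is_rev_conv)

lemma is_partition_part_of_mset: "0 \<notin># M \<Longrightarrow> is_partition (part_of_mset M)"
  unfolding part_of_mset_def is_partition_def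
  by (auto simp: sorted_wrt_rev intro!: gr0I)

lemma bij_betw_mset_partitions: "bij_betw mset (partitions n) (mpartitions n)"
proof (rule bij_betw_byWitness[where f' = part_of_mset])
  show "mset ` partitions n \<subseteq> mpartitions n"
    by (auto simp: partitions_def mpartitions_def is_partition_def sum_mset_sum_list)
  show "part_of_mset ` mpartitions n \<subseteq> partitions n"
    by (auto simp: partitions_def mpartitions_def is_partition_part_of_mset sum_mset_sum_list[symmetric])
qed (auto simp: partitions_def part_of_mset_mset)

lemma finite_mpartitions [simp]: "finite (mpartitions n)"
  using bij_betw_finite[OF bij_betw_mset_partitions] finite_partitions by blast

definition pmset :: "nat multiset \<Rightarrow> pseries" where
  "pmset M = prod_mset (image_mset power_sum M)"

lemma pmset_mset: "pmset (mset \<rho>) = power_sum_part \<rho>"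
  by (simp add: pmset_def power_sum_part_def prod_mset_prod_list flip: mset_map)

lemma pmset_empty [simp]: "pmset {#} = 1"
  by (simp add: pmset_def)

lemma pmset_add_mset [simp]: "pmset (add_mset k M) = power_sum k * pmset M"
  by (simp add: pmset_def)

lemma pmset_union: "pmset (M + N) = pmset M * pmset N"
  by (simp add: pmset_def)

definition zmset :: "nat multiset \<Rightarrow> nat" where
  "zmset M = (\<Prod>i\<in>set_mset M. i ^ count M i * fact (count M i))"

lemma zmset_mset: "zmset (mset \<rho>) = z_part \<rho>"
  by (simp add: zmset_def z_part_def count_mset)

lemma zmset_pos: "0 \<notin># M \<Longrightarrow> 0 < zmset M"
  unfolding zmset_def by (intro prod_pos) (auto intro!: gr0I)

text \<open>Only the factor of \<open>k\<close> changes: raising its multiplicity from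
  \<open>r\<close> to \<open>r + 1\<close> turns \<open>k^r * r!\<close> into
  \<open>k^(r+1) * (r+1)!\<close>.\<close>

lemma zmset_add_mset: "zmset (add_mset k M) = zmset M * (k * Suc (count M k))"
proof -
  let ?f = "\<lambda>M i. i ^ count M i * fact (count M i) :: nat"
  let ?R = "\<Prod>i\<in>set_mset M - {k}. ?f M i"
  \<comment> \<open>If \<open>k\<close> is not a part of \<open>M\<close>, its factor is
    \<open>k^0 * 0! = 1\<close>, so it can be inserted into the index set, which then agrees with
    that of \<open>add_mset k M\<close>.\<close>
  have "zmset M = (\<Prod>i\<in>insert k (set_mset M). ?f M i)"
    unfolding zmset_def by (rule prod.mono_neutral_left) (auto simp: not_in_iff)
  then have "zmset M = ?f M k * ?R"
    by (simp add: prod.insert_remove)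
  moreover have "zmset (add_mset k M) = ?f (add_mset k M) k * (\<Prod>i\<in>set_mset M - {k}. ?f (add_mset k M) i)"
    unfolding zmset_def by (simp add: prod.insert_remove)
  moreover have "(\<Prod>i\<in>set_mset M - {k}. ?f (add_mset k M) i) = ?R"
    by (rule prod.cong) auto
  ultimately show ?thesis by (simp add: algebra_simps)
qed

lemma sum_mset_eq_sum_count: "sum_mset M = (\<Sum>k\<in>set_mset M. count M k * k)"
proof -
  obtain xs where "M = mset xs" by (metis ex_mset)
  then show ?thesis
    using sum_list_map_eq_sum_count[of "\<lambda>x. x" xs] by (simp add: sum_mset_sum_list count_mset)
qed

text \<open>Write \<open>n\<close> as the sum of \<open>count M k * k\<close> over the distinct
  parts \<open>k\<close> of \<open>M\<close>, and regroup the pairs \<open>(M, k)\<close> by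
  \<open>k\<close> and the multiset left after removing one \<open>k\<close>. This is the
  counterpart of Newton's recursion for power sum expansions.\<close>

lemma sum_mpartitions_remove:
  fixes F :: "nat multiset \<Rightarrow> rat"
  shows "(\<Sum>M\<in>mpartitions n. scale (of_nat n * F M / of_nat (zmset M)) (pmset M)) =
    (\<Sum>k=1..n. \<Sum>M\<in>mpartitions (n - k).
       scale (F (add_mset k M) / of_nat (zmset M)) (power_sum k * pmset M))"
proof -
  have "(\<Sum>M\<in>mpartitions n. scale (of_nat n * F M / of_nat (zmset M)) (pmset M)) =
      (\<Sum>M\<in>mpartitions n. \<Sum>k\<in>set_mset M.
        scale (of_nat (count M k * k) * F M / of_nat (zmset M)) (pmset M))"
  proof (rule sum.cong[OF refl])
    fix M assume "M \<in> mpartitions n"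
    then have "n = (\<Sum>k\<in>set_mset M. count M k * k)"
      by (simp add: mpartitions_def sum_mset_eq_sum_count)
    then have "of_nat n * F M / of_nat (zmset M) =
        (\<Sum>k\<in>set_mset M. of_nat (count M k * k) * F M / of_nat (zmset M))"
      by (simp only: of_nat_sum sum_distrib_right sum_divide_distrib)
    then show "scale (of_nat n * F M / of_nat (zmset M)) (pmset M) =
        (\<Sum>k\<in>set_mset M. scale (of_nat (count M k * k) * F M / of_nat (zmset M)) (pmset M))"
      by (simp only: pseries.scale_sum_left)
  qed
  also have "\<dots> = (\<Sum>(M, k)\<in>(SIGMA M:mpartitions n. set_mset M).
        scale (of_nat (count M k * k) * F M / of_nat (zmset M)) (pmset M))"
    by (rule sum.Sigma) auto
  also have "\<dots> = (\<Sum>(k, M)\<in>(SIGMA k:{1..n}. mpartitions (n - k)).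
       scale (F (add_mset k M) / of_nat (zmset M)) (power_sum k * pmset M))"
  proof (rule sum.reindex_bij_witness[where j = "\<lambda>(M, k). (k, M - {#k#})" and i = "\<lambda>(k, M). (add_mset k M, k)"])
    fix p assume "p \<in> (SIGMA M:mpartitions n. set_mset M)"
    then obtain M k where p: "p = (M, k)" "M \<in> mpartitions n" "k \<in># M" by auto
    define N where "N = M - {#k#}"
    have M: "M = add_mset k N" using p by (simp add: N_def)
    have k: "0 < k" using p by (auto simp: mpartitions_def intro!: gr0I)
    have N: "0 \<notin># N" "sum_mset N = n - k" "k \<le> n"
      using p(2) by (auto simp: M mpartitions_def)
    show "(case case p of (M, k) \<Rightarrow> (k, M - {#k#}) of (k, M) \<Rightarrow> (add_mset k M, k)) = p"
      by (simp add: p M)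
    show "(case p of (M, k) \<Rightarrow> (k, M - {#k#})) \<in> (SIGMA k:{1..n}. mpartitions (n - k))"
      using N k by (auto simp: p M mpartitions_def)
    have "(of_nat (count M k * k) * F M / of_nat (zmset M) :: rat) = F (add_mset k N) / of_nat (zmset N)"
    proof -
      \<comment> \<open>\<open>t\<close> is the quotient of \<open>zmset M\<close> by
        \<open>zmset N\<close>, so it cancels.\<close>
      define t where "t = k * Suc (count N k)"
      have "t \<noteq> 0" using k by (simp add: t_def)
      moreover have "count M k * k = t" "zmset M = zmset N * t"
        by (simp_all add: M t_def zmset_add_mset)
      ultimately show ?thesis by (simp add: M)
    qed
    then show "(case case p of (M, k) \<Rightarrow> (k, M - {#k#}) of (k, M) \<Rightarrow>
           scale (F (add_mset k M) / of_nat (zmset M)) (power_sum k * pmset M)) =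
         (case p of (M, k) \<Rightarrow> scale (of_nat (count M k * k) * F M / of_nat (zmset M)) (pmset M))"
      unfolding p prod.case by (simp only: M add_mset_remove_trivial pmset_add_mset)
  qed (auto simp: mpartitions_def)
  also have "\<dots> = (\<Sum>k=1..n. \<Sum>M\<in>mpartitions (n - k).
       scale (F (add_mset k M) / of_nat (zmset M)) (power_sum k * pmset M))"
    by (rule sum.Sigma[symmetric]) auto
  finally show ?thesis .
qed

lemma mpartitions_0: "mpartitions 0 = {{#}}"
proof -
  have "M = {#}" if "0 \<notin># M" "sum_mset M = 0" for M :: "nat multiset"
    using that by (cases M) auto
  then show ?thesis by (auto simp: mpartitions_def)
qed

text \<open>Induction on the degree: after multiplication by \<open>deg m\<close> both sides satisfy
  the same recursion, the left one by \<open>hprod_newton\<close> and the right one by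
  \<open>sum_mpartitions_remove\<close> with \<open>F M\<close> the coefficient of \<open>m\<close>
  in \<open>pmset M\<close>.\<close>

lemma hprod_expansion_mset:
  "hprod m = (\<Sum>M\<in>mpartitions (deg m). scale (coeff (pmset M) m / of_nat (zmset M)) (pmset M))"
proof (induction "deg m" arbitrary: m rule: less_induct)
  case less
  let ?n = "deg m"
  let ?L = "Poly_Mapping.lookup m"
  show ?case
  proof (cases "?n = 0")
    case True
    then show ?thesis
      by (simp add: mpartitions_0 hprod_def coeff_1 zmset_def)
  next
    case False
    have *: "power_sum k * hprod (m - Poly_Mapping.single i k) =
        (\<Sum>M\<in>mpartitions (?n - k). scale (coeff (pmset M) (m - Poly_Mapping.single i k) / of_nat (zmset M))
           (power_sum k * pmset M))" if "1 \<le> k" "k \<le> ?L i" for i k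
    proof -
      have d: "deg (m - Poly_Mapping.single i k) = ?n - k"
        using that by (simp add: deg_minus_single)
      then have "deg (m - Poly_Mapping.single i k) < ?n"
        using that lookup_le_deg[of m i] by linarith
      from less[OF this] show ?thesis unfolding d by (simp add: sum_distrib_left)
    qed
    have "scale (of_nat ?n) (\<Sum>M\<in>mpartitions ?n. scale (coeff (pmset M) m / of_nat (zmset M)) (pmset M)) =
        (\<Sum>M\<in>mpartitions ?n. scale (of_nat ?n * coeff (pmset M) m / of_nat (zmset M)) (pmset M))"
      by (simp add: pseries.scale_sum_right)
    also have "\<dots> = (\<Sum>k=1..?n. \<Sum>M\<in>mpartitions (?n - k).
        scale (coeff (pmset (add_mset k M)) m / of_nat (zmset M)) (power_sum k * pmset M))"
      by (rule sum_mpartitions_remove)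
    also have "\<dots> = (\<Sum>k=1..?n. \<Sum>i | k \<le> ?L i. power_sum k * hprod (m - Poly_Mapping.single i k))"
    proof (rule sum.cong[OF refl])
      fix k assume k: "k \<in> {1..?n}"
      have "(\<Sum>M\<in>mpartitions (?n - k).
          scale (coeff (pmset (add_mset k M)) m / of_nat (zmset M)) (power_sum k * pmset M)) =
        (\<Sum>M\<in>mpartitions (?n - k). \<Sum>i | k \<le> ?L i.
          scale (coeff (pmset M) (m - Poly_Mapping.single i k) / of_nat (zmset M)) (power_sum k * pmset M))"
        using k by (simp add: coeff_power_sum_mult sum_divide_distrib pseries.scale_sum_left)
      also have "\<dots> = (\<Sum>i | k \<le> ?L i. \<Sum>M\<in>mpartitions (?n - k).
          scale (coeff (pmset M) (m - Poly_Mapping.single i k) / of_nat (zmset M)) (power_sum k * pmset M))"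
        by (rule sum.swap)
      also have "\<dots> = (\<Sum>i | k \<le> ?L i. power_sum k * hprod (m - Poly_Mapping.single i k))"
        by (rule sum.cong[OF refl], rule *[symmetric]) (use k in auto)
      finally show "(\<Sum>M\<in>mpartitions (?n - k).
          scale (coeff (pmset (add_mset k M)) m / of_nat (zmset M)) (power_sum k * pmset M)) =
        (\<Sum>i | k \<le> ?L i. power_sum k * hprod (m - Poly_Mapping.single i k))" .
    qed
    \<comment> \<open>As \<open>k\<close> is at least 1, \<open>k \<le> ?L i\<close> forces
      \<open>i\<close> into the keys, a finite set independent of \<open>k\<close>, as the exchange
      of the two sums requires.\<close>
    also have "\<dots> = (\<Sum>k=1..?n. \<Sum>i | i \<in> Poly_Mapping.keys m \<and> k \<le> ?L i.
        power_sum k * hprod (m - Poly_Mapping.single i k))"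
    proof (rule sum.cong[OF refl])
      fix k assume k: "k \<in> {1..?n}"
      then have "{i. k \<le> ?L i} = {i. i \<in> Poly_Mapping.keys m \<and> k \<le> ?L i}"
        by (force simp: in_keys_iff)
      then show "(\<Sum>i | k \<le> ?L i. power_sum k * hprod (m - Poly_Mapping.single i k)) =
          (\<Sum>i | i \<in> Poly_Mapping.keys m \<and> k \<le> ?L i. power_sum k * hprod (m - Poly_Mapping.single i k))"
        by (simp only:)
    qed
    also have "\<dots> = (\<Sum>i\<in>Poly_Mapping.keys m. \<Sum>k | k \<in> {1..?n} \<and> k \<le> ?L i.
        power_sum k * hprod (m - Poly_Mapping.single i k))"
      by (rule sum.swap_restrict) auto
    also have "\<dots> = (\<Sum>i\<in>Poly_Mapping.keys m. \<Sum>k=1..?L i. power_sum k * hprod (m - Poly_Mapping.single i k))"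
    proof (rule sum.cong[OF refl])
      fix i
      have "{k. k \<in> {1..?n} \<and> k \<le> ?L i} = {1..?L i}"
        using lookup_le_deg[of m i] by auto
      then show "(\<Sum>k | k \<in> {1..?n} \<and> k \<le> ?L i. power_sum k * hprod (m - Poly_Mapping.single i k)) =
        (\<Sum>k=1..?L i. power_sum k * hprod (m - Poly_Mapping.single i k))"
        by (simp only:)
    qed
    also have "\<dots> = scale (of_nat ?n) (hprod m)"
      by (rule hprod_newton[symmetric])
    finally show ?thesis using False by (metis of_nat_eq_0_iff pseries.scale_left_imp_eq)
  qed
qed

lemma hprod_expansion:
  "hprod m = (\<Sum>\<rho>\<in>partitions (deg m).
     scale (coeff (power_sum_part \<rho>) m / of_nat (z_part \<rho>)) (power_sum_part \<rho>))"
  unfolding hprod_expansion_mset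
  by (subst sum.reindex_bij_betw[OF bij_betw_mset_partitions, symmetric])
     (simp add: pmset_mset zmset_mset)

section \<open>Linear independence of the products of power sums\<close>

lemma coeff_pmset_nonneg: "0 \<notin># M \<Longrightarrow> 0 \<le> coeff (pmset M) m"
proof (induction M arbitrary: m)
  case (add k M)
  then have "0 < k" by (auto intro: gr0I)
  with add show ?case by (auto simp: coeff_power_sum_mult intro!: sum_nonneg)
qed (simp add: coeff_1)

text \<open>The type of the monomial: its nonzero exponents, read as a partition.\<close>

definition exponents :: "(nat \<Rightarrow>\<^sub>0 nat) \<Rightarrow> nat multiset" where
  "exponents m = image_mset (Poly_Mapping.lookup m) (mset_set (Poly_Mapping.keys m))"

lemma size_exponents: "size (exponents m) = card (Poly_Mapping.keys m)"
  by (simp add: exponents_def)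

lemma keys_add_single:
  "0 < k \<Longrightarrow> Poly_Mapping.keys (m + Poly_Mapping.single i k) = insert i (Poly_Mapping.keys (m :: nat \<Rightarrow>\<^sub>0 nat))"
  by (auto simp: in_keys_iff lookup_add lookup_single when_def split: if_splits)

lemma exponents_add_single:
  assumes "0 < k" "i \<notin> Poly_Mapping.keys m"
  shows "exponents (m + Poly_Mapping.single i k) = add_mset k (exponents m)"
proof -
  have "image_mset (Poly_Mapping.lookup (m + Poly_Mapping.single i k)) (mset_set (Poly_Mapping.keys m)) = exponents m"
    unfolding exponents_def using assms
    by (intro image_mset_cong) (auto simp: lookup_add lookup_single when_def)
  then show ?thesis
    using assms by (simp add: exponents_def keys_add_single lookup_add in_keys_iff)
qed

lemma ex_exponents: "0 \<notin># M \<Longrightarrow> \<exists>m. exponents m = M"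
proof (induction M)
  case empty
  have "exponents 0 = {#}" by (simp add: exponents_def)
  then show ?case ..
next
  case (add k M)
  then obtain m where m: "exponents m = M" by auto
  obtain i where "i \<notin> Poly_Mapping.keys m"
    using ex_new_if_finite[OF infinite_UNIV_nat finite_keys] by blast
  with m add.prems show ?case
    by (metis exponents_add_single gr0I union_single_eq_member)
qed

text \<open>Multiplying by a power sum either creates a new variable or enlarges the exponent of an old one.\<close>

lemma coeff_pmset_nonzero:
  assumes "0 \<notin># M" "coeff (pmset M) m \<noteq> 0"
  shows "size (exponents m) \<le> size M \<and> (size (exponents m) = size M \<longrightarrow> exponents m = M)"
  using assms
proof (induction M arbitrary: m)
  case empty
  then show ?case by (auto simp: coeff_1 exponents_def split: if_splits)
next
  case (add k M)
  then have k: "0 < k" by (auto intro: gr0I)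
  then have "(\<Sum>i | k \<le> Poly_Mapping.lookup m i. coeff (pmset M) (m - Poly_Mapping.single i k)) \<noteq> 0"
    using add.prems by (simp add: coeff_power_sum_mult)
  then obtain i where i: "k \<le> Poly_Mapping.lookup m i" "coeff (pmset M) (m - Poly_Mapping.single i k) \<noteq> 0"
    by (metis (mono_tags, lifting) mem_Collect_eq sum.neutral)
  define m' where "m' = m - Poly_Mapping.single i k"
  have m: "m = m' + Poly_Mapping.single i k"
    using minus_single_add[OF i(1)] by (simp add: m'_def)
  have IH: "size (exponents m') \<le> size M \<and> (size (exponents m') = size M \<longrightarrow> exponents m' = M)"
    using add i by (simp add: m'_def)
  show ?case
  proof (cases "i \<in> Poly_Mapping.keys m'")
    case True
    then have "size (exponents m) = size (exponents m')"
      by (simp add: size_exponents m keys_add_single[OF k] insert_absorb)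
    with IH show ?thesis by simp
  next
    case False
    with IH k show ?thesis by (auto simp: m exponents_add_single)
  qed
qed

text \<open>Take \<open>x_i^k\<close> from the factor \<open>p_k\<close> for a variable whose
  exponent is exactly \<open>k\<close>: what remains has type \<open>M\<close>. All other
  contributions are nonnegative, so nothing cancels.\<close>

lemma coeff_pmset_exponents_pos:
  assumes "0 \<notin># M" "exponents m = M"
  shows "0 < coeff (pmset M) m"
  using assms
proof (induction M arbitrary: m)
  case empty
  then have "m = 0" by (simp add: exponents_def mset_set_empty_iff)
  then show ?case by (simp add: coeff_1)
next
  case (add k M)
  then have k: "0 < k" by (auto intro: gr0I)
  have "k \<in># exponents m" using add.prems by simp
  then obtain i where i: "Poly_Mapping.lookup m i = k"
    by (auto simp: exponents_def)
  define m' where "m' = m - Poly_Mapping.single i k"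
  have m: "m = m' + Poly_Mapping.single i k"
    using minus_single_add[of k m i] i by (simp add: m'_def)
  have "i \<notin> Poly_Mapping.keys m'"
    using i by (simp add: m'_def in_keys_iff lookup_minus)
  then have "exponents m' = M"
    using add.prems by (simp add: m exponents_add_single[OF k])
  then have "0 < coeff (pmset M) m'" using add by simp
  then have "0 < (\<Sum>i | k \<le> Poly_Mapping.lookup m i. coeff (pmset M) (m - Poly_Mapping.single i k))"
    using i add.prems k
    by (intro sum_pos2[of _ i]) (auto simp: m'_def finite_ge_lookup intro: coeff_pmset_nonneg)
  then show ?case using k by (simp add: coeff_power_sum_mult)
qed

text \<open>Among the multisets with nonzero coefficient take one, \<open>N\<close>, with the most
  parts, and compare coefficients of a monomial of type \<open>N\<close>: by
  \<open>coeff_pmset_nonzero\<close> it occurs in no other product that has a nonzero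
  coefficient.\<close>

lemma pmset_independent:
  assumes "finite R" "\<And>M. M \<in> R \<Longrightarrow> 0 \<notin># M" "(\<Sum>M\<in>R. scale (c M) (pmset M)) = 0" "M \<in> R"
  shows "c M = 0"
proof (rule ccontr)
  assume "c M \<noteq> 0"
  define S where "S = {M \<in> R. c M \<noteq> 0}"
  have S: "S \<noteq> {}" "finite S" using assms \<open>c M \<noteq> 0\<close> by (auto simp: S_def)
  then have "Max (size ` S) \<in> size ` S" by (intro Max_in) auto
  then obtain N where "N \<in> S" "size N = Max (size ` S)" by auto
  moreover have "size M \<le> Max (size ` S)" if "M \<in> S" for M using that S by simp
  ultimately have N: "N \<in> R" "c N \<noteq> 0" "\<And>M. M \<in> R \<Longrightarrow> c M \<noteq> 0 \<Longrightarrow> size M \<le> size N"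
    by (auto simp: S_def)
  obtain m where m: "exponents m = N" using ex_exponents N assms(2) by blast
  have "0 = (\<Sum>M\<in>R. c M * coeff (pmset M) m)"
    using arg_cong[OF assms(3), of "\<lambda>f. coeff f m"] by simp
  also have "\<dots> = (\<Sum>M\<in>R. if M = N then c N * coeff (pmset N) m else 0)"
  proof (rule sum.cong[OF refl])
    fix M assume M: "M \<in> R"
    show "c M * coeff (pmset M) m = (if M = N then c N * coeff (pmset N) m else 0)"
      using coeff_pmset_nonzero[of M m] assms(2)[OF M] N(3)[OF M] m by force
  qed
  also have "\<dots> = c N * coeff (pmset N) m" using assms(1) N(1) by simp
  finally show False
    using N coeff_pmset_exponents_pos[OF assms(2) m] by auto
qed

text \<open>\<open>schur_coeff\<close> and \<open>power_sum_coeff\<close> are coordinates at a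
  vector, not at an index. Reading them off an indexed sum requires the family to be injective and
  its image to be independent.\<close>

lemma pseries_family_independent:
  assumes "\<And>R c i. finite R \<Longrightarrow> R \<subseteq> I \<Longrightarrow> (\<Sum>i\<in>R. scale (c i) (e i)) = 0 \<Longrightarrow> i \<in> R \<Longrightarrow> c i = 0"
  shows "inj_on e I" "pseries.independent (e ` I)"
proof -
  show inj: "inj_on e I"
  proof (rule inj_onI, rule ccontr)
    fix i j assume ij: "i \<in> I" "j \<in> I" "e i = e j" "i \<noteq> j"
    \<comment> \<open>If \<open>e i = e j\<close>, the difference \<open>e i - e j\<close> is a
      vanishing combination with coefficients 1 and -1.\<close>
    have "(\<Sum>l\<in>{i, j}. scale (if l = i then 1 else -1) (e l)) = 0"
      using ij by (simp add: pseries.scale_minus_left)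
    from assms[OF _ _ this, of i] ij show False by simp
  qed
  show "pseries.independent (e ` I)"
    unfolding pseries.independent_explicit_finite_subsets
  proof (intro allI impI)
    fix S u assume S: "S \<subseteq> e ` I" "finite S" "(\<Sum>v\<in>S. scale (u v) v) = 0"
    obtain R where R: "R \<subseteq> I" "inj_on e R" "S = e ` R"
      using S(1) by (auto simp: subset_image_inj)
    have "(\<Sum>i\<in>R. scale (u (e i)) (e i)) = 0" "finite R"
      using S R by (auto simp: sum.reindex finite_image_iff)
    from assms[OF this(2) R(1) this(1)] show "\<forall>v\<in>S. u v = 0" using R by auto
  qed
qed

lemma representation_family:
  assumes "inj_on e I" "pseries.independent (e ` I)" "finite R" "R \<subseteq> I" "j \<in> I"
  shows "pseries.representation (e ` I) (\<Sum>i\<in>R. scale (c i) (e i)) (e j) = (if j \<in> R then c j else 0)"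
proof -
  have e: "e i \<in> e ` I" "e i \<in> pseries.span (e ` I)" if "i \<in> R" for i
    using that assms(4) by (auto intro: pseries.span_base)
  have "pseries.representation (e ` I) (\<Sum>i\<in>R. scale (c i) (e i)) (e j) =
      (\<Sum>i\<in>R. pseries.representation (e ` I) (scale (c i) (e i)) (e j))"
    by (subst pseries.representation_sum[OF assms(2)]) (auto intro: pseries.span_scale e)
  also have "\<dots> = (\<Sum>i\<in>R. c i * (if e j = e i then 1 else 0))"
    by (rule sum.cong)
       (auto simp: pseries.representation_scale[OF assms(2)] pseries.representation_basis[OF assms(2)] e)
  also have "\<dots> = (\<Sum>i\<in>R. if i = j then c i else 0)"
    using assms by (intro sum.cong) (auto simp: inj_on_def subset_iff)
  also have "\<dots> = (if j \<in> R then c j else 0)" using assms(3) by simp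
  finally show ?thesis .
qed

lemma power_sum_part_independent:
  assumes R: "finite R" "R \<subseteq> Collect is_partition"
    "(\<Sum>\<rho>\<in>R. scale (c \<rho>) (power_sum_part \<rho>)) = 0" "\<rho> \<in> R"
  shows "c \<rho> = 0"
proof -
  have pos: "0 \<notin># M" if M: "M \<in> mset ` R" for M
  proof -
    obtain \<sigma> where "M = mset \<sigma>" "is_partition \<sigma>" using M R(2) by auto
    then show ?thesis by (auto simp: is_partition_def)
  qed
  have inj: "inj_on mset R" using R(2) by (auto simp: inj_on_def) (metis mem_Collect_eq part_of_mset_mset subsetD)
  have "(\<Sum>M\<in>mset ` R. scale (c (part_of_mset M)) (pmset M)) =
      (\<Sum>\<rho>\<in>R. scale (c (part_of_mset (mset \<rho>))) (power_sum_part \<rho>))"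
    by (subst sum.reindex[OF inj]) (simp add: pmset_mset)
  also have "\<dots> = (\<Sum>\<rho>\<in>R. scale (c \<rho>) (power_sum_part \<rho>))"
    using R(2) by (intro sum.cong) (auto simp: part_of_mset_mset)
  also have "\<dots> = 0" by (rule R)
  finally have "c (part_of_mset (mset \<rho>)) = 0"
    by (intro pmset_independent[of "mset ` R" "\<lambda>M. c (part_of_mset M)"]) (use R pos in auto)
  then show ?thesis using R by (simp add: part_of_mset_mset subset_iff)
qed

lemma power_sum_part_basis:
  shows "inj_on power_sum_part (Collect is_partition)"
    and "pseries.independent (power_sum_part ` Collect is_partition)"
  by (rule pseries_family_independent; use power_sum_part_independent in blast)+

lemma power_sum_coeff_sum:
  assumes "finite R" "R \<subseteq> Collect is_partition" "is_partition \<sigma>"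
  shows "power_sum_coeff (\<Sum>\<rho>\<in>R. scale (c \<rho>) (power_sum_part \<rho>)) \<sigma> = (if \<sigma> \<in> R then c \<sigma> else 0)"
  unfolding power_sum_coeff_def using assms power_sum_part_basis
  by (intro representation_family) auto

subsection \<open>Tableaux and horizontal strips\<close>

text \<open>Shapes are functions giving row lengths, zero from some row on, so that strips and the
  local rule can be stated row by row without reference to list lengths.\<close>

definition finsupp :: "(nat \<Rightarrow> nat) \<Rightarrow> bool" where
  "finsupp f \<longleftrightarrow> finite {i. f i \<noteq> 0}"

definition sz :: "(nat \<Rightarrow> nat) \<Rightarrow> nat" where
  "sz f = (\<Sum>i | f i \<noteq> 0. f i)"

definition cells :: "(nat \<Rightarrow> nat) \<Rightarrow> (nat \<times> nat) set" where
  "cells f = {(i, j). j < f i}"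

text \<open>For partitions, \<open>horizontal_strip \<nu> f\<close> says that the skew shape \<open>f/\<nu>\<close> has no two cells in one column.\<close>

definition horizontal_strip :: "(nat \<Rightarrow> nat) \<Rightarrow> (nat \<Rightarrow> nat) \<Rightarrow> bool" where
  "horizontal_strip \<nu> f \<longleftrightarrow> (\<forall>i. \<nu> i \<le> f i \<and> f (Suc i) \<le> \<nu> i)"

definition remove_strips :: "nat \<Rightarrow> (nat \<Rightarrow> nat) \<Rightarrow> (nat \<Rightarrow> nat) set" where
  "remove_strips a f = {\<nu>. horizontal_strip \<nu> f \<and> sz f = sz \<nu> + a}"

definition add_strips :: "nat \<Rightarrow> (nat \<Rightarrow> nat) \<Rightarrow> (nat \<Rightarrow> nat) set" where
  "add_strips k \<mu> = {f. horizontal_strip \<mu> f \<and> sz f = sz \<mu> + k}"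

lemma finsupp_le: "finsupp f \<Longrightarrow> (\<And>i. g i \<le> f i) \<Longrightarrow> finsupp g"
  unfolding finsupp_def
  by (erule finite_subset[rotated]) (metis (mono_tags, lifting) le_zero_eq mem_Collect_eq subsetI)

lemma sz_eq_sum:
  assumes "\<And>i. N \<le> i \<Longrightarrow> f i = 0"
  shows "sz f = sum f {..<N}"
  unfolding sz_def
proof (rule sum.mono_neutral_left)
  show "{i. f i \<noteq> 0} \<subseteq> {..<N}"
    using assms by (metis (mono_tags, lifting) lessThan_iff linorder_not_le mem_Collect_eq subsetI)
qed auto

lemma finsupp_bound: "finsupp f \<Longrightarrow> \<exists>N. \<forall>i\<ge>N. f i = 0"
proof -
  assume "finsupp f"
  then obtain N where "\<forall>i\<in>{i. f i \<noteq> 0}. i < N"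
    unfolding finsupp_def by (metis finite_nat_set_iff_bounded)
  then show ?thesis by (metis (mono_tags, lifting) linorder_not_le mem_Collect_eq)
qed

lemma finsuppI: "(\<And>i. N \<le> i \<Longrightarrow> f i = 0) \<Longrightarrow> finsupp f"
  unfolding finsupp_def by (rule finite_subset[of _ "{..<N}"]) (metis (mono_tags, lifting) lessThan_iff linorder_not_le mem_Collect_eq subsetI, simp)

lemma le_sz: "finsupp f \<Longrightarrow> f i \<le> sz f"
  unfolding finsupp_def sz_def by (cases "f i = 0") (auto intro: member_le_sum)

lemma sz_mono:
  assumes "finsupp f" "\<And>i. g i \<le> f i"
  shows "sz g \<le> sz f"
proof -
  obtain N where N: "\<forall>i\<ge>N. f i = 0" using finsupp_bound assms by blast
  then have "\<forall>i\<ge>N. g i = 0" using assms(2) by (metis le_zero_eq)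
  then show ?thesis using N assms(2) by (simp add: sz_eq_sum[of N] sum_mono)
qed

lemma finite_le_finsupp:
  assumes "finsupp f"
  shows "finite {g. \<forall>i. g i \<le> f i}"
proof (rule finite_subset)
  let ?S = "{i. f i \<noteq> 0}"
  show "{g. \<forall>i. g i \<le> f i} \<subseteq> {g. \<forall>i. (i \<in> ?S \<longrightarrow> g i \<in> {..sz f}) \<and> (i \<notin> ?S \<longrightarrow> g i = 0)}"
    using le_sz[OF assms] by (auto intro: order_trans) (metis le_zero_eq)
  show "finite {g. \<forall>i. (i \<in> ?S \<longrightarrow> g i \<in> {..sz f}) \<and> (i \<notin> ?S \<longrightarrow> g i = 0)}"
    using assms by (intro finite_set_of_finite_funs) (auto simp: finsupp_def)
qed

lemma finite_remove_strips [simp]: "finsupp f \<Longrightarrow> finite (remove_strips a f)"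
  by (rule finite_subset[OF _ finite_le_finsupp]) (auto simp: remove_strips_def horizontal_strip_def)

lemma remove_strips_finsupp: "finsupp f \<Longrightarrow> \<nu> \<in> remove_strips a f \<Longrightarrow> finsupp \<nu>"
  by (erule finsupp_le) (auto simp: remove_strips_def horizontal_strip_def)

lemma horizontal_strip_finsupp:
  assumes "finsupp \<mu>" "horizontal_strip \<mu> f"
  shows "finsupp f"
proof -
  obtain N where N: "\<forall>i\<ge>N. \<mu> i = 0" using finsupp_bound assms by blast
  show ?thesis
  proof (rule finsuppI[of "Suc N"])
    fix i assume i: "Suc N \<le> i"
    then obtain j where "i = Suc j" by (cases i) auto
    then show "f i = 0" using N i assms(2) by (auto simp: horizontal_strip_def) (metis le_zero_eq)
  qed
qed

lemma finite_add_strips [simp]: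
  assumes "finsupp \<mu>"
  shows "finite (add_strips k \<mu>)"
proof (rule finite_subset)
  \<comment> \<open>Each later row of a strip extension is bounded by the preceding row of
    \<open>\<mu>\<close>, and row 0 by the total size.\<close>
  let ?g = "\<lambda>i. case i of 0 \<Rightarrow> sz \<mu> + k | Suc j \<Rightarrow> \<mu> j"
  obtain N where N: "\<forall>i\<ge>N. \<mu> i = 0" using finsupp_bound assms by blast
  have "finsupp ?g" by (rule finsuppI[of "Suc N"]) (use N in \<open>auto split: nat.split\<close>)
  then show "finite {f. \<forall>i. f i \<le> ?g i}" by (rule finite_le_finsupp)
  show "add_strips k \<mu> \<subseteq> {f. \<forall>i. f i \<le> ?g i}"
  proof
    fix f assume f: "f \<in> add_strips k \<mu>"
    then have "finsupp f" using horizontal_strip_finsupp[OF assms] by (auto simp: add_strips_def)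
    then have "f 0 \<le> sz \<mu> + k" using f le_sz[of f 0] by (simp add: add_strips_def)
    then show "f \<in> {f. \<forall>i. f i \<le> ?g i}"
      using f by (auto simp: add_strips_def horizontal_strip_def split: nat.split)
  qed
qed

lemma cells_eq_Sigma: "cells f = (SIGMA i:{i. f i \<noteq> 0}. {..<f i})"
  by (auto simp: cells_def)

lemma finite_cells [simp]: "finsupp f \<Longrightarrow> finite (cells f)"
  by (simp add: cells_eq_Sigma finsupp_def)

lemma card_cells: "finsupp f \<Longrightarrow> card (cells f) = sz f"
  by (simp add: cells_eq_Sigma finsupp_def sz_def)

section \<open>Semistandard tableaux and their branching rule\<close>

definition tableaux :: "(nat \<Rightarrow> nat) \<Rightarrow> (nat \<times> nat \<Rightarrow> nat) set" where
  "tableaux f = {T. (\<forall>p. p \<notin> cells f \<longrightarrow> T p = 0)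
      \<and> (\<forall>i j. Suc j < f i \<longrightarrow> T (i, j) \<le> T (i, Suc j))
      \<and> (\<forall>i j. j < f (Suc i) \<longrightarrow> T (i, j) < T (Suc i, j))}"

text \<open>\<open>n\<close> is the number of variables, and values of \<open>\<alpha>\<close> from
  \<open>n\<close> on are ignored. This makes \<open>n\<close> the parameter of the inductions that
  peel off the largest entry.\<close>

definition content_tableaux :: "nat \<Rightarrow> (nat \<Rightarrow> nat) \<Rightarrow> (nat \<Rightarrow> nat) \<Rightarrow> (nat \<times> nat \<Rightarrow> nat) set" where
  "content_tableaux n f \<alpha> =
    {T \<in> tableaux f. \<forall>k. card {p \<in> cells f. T p = k} = (if k < n then \<alpha> k else 0)}"

definition kostka :: "nat \<Rightarrow> (nat \<Rightarrow> nat) \<Rightarrow> (nat \<Rightarrow> nat) \<Rightarrow> nat" where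
  "kostka n f \<alpha> = card (content_tableaux n f \<alpha>)"

lemma content_tableaux_less:
  assumes "finsupp f" "T \<in> content_tableaux n f \<alpha>" "p \<in> cells f"
  shows "T p < n"
proof (rule ccontr)
  assume "\<not> T p < n"
  then have "card {q \<in> cells f. T q = T p} = 0" using assms by (simp add: content_tableaux_def)
  then have "{q \<in> cells f. T q = T p} = {}" using assms(1) by (subst (asm) card_0_eq) simp_all
  then show False using assms(3) by blast
qed

lemma tableaux_row_mono:
  assumes "T \<in> tableaux f" "j \<le> j'" "j' < f i"
  shows "T (i, j) \<le> T (i, j')"
  using assms(2,3)
proof (induction j' rule: dec_induct)
  case (step j')
  then have "T (i, j') \<le> T (i, Suc j')" using assms(1) by (auto simp: tableaux_def)
  with step show ?case by simp
qed simp

lemma down_closed_eq_lessThan: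
  assumes "finite D" "\<And>i j :: nat. j \<in> D \<Longrightarrow> i \<le> j \<Longrightarrow> i \<in> D"
  shows "D = {..<card D}"
proof (cases "D = {}")
  case False
  have "D = {..Max D}" using assms False by (auto intro: Max_ge Max_in)
  then show ?thesis by (metis card_atMost lessThan_Suc_atMost)
qed simp

text \<open>Rows increase weakly, so the entries below \<open>n\<close> fill an initial segment of
  each row, and their number is the row length of the subtableau they form.\<close>

definition inner_shape :: "nat \<Rightarrow> (nat \<Rightarrow> nat) \<Rightarrow> (nat \<times> nat \<Rightarrow> nat) \<Rightarrow> nat \<Rightarrow> nat" where
  "inner_shape n f T i = card {j. j < f i \<and> T (i, j) < n}"

definition restrict_tableau :: "(nat \<Rightarrow> nat) \<Rightarrow> (nat \<times> nat \<Rightarrow> nat) \<Rightarrow> nat \<times> nat \<Rightarrow> nat" where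
  "restrict_tableau \<nu> T p = (if p \<in> cells \<nu> then T p else 0)"

definition extend_tableau ::
    "nat \<Rightarrow> (nat \<Rightarrow> nat) \<Rightarrow> (nat \<Rightarrow> nat) \<Rightarrow> (nat \<times> nat \<Rightarrow> nat) \<Rightarrow> nat \<times> nat \<Rightarrow> nat" where
  "extend_tableau n f \<nu> T p = (if p \<in> cells \<nu> then T p else if p \<in> cells f then n else 0)"

lemma inner_shape_less_iff:
  assumes "T \<in> tableaux f"
  shows "j < inner_shape n f T i \<longleftrightarrow> j < f i \<and> T (i, j) < n"
proof -
  let ?D = "{j. j < f i \<and> T (i, j) < n}"
  have "?D = {..<card ?D}"
    by (rule down_closed_eq_lessThan) (auto dest: tableaux_row_mono[OF assms])
  then show ?thesis unfolding inner_shape_def by blast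
qed

lemma extend_tableau_mem:
  assumes f: "finsupp f" and \<nu>: "\<nu> \<in> remove_strips (\<alpha> n) f" and T: "T \<in> content_tableaux n \<nu> \<alpha>"
  shows "extend_tableau n f \<nu> T \<in> content_tableaux (Suc n) f \<alpha>"
proof -
  let ?E = "extend_tableau n f \<nu> T"
  have hs: "\<nu> i \<le> f i" "f (Suc i) \<le> \<nu> i" for i
    using \<nu> by (auto simp: remove_strips_def horizontal_strip_def)
  have sub: "cells \<nu> \<subseteq> cells f" using hs(1) by (auto simp: cells_def intro: less_le_trans)
  have fin: "finsupp \<nu>" using remove_strips_finsupp f \<nu> by blast
  have less: "T p < n" if "p \<in> cells \<nu>" for p
    using content_tableaux_less[OF fin T that] .
  have tab: "T \<in> tableaux \<nu>" using T by (simp add: content_tableaux_def)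
  have "?E \<in> tableaux f"
    unfolding tableaux_def mem_Collect_eq
  proof (intro conjI allI impI)
    fix p assume "p \<notin> cells f" then show "?E p = 0" using sub by (auto simp: extend_tableau_def)
  next
    fix i j assume "Suc j < f i"
    then show "?E (i, j) \<le> ?E (i, Suc j)"
      using less[of "(i, j)"] tab by (auto simp: extend_tableau_def cells_def tableaux_def)
  next
    fix i j assume j: "j < f (Suc i)"
    \<comment> \<open>By the strip condition, a cell directly above a cell of \<open>f\<close> lies
      in \<open>\<nu>\<close>, so its entry is below \<open>n\<close>; this keeps the columns
      strict.\<close>
    then have "(i, j) \<in> cells \<nu>" using hs(2)[of i] by (simp add: cells_def)
    then show "?E (i, j) < ?E (Suc i, j)"
      using less[of "(i, j)"] tab j by (auto simp: extend_tableau_def cells_def tableaux_def)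
  qed
  moreover have "card {p \<in> cells f. ?E p = k} = (if k < Suc n then \<alpha> k else 0)" for k
  proof -
    consider "k < n" | "k = n" | "n < k" by linarith
    then show ?thesis
    proof cases
      case 1
      then have "{p \<in> cells f. ?E p = k} = {p \<in> cells \<nu>. T p = k}"
        using sub by (auto simp: extend_tableau_def split: if_splits)
      then show ?thesis using T 1 by (simp add: content_tableaux_def)
    next
      case 2
      then have "{p \<in> cells f. ?E p = k} = cells f - cells \<nu>"
        using less by (force simp: extend_tableau_def split: if_splits)
      then show ?thesis using 2 \<nu> sub f fin
        by (simp add: card_Diff_subset card_cells remove_strips_def)
    next
      case 3
      then have eq: "{p \<in> cells f. ?E p = k} = {}"
        using less by (force simp: extend_tableau_def split: if_splits)
      show ?thesis unfolding eq using 3 by simp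
    qed
  qed
  ultimately show ?thesis by (simp add: content_tableaux_def)
qed

text \<open>Columns are strict, so the maximal entry \<open>n\<close> occurs at most once in each
  column and its cells form a horizontal strip; erasing them leaves a tableau.\<close>

lemma inner_shape_mem:
  assumes f: "finsupp f" and anti: "\<And>i. f (Suc i) \<le> f i" and T: "T \<in> content_tableaux (Suc n) f \<alpha>"
  shows "inner_shape n f T \<in> remove_strips (\<alpha> n) f"
    and "restrict_tableau (inner_shape n f T) T \<in> content_tableaux n (inner_shape n f T) \<alpha>"
proof -
  let ?\<nu> = "inner_shape n f T"
  let ?R = "restrict_tableau ?\<nu> T"
  have tab: "T \<in> tableaux f" using T by (simp add: content_tableaux_def)
  note iff = inner_shape_less_iff[OF tab]
  have le: "T p \<le> n" if "p \<in> cells f" for p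
    using content_tableaux_less[OF f T that] by simp
  have sub: "cells ?\<nu> \<subseteq> cells f" by (auto simp: cells_def iff)
  have hs: "?\<nu> i \<le> f i" for i using iff[of _ n i] by (metis leI less_irrefl)
  have fin: "finsupp ?\<nu>" by (rule finsupp_le[OF f hs])
  have cell: "p \<in> cells ?\<nu> \<longleftrightarrow> p \<in> cells f \<and> T p < n" for p
    by (cases p) (simp add: cells_def iff)
  have "f (Suc i) \<le> ?\<nu> i" for i
  proof (rule ccontr)
    \<comment> \<open>Consider column \<open>?\<nu> i\<close>, the first one of row \<open>i\<close>
      without an entry below \<open>n\<close>: the entry in row \<open>Suc i\<close> is at most
      \<open>n\<close>, so by strictness the one in row \<open>i\<close> would be below
      \<open>n\<close>.\<close>
    assume "\<not> f (Suc i) \<le> ?\<nu> i"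
    then have j: "?\<nu> i < f (Suc i)" by simp
    then have lt: "T (i, ?\<nu> i) < T (Suc i, ?\<nu> i)" using tab by (auto simp: tableaux_def)
    moreover have "T (Suc i, ?\<nu> i) \<le> n" using le j by (simp add: cells_def)
    ultimately have "\<not> ?\<nu> i < f i" using iff[of "?\<nu> i" n i] by auto
    then show False using j anti[of i] by simp
  qed
  moreover have "{p \<in> cells f. T p = n} = cells f - cells ?\<nu>"
    using cell le by force
  then have "card (cells f - cells ?\<nu>) = \<alpha> n"
    using T by (auto simp: content_tableaux_def dest!: spec[of _ n])
  then have "sz f - sz ?\<nu> = \<alpha> n"
    using sub f fin by (simp add: card_Diff_subset card_cells)
  ultimately show "?\<nu> \<in> remove_strips (\<alpha> n) f"
    using hs sz_mono[OF f hs] by (simp add: remove_strips_def horizontal_strip_def)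
  have "?R \<in> tableaux ?\<nu>"
    unfolding tableaux_def mem_Collect_eq
  proof (intro conjI allI impI)
    fix p assume "p \<notin> cells ?\<nu>" then show "?R p = 0" by (simp add: restrict_tableau_def)
  next
    fix i j assume "Suc j < ?\<nu> i"
    then show "?R (i, j) \<le> ?R (i, Suc j)"
      using tab by (simp add: restrict_tableau_def cells_def iff tableaux_def)
  next
    fix i j assume j: "j < ?\<nu> (Suc i)"
    then have "j < f (Suc i)" "T (Suc i, j) < n" by (simp_all add: iff)
    moreover from this(1) have "T (i, j) < T (Suc i, j)" "j < f i"
      using tab anti[of i] by (auto simp: tableaux_def)
    ultimately have "j < ?\<nu> i" by (simp add: iff)
    then show "?R (i, j) < ?R (Suc i, j)"
      using j \<open>T (i, j) < T (Suc i, j)\<close> by (simp add: restrict_tableau_def cells_def)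
  qed
  moreover have "card {p \<in> cells ?\<nu>. ?R p = k} = (if k < n then \<alpha> k else 0)" for k
  proof (cases "k < n")
    case True
    then have "{p \<in> cells ?\<nu>. ?R p = k} = {p \<in> cells f. T p = k}"
      by (auto simp: restrict_tableau_def cell)
    then show ?thesis using True T by (simp add: content_tableaux_def)
  next
    case False
    then have eq: "{p \<in> cells ?\<nu>. ?R p = k} = {}"
      by (auto simp: restrict_tableau_def cell)
    show ?thesis unfolding eq using False by simp
  qed
  ultimately show "?R \<in> content_tableaux n ?\<nu> \<alpha>" by (simp add: content_tableaux_def)
qed
text \<open>The branching rule: a tableau is determined by the subtableau of the entries below
  \<open>n\<close> and its shape, because \<open>n\<close> fills the remaining strip.\<close>

lemma content_tableaux_Suc:
  assumes f: "finsupp f" and anti: "\<And>i. f (Suc i) \<le> f i"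
  shows "bij_betw (\<lambda>(\<nu>, T). extend_tableau n f \<nu> T)
    (SIGMA \<nu>:remove_strips (\<alpha> n) f. content_tableaux n \<nu> \<alpha>) (content_tableaux (Suc n) f \<alpha>)"
proof (rule bij_betw_byWitness
    [where f' = "\<lambda>T. (inner_shape n f T, restrict_tableau (inner_shape n f T) T)"])
  let ?S = "SIGMA \<nu>:remove_strips (\<alpha> n) f. content_tableaux n \<nu> \<alpha>"
  have "inner_shape n f (extend_tableau n f \<nu> T) = \<nu>" "restrict_tableau \<nu> (extend_tableau n f \<nu> T) = T"
    if \<nu>: "\<nu> \<in> remove_strips (\<alpha> n) f" and T: "T \<in> content_tableaux n \<nu> \<alpha>" for \<nu> T
  proof -
    have less: "T p < n" if "p \<in> cells \<nu>" for p
      using content_tableaux_less[OF remove_strips_finsupp[OF f \<nu>] T that] .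
    have hs: "\<nu> i \<le> f i" for i
      using \<nu> by (auto simp: remove_strips_def horizontal_strip_def)
    have "{j. j < f i \<and> extend_tableau n f \<nu> T (i, j) < n} = {..<\<nu> i}" for i
      using less hs[of i] by (auto simp: extend_tableau_def cells_def split: if_splits)
    then show "inner_shape n f (extend_tableau n f \<nu> T) = \<nu>"
      by (auto simp: inner_shape_def)
    show "restrict_tableau \<nu> (extend_tableau n f \<nu> T) = T"
      using T by (auto simp: restrict_tableau_def extend_tableau_def content_tableaux_def tableaux_def)
  qed
  then show "\<forall>p\<in>?S. (\<lambda>T. (inner_shape n f T, restrict_tableau (inner_shape n f T) T))
      (case p of (\<nu>, T) \<Rightarrow> extend_tableau n f \<nu> T) = p"
    by auto
  show "\<forall>T\<in>content_tableaux (Suc n) f \<alpha>.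
      (case (inner_shape n f T, restrict_tableau (inner_shape n f T) T) of (\<nu>, T) \<Rightarrow> extend_tableau n f \<nu> T) = T"
  proof
    fix T assume T: "T \<in> content_tableaux (Suc n) f \<alpha>"
    then have tab: "T \<in> tableaux f" by (simp add: content_tableaux_def)
    have "extend_tableau n f (inner_shape n f T) (restrict_tableau (inner_shape n f T) T) p = T p" for p
    proof -
      have "p \<in> cells (inner_shape n f T) \<longleftrightarrow> p \<in> cells f \<and> T p < n"
        by (cases p) (simp add: cells_def inner_shape_less_iff[OF tab])
      moreover have "T p < Suc n" if "p \<in> cells f" using content_tableaux_less[OF f T that] .
      moreover have "T p = 0" if "p \<notin> cells f" using tab that unfolding tableaux_def by blast
      ultimately show ?thesis
        unfolding extend_tableau_def restrict_tableau_def by (metis less_antisym)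
    qed
    then show "(case (inner_shape n f T, restrict_tableau (inner_shape n f T) T) of (\<nu>, T) \<Rightarrow> extend_tableau n f \<nu> T) = T"
      unfolding prod.case by (rule ext)
  qed
  show "(\<lambda>(\<nu>, T). extend_tableau n f \<nu> T) ` ?S \<subseteq> content_tableaux (Suc n) f \<alpha>"
  proof (rule image_subsetI)
    fix p assume "p \<in> ?S"
    then show "(case p of (\<nu>, T) \<Rightarrow> extend_tableau n f \<nu> T) \<in> content_tableaux (Suc n) f \<alpha>"
      using extend_tableau_mem[OF f] by (cases p) simp
  qed
  show "(\<lambda>T. (inner_shape n f T, restrict_tableau (inner_shape n f T) T)) ` content_tableaux (Suc n) f \<alpha> \<subseteq> ?S"
  proof (rule image_subsetI)
    fix T assume "T \<in> content_tableaux (Suc n) f \<alpha>"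
    from inner_shape_mem[OF f anti this]
    show "(inner_shape n f T, restrict_tableau (inner_shape n f T) T) \<in> ?S" by simp
  qed
qed

lemma remove_strips_antimono:
  assumes "\<nu> \<in> remove_strips a f"
  shows "\<nu> (Suc i) \<le> \<nu> i"
  using assms by (auto simp: remove_strips_def horizontal_strip_def intro: order_trans)

lemma content_tableaux_0:
  assumes "finsupp f"
  shows "content_tableaux 0 f \<alpha> = (if f = (\<lambda>_. 0) then {\<lambda>_. 0} else {})"
proof (cases "f = (\<lambda>_. 0)")
  case True
  then show ?thesis by (auto simp: content_tableaux_def tableaux_def cells_def)
next
  case False
  then obtain i where "(i, 0) \<in> cells f" by (auto simp: cells_def)
  then have "T \<notin> content_tableaux 0 f \<alpha>" for T
    using content_tableaux_less[OF assms] by blast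
  then show ?thesis using False by auto
qed

lemma finite_content_tableaux:
  assumes "finsupp f" "\<And>i. f (Suc i) \<le> f i"
  shows "finite (content_tableaux n f \<alpha>)"
  using assms
proof (induction n arbitrary: f)
  case (Suc n)
  have "finite (SIGMA \<nu>:remove_strips (\<alpha> n) f. content_tableaux n \<nu> \<alpha>)"
  proof (rule finite_SigmaI)
    fix \<nu> assume "\<nu> \<in> remove_strips (\<alpha> n) f"
    then show "finite (content_tableaux n \<nu> \<alpha>)"
      by (intro Suc.IH remove_strips_antimono remove_strips_finsupp[OF Suc.prems(1)])
  qed (simp add: Suc.prems)
  then show ?case using bij_betw_finite[OF content_tableaux_Suc[OF Suc.prems]] by simp
qed (simp add: content_tableaux_0)

lemma kostka_0: "finsupp f \<Longrightarrow> kostka 0 f \<alpha> = (if f = (\<lambda>_. 0) then 1 else 0)"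
  by (simp add: kostka_def content_tableaux_0)

lemma kostka_Suc:
  assumes "finsupp f" "\<And>i. f (Suc i) \<le> f i"
  shows "kostka (Suc n) f \<alpha> = (\<Sum>\<nu>\<in>remove_strips (\<alpha> n) f. kostka n \<nu> \<alpha>)"
  unfolding kostka_def bij_betw_same_card[OF content_tableaux_Suc[OF assms], symmetric]
proof (rule card_SigmaI)
  show "\<forall>\<nu>\<in>remove_strips (\<alpha> n) f. finite (content_tableaux n \<nu> \<alpha>)"
    using finite_content_tableaux remove_strips_antimono remove_strips_finsupp[OF assms(1)] by blast
qed (simp add: assms)

lemma kostka_cong: "(\<And>i. i < n \<Longrightarrow> \<alpha> i = \<beta> i) \<Longrightarrow> kostka n f \<alpha> = kostka n f \<beta>"
  by (simp add: kostka_def content_tableaux_def cong: if_cong)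

lemma diagram_eq_cells: "diagram \<kappa> = cells (nth_default 0 \<kappa>)"
  by (auto simp: diagram_def cells_def nth_default_def split: if_splits)

text \<open>Any \<open>n\<close> bounding the variables of \<open>m\<close> will do, since beyond
  \<open>n\<close> both contents are 0. The coefficient thereby becomes a Kostka number, to which
  the recursion in \<open>n\<close> applies.\<close>

lemma coeff_schur:
  assumes "Poly_Mapping.keys m \<subseteq> {..<n}"
  shows "coeff (schur \<kappa>) m = of_nat (kostka n (nth_default 0 \<kappa>) (Poly_Mapping.lookup m))"
proof -
  have eq: "(if k < n then Poly_Mapping.lookup m k else 0) = Poly_Mapping.lookup m k" for k
  proof (cases "k < n")
    case False
    then have "k \<notin> Poly_Mapping.keys m" using assms by auto
    then show ?thesis using False by (simp add: in_keys_iff)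
  qed simp
  have "ssyt \<kappa> = tableaux (nth_default 0 \<kappa>)"
    unfolding ssyt_def tableaux_def diagram_eq_cells by (simp add: cells_def)
  then have "{T \<in> ssyt \<kappa>. \<forall>k. card {p \<in> diagram \<kappa>. T p = k} = Poly_Mapping.lookup m k} =
      content_tableaux n (nth_default 0 \<kappa>) (Poly_Mapping.lookup m)"
    by (simp only: content_tableaux_def eq diagram_eq_cells)
  then show ?thesis by (simp add: schur.rep_eq kostka_def)
qed

subsection \<open>The Pieri rule and Kostka numbers\<close>

text \<open>
  Fomin's local rule: for fixed \<open>\<mu>\<close> and \<open>\<nu>\<close>, the parts \<open>f (Suc i)\<close> of a common horizontal strip
  extension and the parts \<open>\<kappa> i\<close> of a common horizontal strip restriction run through the same
  interval, and are matched by reflecting it. The part \<open>f 0\<close> is free, its excess is \<open>j\<close>.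
\<close>

definition local_up :: "(nat \<Rightarrow> nat) \<Rightarrow> (nat \<Rightarrow> nat) \<Rightarrow> nat \<Rightarrow> (nat \<Rightarrow> nat) \<Rightarrow> nat \<Rightarrow> nat" where
  "local_up \<mu> \<nu> j \<kappa> i = (case i of 0 \<Rightarrow> max (\<mu> 0) (\<nu> 0) + j
     | Suc l \<Rightarrow> max (\<mu> (Suc l)) (\<nu> (Suc l)) + min (\<mu> l) (\<nu> l) - \<kappa> l)"

definition local_down :: "(nat \<Rightarrow> nat) \<Rightarrow> (nat \<Rightarrow> nat) \<Rightarrow> (nat \<Rightarrow> nat) \<Rightarrow> nat \<Rightarrow> nat" where
  "local_down \<mu> \<nu> f i = max (\<mu> (Suc i)) (\<nu> (Suc i)) + min (\<mu> i) (\<nu> i) - f (Suc i)"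

text \<open>Sum the local relations over all rows and use \<open>max x y + min x y = x + y\<close>;
  the maximum in row 0, absent from the shifted relations, is supplied by
  \<open>f 0\<close>.\<close>

lemma sz_local:
  assumes fin: "finsupp \<mu>" "finsupp \<nu>" "finsupp \<kappa>" "finsupp f"
    and 0: "f 0 = max (\<mu> 0) (\<nu> 0) + j"
    and Suc: "\<And>i. f (Suc i) + \<kappa> i = max (\<mu> (Suc i)) (\<nu> (Suc i)) + min (\<mu> i) (\<nu> i)"
  shows "sz f + sz \<kappa> = j + sz \<mu> + sz \<nu>"
proof -
  obtain A B C E where "\<forall>i\<ge>A. \<mu> i = 0" "\<forall>i\<ge>B. \<nu> i = 0" "\<forall>i\<ge>C. \<kappa> i = 0" "\<forall>i\<ge>E. f i = 0"
    using fin[THEN finsupp_bound] by blast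
  then obtain N where N: "\<forall>i\<ge>N. \<mu> i = 0" "\<forall>i\<ge>N. \<nu> i = 0" "\<forall>i\<ge>N. \<kappa> i = 0" "\<forall>i\<ge>N. f i = 0"
    using that[of "A + B + C + E"] by auto
  \<comment> \<open>\<open>f\<close> is summed over one row more than \<open>\<kappa>\<close>, so
    that splitting off \<open>f 0\<close> pairs \<open>f (Suc i)\<close> with
    \<open>\<kappa> i\<close>.\<close>
  have "sz f + sz \<kappa> = sum f {..<Suc N} + sum \<kappa> {..<N}"
    using N by (simp add: sz_eq_sum[of "Suc N" f] sz_eq_sum[of N \<kappa>])
  also have "\<dots> = f 0 + (\<Sum>i<N. f (Suc i) + \<kappa> i)"
    by (simp only: sum.lessThan_Suc_shift sum.distrib add.assoc)
  also have "\<dots> = j + (max (\<mu> 0) (\<nu> 0) + (\<Sum>i<N. max (\<mu> (Suc i)) (\<nu> (Suc i)))) + (\<Sum>i<N. min (\<mu> i) (\<nu> i))"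
    by (simp add: 0 Suc sum.distrib)
  also have "\<dots> = j + (\<Sum>i<Suc N. max (\<mu> i) (\<nu> i)) + (\<Sum>i<N. min (\<mu> i) (\<nu> i))"
    by (simp only: sum.lessThan_Suc_shift)
  also have "\<dots> = j + (\<Sum>i<N. max (\<mu> i) (\<nu> i) + min (\<mu> i) (\<nu> i))"
    using N by (simp add: sum.distrib)
  also have "\<dots> = j + (\<Sum>i<N. \<mu> i + \<nu> i)"
    by (simp add: max_def min_def if_distrib add.commute cong: if_cong)
  also have "\<dots> = j + sz \<mu> + sz \<nu>"
    using N by (simp add: sz_eq_sum[of N] sum.distrib)
  finally show ?thesis .
qed

text \<open>The strip conditions put \<open>f (Suc i)\<close> between
  \<open>max (\<mu> (Suc i)) (\<nu> (Suc i))\<close> and \<open>min (\<mu> i) (\<nu> i)\<close>.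
  Reflection sends it to \<open>\<kappa> i\<close> in the same interval, which says exactly that
  \<open>\<kappa>\<close> is a common strip restriction. The sizes come from
  \<open>sz_local\<close>.\<close>

lemma local_down_mem:
  assumes \<mu>: "finsupp \<mu>" and f: "f \<in> add_strips k \<mu>" and \<nu>: "\<nu> \<in> remove_strips a f"
  defines "j \<equiv> f 0 - max (\<mu> 0) (\<nu> 0)" and "\<kappa> \<equiv> local_down \<mu> \<nu> f"
  shows "j \<le> min k a" "\<kappa> \<in> remove_strips (a - j) \<mu>" "\<nu> \<in> add_strips (k - j) \<kappa>"
    "local_up \<mu> \<nu> j \<kappa> = f"
proof -
  have hs: "\<mu> i \<le> f i" "f (Suc i) \<le> \<mu> i" "\<nu> i \<le> f i" "f (Suc i) \<le> \<nu> i" for i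
    using f \<nu> by (auto simp: add_strips_def remove_strips_def horizontal_strip_def)
  have fin_f: "finsupp f" using f horizontal_strip_finsupp[OF \<mu>] by (simp add: add_strips_def)
  have fin_\<nu>: "finsupp \<nu>" by (rule finsupp_le[OF fin_f hs(3)])
  have \<kappa>: "\<kappa> i \<le> \<mu> i" "\<kappa> i \<le> \<nu> i" "\<mu> (Suc i) \<le> \<kappa> i" "\<nu> (Suc i) \<le> \<kappa> i"
    "f (Suc i) + \<kappa> i = max (\<mu> (Suc i)) (\<nu> (Suc i)) + min (\<mu> i) (\<nu> i)" for i
    using hs[of "Suc i"] hs[of i] unfolding \<kappa>_def local_down_def by linarith+
  have fin_\<kappa>: "finsupp \<kappa>" by (rule finsupp_le[OF \<mu> \<kappa>(1)])
  have 0: "f 0 = max (\<mu> 0) (\<nu> 0) + j" using hs[of 0] by (simp add: j_def)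
  have "sz f + sz \<kappa> = j + sz \<mu> + sz \<nu>"
    by (rule sz_local[OF \<mu> fin_\<nu> fin_\<kappa> fin_f 0 \<kappa>(5)])
  moreover have "sz f = sz \<mu> + k" "sz f = sz \<nu> + a"
    using f \<nu> by (auto simp: add_strips_def remove_strips_def)
  moreover have "sz \<kappa> \<le> sz \<mu>" "sz \<kappa> \<le> sz \<nu>"
    using sz_mono[OF \<mu> \<kappa>(1)] sz_mono[OF fin_\<nu> \<kappa>(2)] by simp_all
  ultimately have "j \<le> min k a" "sz \<mu> = sz \<kappa> + (a - j)" "sz \<nu> = sz \<kappa> + (k - j)" by linarith+
  then show "j \<le> min k a" "\<kappa> \<in> remove_strips (a - j) \<mu>" "\<nu> \<in> add_strips (k - j) \<kappa>"
    using \<kappa> by (auto simp: add_strips_def remove_strips_def horizontal_strip_def)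
  have "local_up \<mu> \<nu> j \<kappa> i = f i" for i
  proof (cases i)
    case (Suc l)
    then show ?thesis using \<kappa>(5)[of l] unfolding local_up_def by simp
  qed (simp add: local_up_def 0)
  then show "local_up \<mu> \<nu> j \<kappa> = f" by (rule ext)
qed

text \<open>The inverse reflection. The bound on \<open>j\<close> makes the truncated differences
  \<open>a - j\<close> and \<open>k - j\<close> exact.\<close>

lemma local_up_mem:
  assumes \<mu>: "finsupp \<mu>" and j: "j \<le> min k a" and \<kappa>: "\<kappa> \<in> remove_strips (a - j) \<mu>"
    and \<nu>: "\<nu> \<in> add_strips (k - j) \<kappa>"
  defines "f \<equiv> local_up \<mu> \<nu> j \<kappa>"
  shows "f \<in> add_strips k \<mu>" "\<nu> \<in> remove_strips a f"
    "f 0 - max (\<mu> 0) (\<nu> 0) = j" "local_down \<mu> \<nu> f = \<kappa>"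
proof -
  have hs: "\<kappa> i \<le> \<mu> i" "\<kappa> i \<le> \<nu> i" "\<mu> (Suc i) \<le> \<kappa> i" "\<nu> (Suc i) \<le> \<kappa> i" for i
    using \<kappa> \<nu> by (auto simp: add_strips_def remove_strips_def horizontal_strip_def)
  have fin_\<kappa>: "finsupp \<kappa>" by (rule finsupp_le[OF \<mu> hs(1)])
  have fin_\<nu>: "finsupp \<nu>" using \<nu> horizontal_strip_finsupp[OF fin_\<kappa>] by (simp add: add_strips_def)
  have 0: "f 0 = max (\<mu> 0) (\<nu> 0) + j" by (simp add: f_def local_up_def)
  have step: "f (Suc i) + \<kappa> i = max (\<mu> (Suc i)) (\<nu> (Suc i)) + min (\<mu> i) (\<nu> i)" for i
    using hs[of i] unfolding f_def local_up_def by simp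
  have f: "\<mu> i \<le> f i" "\<nu> i \<le> f i" "f (Suc i) \<le> \<mu> i" "f (Suc i) \<le> \<nu> i" for i
  proof -
    have "max (\<mu> i) (\<nu> i) \<le> f i"
    proof (cases i)
      case (Suc l)
      show ?thesis unfolding Suc using step[of l] hs[of l] by linarith
    qed (simp add: 0)
    then show "\<mu> i \<le> f i" "\<nu> i \<le> f i" by simp_all
    show "f (Suc i) \<le> \<mu> i" "f (Suc i) \<le> \<nu> i"
      using step[of i] hs[of i] by linarith+
  qed
  have fin_f: "finsupp f" by (rule horizontal_strip_finsupp[OF \<mu>]) (simp add: horizontal_strip_def f)
  have "sz f + sz \<kappa> = j + sz \<mu> + sz \<nu>"
    by (rule sz_local[OF \<mu> fin_\<nu> fin_\<kappa> fin_f 0 step])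
  moreover have "sz \<mu> = sz \<kappa> + (a - j)" "sz \<nu> = sz \<kappa> + (k - j)"
    using \<kappa> \<nu> by (auto simp: add_strips_def remove_strips_def)
  ultimately have "sz f = sz \<mu> + k" "sz f = sz \<nu> + a" using j by linarith+
  then show "f \<in> add_strips k \<mu>" "\<nu> \<in> remove_strips a f"
    using f by (auto simp: add_strips_def remove_strips_def horizontal_strip_def)
  show "f 0 - max (\<mu> 0) (\<nu> 0) = j" using 0 by simp
  have "local_down \<mu> \<nu> f i = \<kappa> i" for i using step[of i] unfolding local_down_def by simp
  then show "local_down \<mu> \<nu> f = \<kappa>" by (rule ext)
qed

text \<open>The local rule matches \<open>(f, \<nu>)\<close> with
  \<open>(j, \<kappa>, \<nu>)\<close> and keeps \<open>\<nu>\<close>, so the sums agree for every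
  \<open>F\<close>. Read with operators, this is the commutation relation between adding and
  removing strips.\<close>

lemma strips_commute:
  fixes F :: "(nat \<Rightarrow> nat) \<Rightarrow> nat"
  assumes \<mu>: "finsupp \<mu>"
  shows "(\<Sum>f\<in>add_strips k \<mu>. \<Sum>\<nu>\<in>remove_strips a f. F \<nu>) =
    (\<Sum>j\<le>min k a. \<Sum>\<kappa>\<in>remove_strips (a - j) \<mu>. \<Sum>\<nu>\<in>add_strips (k - j) \<kappa>. F \<nu>)"
proof -
  have fin_up: "finsupp f" if "f \<in> add_strips l \<kappa>" "finsupp \<kappa>" for f l \<kappa>
    using that horizontal_strip_finsupp by (auto simp: add_strips_def)
  let ?S = "SIGMA f:add_strips k \<mu>. remove_strips a f"
  let ?T = "SIGMA j:{..min k a}. SIGMA \<kappa>:remove_strips (a - j) \<mu>. add_strips (k - j) \<kappa>"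
  have "(\<Sum>f\<in>add_strips k \<mu>. \<Sum>\<nu>\<in>remove_strips a f. F \<nu>) = (\<Sum>(f, \<nu>)\<in>?S. F \<nu>)"
    by (rule sum.Sigma) (use \<mu> fin_up in auto)
  also have "\<dots> = (\<Sum>(j, \<kappa>, \<nu>)\<in>?T. F \<nu>)"
  proof (rule sum.reindex_bij_witness[where
        j = "\<lambda>(f, \<nu>). (f 0 - max (\<mu> 0) (\<nu> 0), local_down \<mu> \<nu> f, \<nu>)" and
        i = "\<lambda>(j, \<kappa>, \<nu>). (local_up \<mu> \<nu> j \<kappa>, \<nu>)"])
    fix p assume "p \<in> ?S"
    then obtain f \<nu> where p: "p = (f, \<nu>)" "f \<in> add_strips k \<mu>" "\<nu> \<in> remove_strips a f" by blast
    note down = local_down_mem[OF \<mu> p(2,3)]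
    show "(case case p of (f, \<nu>) \<Rightarrow> (f 0 - max (\<mu> 0) (\<nu> 0), local_down \<mu> \<nu> f, \<nu>) of
        (j, \<kappa>, \<nu>) \<Rightarrow> (local_up \<mu> \<nu> j \<kappa>, \<nu>)) = p"
      unfolding p(1) prod.case down(4) ..
    show "(case p of (f, \<nu>) \<Rightarrow> (f 0 - max (\<mu> 0) (\<nu> 0), local_down \<mu> \<nu> f, \<nu>)) \<in> ?T"
      unfolding p(1) prod.case by (intro SigmaI down) (simp add: down(1)[simplified])
    show "(case case p of (f, \<nu>) \<Rightarrow> (f 0 - max (\<mu> 0) (\<nu> 0), local_down \<mu> \<nu> f, \<nu>) of
        (j, \<kappa>, \<nu>) \<Rightarrow> F \<nu>) = (case p of (f, \<nu>) \<Rightarrow> F \<nu>)"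
      unfolding p(1) prod.case ..
  next
    fix q assume "q \<in> ?T"
    then obtain j \<kappa> \<nu> where q: "q = (j, \<kappa>, \<nu>)" "j \<le> min k a" "\<kappa> \<in> remove_strips (a - j) \<mu>"
      "\<nu> \<in> add_strips (k - j) \<kappa>" by blast
    note up = local_up_mem[OF \<mu> q(2-4)]
    show "(case case q of (j, \<kappa>, \<nu>) \<Rightarrow> (local_up \<mu> \<nu> j \<kappa>, \<nu>) of
        (f, \<nu>) \<Rightarrow> (f 0 - max (\<mu> 0) (\<nu> 0), local_down \<mu> \<nu> f, \<nu>)) = q"
      unfolding q(1) prod.case up(3,4) ..
    show "(case q of (j, \<kappa>, \<nu>) \<Rightarrow> (local_up \<mu> \<nu> j \<kappa>, \<nu>)) \<in> ?S"
      unfolding q(1) prod.case by (intro SigmaI up)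
  qed
  also have "\<dots> = (\<Sum>j\<le>min k a. \<Sum>(\<kappa>, \<nu>)\<in>(SIGMA \<kappa>:remove_strips (a - j) \<mu>. add_strips (k - j) \<kappa>). F \<nu>)"
    by (rule sum.Sigma[symmetric]) (use \<mu> in \<open>auto intro!: finite_SigmaI simp: remove_strips_finsupp[OF \<mu>]\<close>)
  also have "\<dots> = (\<Sum>j\<le>min k a. \<Sum>\<kappa>\<in>remove_strips (a - j) \<mu>. \<Sum>\<nu>\<in>add_strips (k - j) \<kappa>. F \<nu>)"
    by (intro sum.cong refl sum.Sigma[symmetric] ballI finite_add_strips finite_remove_strips \<mu>)
       (rule remove_strips_finsupp[OF \<mu>])
  finally show ?thesis .
qed

text \<open>Exponent vectors of the degree \<open>k\<close> divisors of \<open>x^\<alpha>\<close> in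
  the first \<open>n\<close> variables: the monomials that \<open>h_k\<close> can contribute to a
  product.\<close>

definition subexponents :: "nat \<Rightarrow> nat \<Rightarrow> (nat \<Rightarrow> nat) \<Rightarrow> (nat \<Rightarrow> nat) set" where
  "subexponents n k \<alpha> = {u. (\<forall>i. u i \<le> \<alpha> i) \<and> (\<forall>i\<ge>n. u i = 0) \<and> sum u {..<n} = k}"

lemma finite_subexponents [simp]: "finite (subexponents n k \<alpha>)"
proof (rule finite_subset)
  have "finsupp (\<lambda>i. if i < n then \<alpha> i else 0)" by (rule finsuppI[of n]) simp
  then show "finite {u. \<forall>i. u i \<le> (if i < n then \<alpha> i else 0)}" by (rule finite_le_finsupp)
qed (auto simp: subexponents_def)

text \<open>Splits off the exponent \<open>j\<close> of the last variable; its range is that of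
  \<open>j\<close> in \<open>strips_commute\<close>.\<close>

lemma sum_subexponents_Suc:
  fixes G :: "(nat \<Rightarrow> nat) \<Rightarrow> nat"
  shows "(\<Sum>u\<in>subexponents (Suc n) k \<alpha>. G u) =
    (\<Sum>j\<le>min k (\<alpha> n). \<Sum>u\<in>subexponents n (k - j) \<alpha>. G (u(n := j)))"
proof -
  have "(\<Sum>u\<in>subexponents (Suc n) k \<alpha>. G u) =
      (\<Sum>(j, u)\<in>(SIGMA j:{..min k (\<alpha> n)}. subexponents n (k - j) \<alpha>). G (u(n := j)))"
  proof (rule sum.reindex_bij_witness[where j = "\<lambda>u. (u n, u(n := 0))" and i = "\<lambda>(j, u). u(n := j)"])
    fix u assume u: "u \<in> subexponents (Suc n) k \<alpha>"
    have "sum (u(n := 0)) {..<n} = sum u {..<n}" by (rule sum.cong) auto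
    moreover have "sum u {..<n} + u n = k" "\<And>i. u i \<le> \<alpha> i" "\<And>i. Suc n \<le> i \<Longrightarrow> u i = 0"
      using u by (auto simp: subexponents_def)
    ultimately show "(u n, u(n := 0)) \<in> (SIGMA j:{..min k (\<alpha> n)}. subexponents n (k - j) \<alpha>)"
      by (auto simp: subexponents_def le_Suc_eq)
  next
    fix p assume "p \<in> (SIGMA j:{..min k (\<alpha> n)}. subexponents n (k - j) \<alpha>)"
    then obtain j u where p: "p = (j, u)" "j \<le> k" "j \<le> \<alpha> n" "u \<in> subexponents n (k - j) \<alpha>" by auto
    have "sum (u(n := j)) {..<n} = sum u {..<n}" by (rule sum.cong) auto
    then show "(case p of (j, u) \<Rightarrow> u(n := j)) \<in> subexponents (Suc n) k \<alpha>"
      using p by (auto simp: subexponents_def)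
    have "u n = 0" using p by (auto simp: subexponents_def)
    then show "((case p of (j, u) \<Rightarrow> u(n := j)) n, (case p of (j, u) \<Rightarrow> u(n := j))(n := 0)) = p"
      by (auto simp: p(1))
  qed auto
  also have "\<dots> = (\<Sum>j\<le>min k (\<alpha> n). \<Sum>u\<in>subexponents n (k - j) \<alpha>. G (u(n := j)))"
    by (rule sum.Sigma[symmetric]) auto
  finally show ?thesis .
qed

text \<open>Pieri's rule for coefficients, by induction on the number of variables. After branching
  on the last variable, \<open>strips_commute\<close> moves the removal past the addition, and its
  \<open>j\<close> becomes the exponent of the last variable that is taken from
  \<open>h_k\<close>.\<close>

lemma pieri_kostka:
  assumes "finsupp \<mu>" "\<And>i. \<mu> (Suc i) \<le> \<mu> i"
  shows "(\<Sum>u\<in>subexponents n k \<alpha>. kostka n \<mu> (\<lambda>i. \<alpha> i - u i)) = (\<Sum>f\<in>add_strips k \<mu>. kostka n f \<alpha>)"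
  using assms
proof (induction n arbitrary: k \<mu>)
  case 0
  have fin_up: "finsupp f" if "f \<in> add_strips k \<mu>" for f
    using that horizontal_strip_finsupp[OF 0(1)] by (auto simp: add_strips_def)
  have sub: "subexponents 0 k \<alpha> = (if k = 0 then {\<lambda>_. 0} else {})"
    by (auto simp: subexponents_def)
  have zero: "(\<lambda>_. 0) \<in> add_strips k \<mu> \<longleftrightarrow> k = 0 \<and> \<mu> = (\<lambda>_. 0)"
    by (auto simp: add_strips_def horizontal_strip_def sz_def)
  have "(\<Sum>f\<in>add_strips k \<mu>. kostka 0 f \<alpha>) = (\<Sum>f\<in>add_strips k \<mu>. if f = (\<lambda>_. 0) then 1 else 0)"
    by (intro sum.cong) (auto simp: kostka_0 fin_up)
  also have "\<dots> = (if k = 0 \<and> \<mu> = (\<lambda>_. 0) then 1 else 0)"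
    using 0(1) by (simp add: zero)
  finally show ?case using 0(1) by (simp add: sub kostka_0)
next
  case (Suc n)
  have fin_up: "finsupp f" "f (Suc i) \<le> f i" if "f \<in> add_strips k \<mu>" for f i
    using that horizontal_strip_finsupp[OF Suc.prems(1)]
    by (auto simp: add_strips_def horizontal_strip_def intro: order_trans)
  have "(\<Sum>f\<in>add_strips k \<mu>. kostka (Suc n) f \<alpha>) =
      (\<Sum>f\<in>add_strips k \<mu>. \<Sum>\<nu>\<in>remove_strips (\<alpha> n) f. kostka n \<nu> \<alpha>)"
    by (intro sum.cong refl kostka_Suc fin_up)
  also have "\<dots> = (\<Sum>j\<le>min k (\<alpha> n). \<Sum>\<kappa>\<in>remove_strips (\<alpha> n - j) \<mu>. \<Sum>\<nu>\<in>add_strips (k - j) \<kappa>. kostka n \<nu> \<alpha>)"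
    by (rule strips_commute[OF Suc.prems(1)])
  also have "\<dots> = (\<Sum>j\<le>min k (\<alpha> n). \<Sum>\<kappa>\<in>remove_strips (\<alpha> n - j) \<mu>.
      \<Sum>u\<in>subexponents n (k - j) \<alpha>. kostka n \<kappa> (\<lambda>i. \<alpha> i - u i))"
  proof (rule sum.cong[OF refl], rule sum.cong[OF refl])
    fix j \<kappa> assume "\<kappa> \<in> remove_strips (\<alpha> n - j) \<mu>"
    then show "(\<Sum>\<nu>\<in>add_strips (k - j) \<kappa>. kostka n \<nu> \<alpha>) =
        (\<Sum>u\<in>subexponents n (k - j) \<alpha>. kostka n \<kappa> (\<lambda>i. \<alpha> i - u i))"
      by (intro Suc.IH[symmetric] remove_strips_finsupp[OF Suc.prems(1)] remove_strips_antimono)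
  qed
  also have "\<dots> = (\<Sum>j\<le>min k (\<alpha> n). \<Sum>u\<in>subexponents n (k - j) \<alpha>.
      \<Sum>\<kappa>\<in>remove_strips (\<alpha> n - j) \<mu>. kostka n \<kappa> (\<lambda>i. \<alpha> i - u i))"
    by (intro sum.cong refl sum.swap)
  \<comment> \<open>Branching read backwards: the last strip has size \<open>\<alpha> n - j\<close>,
    and Kostka numbers in \<open>n\<close> variables do not see the update of \<open>u\<close> at
    \<open>n\<close>.\<close>
  also have "\<dots> = (\<Sum>j\<le>min k (\<alpha> n). \<Sum>u\<in>subexponents n (k - j) \<alpha>.
      kostka (Suc n) \<mu> (\<lambda>i. \<alpha> i - (u(n := j)) i))"
    by (intro sum.cong refl) (auto simp: kostka_Suc[OF Suc.prems] intro!: sum.cong kostka_cong)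
  also have "\<dots> = (\<Sum>u\<in>subexponents (Suc n) k \<alpha>. kostka (Suc n) \<mu> (\<lambda>i. \<alpha> i - u i))"
    by (rule sum_subexponents_Suc[symmetric])
  finally show ?case by simp
qed

lemma ex_keys_bound: "\<exists>n. Poly_Mapping.keys (m :: nat \<Rightarrow>\<^sub>0 nat) \<subseteq> {..<n}"
  using finite_keys[of m] by (auto simp: finite_nat_set_iff_bounded)

text \<open>A contributing term splits \<open>m\<close> as \<open>u + v\<close> with
  \<open>deg u = k\<close>; the exponent vector of \<open>u\<close> determines \<open>v\<close> and
  runs through \<open>subexponents\<close>.\<close>

lemma coeff_hsym_schur:
  assumes "Poly_Mapping.keys m \<subseteq> {..<n}"
  shows "coeff (hsym k * schur \<kappa>) m =
    of_nat (\<Sum>u\<in>subexponents n k (Poly_Mapping.lookup m).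
      kostka n (nth_default 0 \<kappa>) (\<lambda>i. Poly_Mapping.lookup m i - u i))"
proof -
  let ?S = "{(u, v). u + v = m}"
  let ?K = "\<lambda>\<beta>. of_nat (kostka n (nth_default 0 \<kappa>) \<beta>) :: rat"
  have m0: "Poly_Mapping.lookup m i = 0" if "n \<le> i" for i
  proof -
    have "i \<notin> Poly_Mapping.keys m" using assms that by auto
    then show ?thesis by (simp add: in_keys_iff)
  qed
  have "coeff (hsym k * schur \<kappa>) m = (\<Sum>(u, v)\<in>?S. coeff (hsym k) u * coeff (schur \<kappa>) v)"
    by (rule coeff_mult)
  also have "\<dots> = (\<Sum>(u, v)\<in>{p \<in> ?S. deg (fst p) = k}. coeff (schur \<kappa>) v)"
    by (rule sum.mono_neutral_cong_right[OF finite_monomial_splits])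
       (auto simp: hsym.rep_eq split: if_splits)
  also have "\<dots> = (\<Sum>u\<in>subexponents n k (Poly_Mapping.lookup m). ?K (\<lambda>i. Poly_Mapping.lookup m i - u i))"
  proof (rule sum.reindex_bij_witness[where
        j = "\<lambda>(u, v). Poly_Mapping.lookup u" and
        i = "\<lambda>w. (Abs_poly_mapping w, m - Abs_poly_mapping w)"])
    fix p assume "p \<in> {p \<in> ?S. deg (fst p) = k}"
    then obtain u v where p: "p = (u, v)" and uv: "u + v = m" and k: "deg u = k"
      by (cases p) auto
    have lookup: "Poly_Mapping.lookup m i = Poly_Mapping.lookup u i + Poly_Mapping.lookup v i" for i
      by (simp add: lookup_add flip: uv)
    have u0: "Poly_Mapping.lookup u i = 0" "Poly_Mapping.lookup v i = 0" if "n \<le> i" for i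
      using m0[OF that] lookup[of i] by simp_all
    have "Poly_Mapping.keys u \<subseteq> {..<n}" "Poly_Mapping.keys v \<subseteq> {..<n}"
      using u0 by (meson in_keys_iff lessThan_iff linorder_not_le subsetI)+
    note keys = this
    show "(Abs_poly_mapping (case p of (u, v) \<Rightarrow> Poly_Mapping.lookup u),
        m - Abs_poly_mapping (case p of (u, v) \<Rightarrow> Poly_Mapping.lookup u)) = p"
      by (simp add: p poly_mapping.lookup_inverse flip: uv)
    have "sum (Poly_Mapping.lookup u) {..<n} = k"
      using deg_superset[OF _ keys(1)] k by simp
    then show "(case p of (u, v) \<Rightarrow> Poly_Mapping.lookup u) \<in> subexponents n k (Poly_Mapping.lookup m)"
      using u0 lookup by (simp add: p subexponents_def)
    have "(\<lambda>i. Poly_Mapping.lookup m i - Poly_Mapping.lookup u i) = Poly_Mapping.lookup v"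
      by (simp add: lookup)
    then show "?K (\<lambda>i. Poly_Mapping.lookup m i - (case p of (u, v) \<Rightarrow> Poly_Mapping.lookup u) i) =
        (case p of (u, v) \<Rightarrow> coeff (schur \<kappa>) v)"
      by (simp only: p prod.case coeff_schur[OF keys(2)])
  next
    fix w assume w: "w \<in> subexponents n k (Poly_Mapping.lookup m)"
    have "finsupp w" by (rule finsuppI[of n]) (use w in \<open>auto simp: subexponents_def\<close>)
    then have lw: "Poly_Mapping.lookup (Abs_poly_mapping w) = w" by (simp add: finsupp_def)
    then show "(case (Abs_poly_mapping w, m - Abs_poly_mapping w) of (u, v) \<Rightarrow> Poly_Mapping.lookup u) = w"
      by simp
    have "Poly_Mapping.keys (Abs_poly_mapping w) \<subseteq> {..<n}"
    proof
      fix i assume "i \<in> Poly_Mapping.keys (Abs_poly_mapping w)"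
      then have "w i \<noteq> 0" by (simp add: in_keys_iff lw)
      then show "i \<in> {..<n}" using w by (auto simp: subexponents_def intro: ccontr)
    qed
    then have "deg (Abs_poly_mapping w) = k"
      using w lw by (subst deg_superset[of "{..<n}"]) (auto simp: subexponents_def)
    moreover have "Abs_poly_mapping w + (m - Abs_poly_mapping w) = m"
      by (rule poly_mapping_eqI) (use w in \<open>simp add: lookup_add lookup_minus lw subexponents_def\<close>)
    ultimately show "(Abs_poly_mapping w, m - Abs_poly_mapping w) \<in> {p \<in> ?S. deg (fst p) = k}"
      by simp
  qed
  finally show ?thesis by simp
qed

section \<open>Partitions and their row functions\<close>

lemma partition_fun:
  assumes "is_partition \<kappa>"
  shows "finsupp (nth_default 0 \<kappa>)" "nth_default 0 \<kappa> (Suc i) \<le> nth_default 0 \<kappa> i"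
    "sz (nth_default 0 \<kappa>) = sum_list \<kappa>"
proof -
  show "finsupp (nth_default 0 \<kappa>)"
    by (rule finsuppI[of "length \<kappa>"]) (simp add: nth_default_beyond)
  show "nth_default 0 \<kappa> (Suc i) \<le> nth_default 0 \<kappa> i"
    using assms by (auto simp: nth_default_def is_partition_def sorted_wrt_iff_nth_less)
  have "sz (nth_default 0 \<kappa>) = (\<Sum>i<length \<kappa>. nth_default 0 \<kappa> i)"
    by (rule sz_eq_sum) (simp add: nth_default_beyond)
  also have "\<dots> = sum_list \<kappa>"
    by (simp add: sum_list_sum_nth atLeast0LessThan nth_default_nth)
  finally show "sz (nth_default 0 \<kappa>) = sum_list \<kappa>" .
qed

text \<open>Parts are positive, so the length is recovered as the first index with value 0.\<close>

lemma partition_fun_inj: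
  assumes "is_partition \<kappa>" "is_partition \<sigma>" "nth_default 0 \<kappa> = nth_default 0 \<sigma>"
  shows "\<kappa> = \<sigma>"
proof -
  have iff: "nth_default 0 \<tau> i = 0 \<longleftrightarrow> length \<tau> \<le> i" if "is_partition \<tau>" for \<tau> i
    using that by (auto simp: nth_default_def is_partition_def in_set_conv_nth)
  have "length \<kappa> = length \<sigma>"
    using iff[OF assms(1)] iff[OF assms(2)] assms(3) by (metis le_antisym order_refl)
  then show ?thesis
    using assms(3) by (metis nth_default_nth nth_equalityI)
qed

lemma partition_fun_surj:
  assumes "finsupp f" "\<And>i. f (Suc i) \<le> f i"
  shows "\<exists>\<kappa>. is_partition \<kappa> \<and> nth_default 0 \<kappa> = f"
proof -
  have anti: "f j \<le> f i" if "i \<le> j" for i j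
    using lift_Suc_antimono_le[of f] assms(2) that by blast
  \<comment> \<open>The support is an initial segment, so its cardinality is the number of
    rows.\<close>
  define N where "N = card {i. f i \<noteq> 0}"
  have "{i. f i \<noteq> 0} = {..<N}"
    unfolding N_def
  proof (rule down_closed_eq_lessThan)
    show "finite {i. f i \<noteq> 0}" using assms(1) by (simp add: finsupp_def)
    show "i \<in> {i. f i \<noteq> 0}" if "j \<in> {i. f i \<noteq> 0}" "i \<le> j" for i j
      using anti[OF that(2)] that(1) by simp
  qed
  then have N: "f i \<noteq> 0 \<longleftrightarrow> i < N" for i by blast
  have "nth_default 0 (map f [0..<N]) i = f i" for i
    using N[of i] by (auto simp: nth_default_def)
  moreover have "is_partition (map f [0..<N])"
    using N anti by (auto simp: is_partition_def sorted_wrt_iff_nth_less)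
  ultimately show ?thesis by blast
qed

lemma partition_fun_image:
  "nth_default 0 ` partitions N = {f. finsupp f \<and> (\<forall>i. f (Suc i) \<le> f i) \<and> sz f = N}"
proof (intro equalityI subsetI)
  fix f assume "f \<in> {f. finsupp f \<and> (\<forall>i. f (Suc i) \<le> f i) \<and> sz f = N}"
  then have f: "finsupp f" "\<And>i. f (Suc i) \<le> f i" "sz f = N" by auto
  from partition_fun_surj[OF f(1,2)] obtain \<kappa> where "is_partition \<kappa>" "nth_default 0 \<kappa> = f" by blast
  then show "f \<in> nth_default 0 ` partitions N"
    using partition_fun(3) f(3) by (auto simp: partitions_def)
qed (auto simp: partitions_def partition_fun)

lemma sum_add_strips:
  assumes "is_partition \<mu>"
  shows "(\<Sum>f\<in>add_strips k (nth_default 0 \<mu>). G f) =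
    (\<Sum>lam | lam \<in> partitions (sum_list \<mu> + k) \<and> horizontal_strip (nth_default 0 \<mu>) (nth_default 0 lam).
       G (nth_default 0 lam))"
proof -
  let ?P = "{lam. lam \<in> partitions (sum_list \<mu> + k) \<and> horizontal_strip (nth_default 0 \<mu>) (nth_default 0 lam)}"
  have "f \<in> add_strips k (nth_default 0 \<mu>) \<longleftrightarrow>
      f \<in> nth_default 0 ` partitions (sum_list \<mu> + k) \<and> horizontal_strip (nth_default 0 \<mu>) f" for f
  proof -
    have "f (Suc i) \<le> f i" if "horizontal_strip (nth_default 0 \<mu>) f" for i
      using that[unfolded horizontal_strip_def, rule_format, of i] by linarith
    then show ?thesis
      unfolding partition_fun_image add_strips_def partition_fun(3)[OF assms] mem_Collect_eq
      using horizontal_strip_finsupp[OF partition_fun(1)[OF assms], of f] by metis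
  qed
  then have "add_strips k (nth_default 0 \<mu>) =
      {f \<in> nth_default 0 ` partitions (sum_list \<mu> + k). horizontal_strip (nth_default 0 \<mu>) f}"
    by (intro set_eqI) (simp only: mem_Collect_eq)
  also have "\<dots> = nth_default 0 ` ?P" by (rule Compr_image_eq)
  finally have "add_strips k (nth_default 0 \<mu>) = nth_default 0 ` ?P" .
  moreover have "inj_on (nth_default 0) ?P"
    by (rule inj_onI, rule partition_fun_inj) (simp_all add: partitions_def)
  ultimately show ?thesis by (simp only: sum.reindex comp_def)
qed

lemma sum_remove_strips:
  assumes "is_partition lam" "sum_list lam = N + a"
  shows "(\<Sum>f\<in>remove_strips a (nth_default 0 lam). G f) =
    (\<Sum>\<nu> | \<nu> \<in> partitions N \<and> horizontal_strip (nth_default 0 \<nu>) (nth_default 0 lam). G (nth_default 0 \<nu>))"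
proof -
  let ?P = "{\<nu>. \<nu> \<in> partitions N \<and> horizontal_strip (nth_default 0 \<nu>) (nth_default 0 lam)}"
  have "f \<in> remove_strips a (nth_default 0 lam) \<longleftrightarrow>
      f \<in> nth_default 0 ` partitions N \<and> horizontal_strip f (nth_default 0 lam)" for f
  proof -
    \<comment> \<open>Two consecutive strip conditions are combined: row \<open>Suc i\<close> of
      \<open>f\<close> is at most row \<open>Suc i\<close> of \<open>lam\<close>, which is at most
      row \<open>i\<close> of \<open>f\<close>.\<close>
    have "f (Suc i) \<le> f i" if "horizontal_strip f (nth_default 0 lam)" for i
      using that[unfolded horizontal_strip_def, rule_format, of i]
        that[unfolded horizontal_strip_def, rule_format, of "Suc i"] by linarith
    moreover have "finsupp f" if "horizontal_strip f (nth_default 0 lam)"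
      using finsupp_le[OF partition_fun(1)[OF assms(1)]] that unfolding horizontal_strip_def by blast
    ultimately show ?thesis
      unfolding partition_fun_image remove_strips_def partition_fun(3)[OF assms(1)] assms(2) mem_Collect_eq
      by (metis add_right_cancel)
  qed
  then have "remove_strips a (nth_default 0 lam) =
      {f \<in> nth_default 0 ` partitions N. horizontal_strip f (nth_default 0 lam)}"
    by (intro set_eqI) (simp only: mem_Collect_eq)
  also have "\<dots> = nth_default 0 ` ?P" by (rule Compr_image_eq)
  finally have "remove_strips a (nth_default 0 lam) = nth_default 0 ` ?P" .
  moreover have "inj_on (nth_default 0) ?P"
    by (rule inj_onI, rule partition_fun_inj) (simp_all add: partitions_def)
  ultimately show ?thesis by (simp only: sum.reindex comp_def)
qed

lemma pieri:
  assumes "is_partition \<mu>"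
  shows "hsym k * schur \<mu> =
    (\<Sum>lam | lam \<in> partitions (sum_list \<mu> + k) \<and> horizontal_strip (nth_default 0 \<mu>) (nth_default 0 lam). schur lam)"
proof (rule pseries_eqI)
  fix m :: "nat \<Rightarrow>\<^sub>0 nat"
  obtain n where n: "Poly_Mapping.keys m \<subseteq> {..<n}"
    using ex_keys_bound by blast
  show "coeff (hsym k * schur \<mu>) m = coeff (\<Sum>lam | lam \<in> partitions (sum_list \<mu> + k) \<and>
      horizontal_strip (nth_default 0 \<mu>) (nth_default 0 lam). schur lam) m"
    by (simp add: coeff_hsym_schur[OF n] coeff_schur[OF n] sum_add_strips[OF assms]
        pieri_kostka[OF partition_fun(1,2)[OF assms]])
qed

section \<open>Products of complete homogeneous functions in terms of Schur functions\<close>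

lemma partitions_0: "partitions 0 = {[]}"
  by (auto simp: partitions_def is_partition_def) (case_tac x; auto)

lemma schur_Nil: "schur [] = 1"
proof (rule pseries_eqI)
  fix m :: "nat \<Rightarrow>\<^sub>0 nat"
  obtain n where n: "Poly_Mapping.keys m \<subseteq> {..<n}"
    using ex_keys_bound by blast
  have "content_tableaux n (\<lambda>_. 0) (Poly_Mapping.lookup m) = (if m = 0 then {\<lambda>_. 0} else {})"
  proof (cases "m = 0")
    case False
    then obtain i where i: "Poly_Mapping.lookup m i \<noteq> 0"
      by (metis poly_mapping_eqI lookup_zero)
    then have "i \<in> Poly_Mapping.keys m" by (simp add: in_keys_iff)
    then have "i < n" using n by auto
    then show ?thesis using False i by (auto simp: content_tableaux_def cells_def)
  qed (auto simp: content_tableaux_def tableaux_def cells_def)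
  moreover have "nth_default 0 [] = (\<lambda>_. 0 :: nat)" by (simp add: fun_eq_iff)
  ultimately show "coeff (schur []) m = coeff 1 m"
    by (simp add: coeff_schur[OF n] kostka_def coeff_1)
qed

text \<open>Induction on the number of variables: multiplication by the last factor
  \<open>h_a\<close> adds strips by Pieri's rule, and summing over the smaller shapes is the
  branching rule for Kostka numbers.\<close>

lemma hprod_schur:
  "hprod m = (\<Sum>lam\<in>partitions (deg m). scale (coeff (schur lam) m) (schur lam))"
proof -
  have "hprod m = (\<Sum>lam\<in>partitions (deg m). scale (coeff (schur lam) m) (schur lam))"
    if "Poly_Mapping.keys m \<subseteq> {..<n}" for n
    using that
  proof (induction n arbitrary: m)
    case 0
    then have "m = 0" by simp
    then show ?case by (simp add: partitions_0 schur_Nil coeff_1 hprod_def)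
  next
    case (Suc n)
    define a where "a = Poly_Mapping.lookup m n"
    define m' where "m' = m - Poly_Mapping.single n a"
    have lookup: "Poly_Mapping.lookup m' i = (if i = n then 0 else Poly_Mapping.lookup m i)" for i
      by (auto simp: m'_def a_def lookup_minus lookup_single when_def)
    have keys: "Poly_Mapping.keys m' \<subseteq> {..<n}"
    proof
      fix i assume "i \<in> Poly_Mapping.keys m'"
      then have "Poly_Mapping.lookup m i \<noteq> 0" "i \<noteq> n" by (auto simp: in_keys_iff lookup split: if_splits)
      then have "i \<in> Poly_Mapping.keys m" "i \<noteq> n" by (simp_all add: in_keys_iff)
      then show "i \<in> {..<n}" using Suc.prems by auto
    qed
    have deg: "deg m = deg m' + a"
      using deg_minus_single[of a m n] lookup_le_deg[of m n] by (simp add: m'_def a_def)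
    let ?hs = "\<lambda>\<nu> lam. horizontal_strip (nth_default 0 \<nu>) (nth_default 0 lam)"
    have "hprod m = (\<Prod>i<Suc n. hsym (Poly_Mapping.lookup m i))"
      by (rule hprod_superset) (use Suc.prems in auto)
    also have "\<dots> = (\<Prod>i<n. hsym (Poly_Mapping.lookup m' i)) * hsym a"
      by (simp add: lookup a_def)
    also have "\<dots> = hsym a * hprod m'"
      by (subst hprod_superset[OF _ keys]) (simp_all add: mult.commute)
    also have "\<dots> = (\<Sum>\<nu>\<in>partitions (deg m'). scale (coeff (schur \<nu>) m') (hsym a * schur \<nu>))"
      by (simp add: Suc.IH[OF keys] sum_distrib_left)
    also have "\<dots> = (\<Sum>\<nu>\<in>partitions (deg m'). \<Sum>lam | lam \<in> partitions (deg m) \<and> ?hs \<nu> lam.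
        scale (coeff (schur \<nu>) m') (schur lam))"
      by (intro sum.cong refl) (auto simp: pieri partitions_def deg pseries.scale_sum_right)
    also have "\<dots> = (\<Sum>lam\<in>partitions (deg m). \<Sum>\<nu> | \<nu> \<in> partitions (deg m') \<and> ?hs \<nu> lam.
        scale (coeff (schur \<nu>) m') (schur lam))"
      by (rule sum.swap_restrict) simp_all
    also have "\<dots> = (\<Sum>lam\<in>partitions (deg m). scale (coeff (schur lam) m) (schur lam))"
    proof (rule sum.cong[OF refl])
      fix lam assume lam: "lam \<in> partitions (deg m)"
      then have p: "is_partition lam" "sum_list lam = deg m' + a" by (auto simp: partitions_def deg)
      have "coeff (schur lam) m = of_nat (\<Sum>\<nu>\<in>remove_strips a (nth_default 0 lam). kostka n \<nu> (Poly_Mapping.lookup m))"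
        by (simp only: coeff_schur[OF Suc.prems] kostka_Suc[OF partition_fun(1,2)[OF p(1)]] a_def)
      also have "\<dots> = of_nat (\<Sum>\<nu> | \<nu> \<in> partitions (deg m') \<and> ?hs \<nu> lam. kostka n (nth_default 0 \<nu>) (Poly_Mapping.lookup m))"
        by (simp only: sum_remove_strips[OF p])
      also have "\<dots> = (\<Sum>\<nu> | \<nu> \<in> partitions (deg m') \<and> ?hs \<nu> lam. coeff (schur \<nu>) m')"
      proof -
        have "kostka n f (Poly_Mapping.lookup m) = kostka n f (Poly_Mapping.lookup m')" for f
          by (rule kostka_cong) (simp add: lookup)
        then show ?thesis by (simp add: coeff_schur[OF keys])
      qed
      finally show "(\<Sum>\<nu> | \<nu> \<in> partitions (deg m') \<and> ?hs \<nu> lam. scale (coeff (schur \<nu>) m') (schur lam)) =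
          scale (coeff (schur lam) m) (schur lam)"
        by (simp add: pseries.scale_sum_left)
    qed
    finally show ?case .
  qed
  moreover obtain n where "Poly_Mapping.keys m \<subseteq> {..<n}"
    using ex_keys_bound by blast
  ultimately show ?thesis .
qed

section \<open>Unitriangularity of the Kostka matrix\<close>

definition weight :: "(nat \<Rightarrow> nat) \<Rightarrow> nat" where
  "weight f = (\<Sum>p\<in>cells f. fst p)"

lemma weight_eq_sum:
  assumes "\<And>i. n \<le> i \<Longrightarrow> f i = 0"
  shows "weight f = (\<Sum>i<n. i * f i)"
proof -
  have "cells f = (SIGMA i:{..<n}. {..<f i})"
    using assms by (auto simp: cells_def) (metis linorder_not_le not_less_zero)
  then have "weight f = (\<Sum>i<n. \<Sum>j<f i. i)"
    unfolding weight_def by (subst sum.Sigma) (auto simp: case_prod_unfold)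
  then show ?thesis by (simp add: mult.commute)
qed

lemma row_le_entry:
  assumes "T \<in> tableaux f" "\<And>i. f (Suc i) \<le> f i" "(i, j) \<in> cells f"
  shows "i \<le> T (i, j)"
  using assms(3)
proof (induction i)
  case (Suc i)
  then have "(i, j) \<in> cells f" "T (i, j) < T (Suc i, j)"
    using assms(1) assms(2)[of i] by (auto simp: cells_def tableaux_def)
  then show ?case using Suc.IH by simp
qed simp

lemma sum_content_tableau:
  assumes "finsupp f" "T \<in> content_tableaux n f \<alpha>"
  shows "sum T (cells f) = (\<Sum>k<n. k * \<alpha> k)"
proof -
  have "sum T (cells f) = (\<Sum>k<n. \<Sum>p | p \<in> cells f \<and> T p = k. T p)"
    by (rule sum.group[symmetric]) (use assms content_tableaux_less in auto)
  also have "\<dots> = (\<Sum>k<n. k * \<alpha> k)"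
  proof (rule sum.cong[OF refl])
    fix k assume k: "k \<in> {..<n}"
    have "(\<Sum>p | p \<in> cells f \<and> T p = k. T p) = (\<Sum>p | p \<in> cells f \<and> T p = k. k)"
      by (rule sum.cong) auto
    then show "(\<Sum>p | p \<in> cells f \<and> T p = k. T p) = k * \<alpha> k"
      using assms(2) k by (simp add: content_tableaux_def)
  qed
  finally show ?thesis .
qed

lemma card_row: "card {p \<in> cells f. fst p = k} = f k"
proof -
  have "{p \<in> cells f. fst p = k} = {k} \<times> {..<f k}" by (auto simp: cells_def)
  then show ?thesis by (simp only: card_cartesian_product) simp
qed

text \<open>For a partition, \<open>weight\<close> is the statistic usually called
  \<open>n(\<lambda>)\<close>. The entries of \<open>T\<close> sum to
  \<open>weight \<alpha>\<close>, and each is at least its row index by \<open>row_le_entry\<close>;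
  if the sums agree, every entry equals its row index.\<close>

lemma content_tableaux_weight:
  assumes f: "finsupp f" "\<And>i. f (Suc i) \<le> f i" and \<alpha>: "\<And>i. n \<le> i \<Longrightarrow> \<alpha> i = 0"
    and T: "T \<in> content_tableaux n f \<alpha>"
  shows "weight f \<le> weight \<alpha>" "weight f = weight \<alpha> \<Longrightarrow> f = \<alpha> \<and> T = (\<lambda>p. if p \<in> cells f then fst p else 0)"
proof -
  have tab: "T \<in> tableaux f" using T by (simp add: content_tableaux_def)
  have le: "fst p \<le> T p" if "p \<in> cells f" for p
    using row_le_entry[OF tab f(2), of "fst p" "snd p"] that by simp
  have sum: "sum T (cells f) = weight \<alpha>"
    using sum_content_tableau[OF f(1) T] weight_eq_sum[OF \<alpha>] by simp
  show "weight f \<le> weight \<alpha>"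
    unfolding weight_def[of f] sum[symmetric] by (rule sum_mono) (rule le)
  assume "weight f = weight \<alpha>"
  then have "(\<Sum>p\<in>cells f. fst p) = (\<Sum>p\<in>cells f. T p)"
    using sum by (simp add: weight_def)
  then have eq: "T p = fst p" if "p \<in> cells f" for p
    using sum_mono_inv[OF _ le that] f(1) by force
  have "f k = \<alpha> k" for k
  proof -
    have row: "{p \<in> cells f. T p = k} = {p \<in> cells f. fst p = k}" using eq by auto
    have "card {p \<in> cells f. T p = k} = (if k < n then \<alpha> k else 0)"
      using T by (simp add: content_tableaux_def)
    then have "f k = (if k < n then \<alpha> k else 0)"
      unfolding row card_row .
    then show ?thesis using \<alpha> by (simp split: if_splits)
  qed
  moreover have "T = (\<lambda>p. if p \<in> cells f then fst p else 0)"
  proof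
    fix p show "T p = (if p \<in> cells f then fst p else 0)"
    proof (cases "p \<in> cells f")
      case False
      then have "T p = 0" using tab unfolding tableaux_def by blast
      then show ?thesis using False by simp
    qed (simp add: eq)
  qed
  ultimately show "f = \<alpha> \<and> T = (\<lambda>p. if p \<in> cells f then fst p else 0)" by blast
qed

lemma kostka_self:
  assumes f: "finsupp f" "\<And>i. f (Suc i) \<le> f i" and n: "\<And>i. n \<le> i \<Longrightarrow> f i = 0"
  shows "kostka n f f = 1"
proof -
  let ?T = "\<lambda>p. if p \<in> cells f then fst p else 0"
  have "?T \<in> tableaux f"
    using f(2) by (auto simp: tableaux_def cells_def)
  moreover have "card {p \<in> cells f. ?T p = k} = (if k < n then f k else 0)" for k
  proof -
    have "{p \<in> cells f. ?T p = k} = {p \<in> cells f. fst p = k}" by auto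
    then show ?thesis using n[of k] by (simp only: card_row) simp
  qed
  ultimately have "?T \<in> content_tableaux n f f" unfolding content_tableaux_def by blast
  moreover have "T = ?T" if "T \<in> content_tableaux n f f" for T
    using content_tableaux_weight(2)[of f n f T] f n that by blast
  ultimately have "content_tableaux n f f = {?T}" by blast
  then show ?thesis by (simp only: kostka_def) simp
qed

lemma keys_nth_lessThan: "Poly_Mapping.keys (Poly_Mapping.nth \<alpha>) \<subseteq> {..<length \<alpha>}"
proof
  fix i assume "i \<in> Poly_Mapping.keys (Poly_Mapping.nth \<alpha>)"
  then have "nth_default 0 \<alpha> i \<noteq> 0" by (simp only: in_keys_iff lookup_nth) simp
  then show "i \<in> {..<length \<alpha>}" by (simp add: nth_default_def split: if_splits)
qed

lemma deg_nth: "deg (Poly_Mapping.nth \<alpha>) = sum_list \<alpha>"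
proof -
  have "deg (Poly_Mapping.nth \<alpha>) = (\<Sum>i<length \<alpha>. nth_default 0 \<alpha> i)"
    by (subst deg_superset[OF _ keys_nth_lessThan]) simp_all
  then show ?thesis by (simp add: sum_list_sum_nth atLeast0LessThan nth_default_nth)
qed

text \<open>A nonzero coefficient provides a tableau, to which
  \<open>content_tableaux_weight\<close> applies. Comparing weights takes the place of the dominance
  order.\<close>

lemma schur_unitriangular:
  assumes "is_partition lam" "is_partition \<alpha>"
  shows "coeff (schur \<alpha>) (Poly_Mapping.nth \<alpha>) = 1"
    "coeff (schur lam) (Poly_Mapping.nth \<alpha>) \<noteq> 0 \<Longrightarrow>
      lam = \<alpha> \<or> weight (nth_default 0 lam) < weight (nth_default 0 \<alpha>)"
proof -
  let ?n = "length \<alpha>"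
  have coeff: "coeff (schur \<kappa>) (Poly_Mapping.nth \<alpha>) = of_nat (kostka ?n (nth_default 0 \<kappa>) (nth_default 0 \<alpha>))" for \<kappa>
    using coeff_schur[OF keys_nth_lessThan, of \<kappa> \<alpha>] by (simp only: lookup_nth)
  have zero: "nth_default 0 \<alpha> i = 0" if "?n \<le> i" for i
    using that by (simp add: nth_default_beyond)
  show "coeff (schur \<alpha>) (Poly_Mapping.nth \<alpha>) = 1"
    unfolding coeff by (subst kostka_self[OF partition_fun(1,2)[OF assms(2)] zero]) simp_all
  assume "coeff (schur lam) (Poly_Mapping.nth \<alpha>) \<noteq> 0"
  then obtain T where "T \<in> content_tableaux ?n (nth_default 0 lam) (nth_default 0 \<alpha>)"
    unfolding coeff kostka_def by fastforce
  note w = content_tableaux_weight[of "nth_default 0 lam" ?n "nth_default 0 \<alpha>",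
      OF partition_fun(1,2)[OF assms(1)] zero this]
  show "lam = \<alpha> \<or> weight (nth_default 0 lam) < weight (nth_default 0 \<alpha>)"
  proof (cases "weight (nth_default 0 lam) = weight (nth_default 0 \<alpha>)")
    case True
    then show ?thesis using w(2) partition_fun_inj[OF assms] by blast
  qed (use w(1) in auto)
qed

subsection \<open>Hall and Kronecker products\<close>

text \<open>The symmetric functions of degree \<open>n\<close>. Over the rationals the power sum
  products span all of them, and the Hall and Kronecker products are defined through these
  coordinates.\<close>

definition homsym :: "nat \<Rightarrow> pseries set" where
  "homsym n = pseries.span (power_sum_part ` partitions n)"

lemma homsym_diff: "f \<in> homsym n \<Longrightarrow> g \<in> homsym n \<Longrightarrow> f - g \<in> homsym n"
  unfolding homsym_def by (rule pseries.span_diff)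

lemma homsym_scale: "f \<in> homsym n \<Longrightarrow> scale c f \<in> homsym n"
  unfolding homsym_def by (rule pseries.span_scale)

lemma homsym_sum: "(\<And>i. i \<in> I \<Longrightarrow> f i \<in> homsym n) \<Longrightarrow> (\<Sum>i\<in>I. f i) \<in> homsym n"
  unfolding homsym_def by (rule pseries.span_sum)

lemma power_sum_part_homsym: "\<rho> \<in> partitions n \<Longrightarrow> power_sum_part \<rho> \<in> homsym n"
  unfolding homsym_def by (rule pseries.span_base) (rule imageI)

lemma partitions_subset: "partitions n \<subseteq> Collect is_partition"
  by (auto simp: partitions_def)

lemma homsym_cases:
  assumes "f \<in> homsym n"
  obtains c where "f = (\<Sum>\<rho>\<in>partitions n. scale (c \<rho>) (power_sum_part \<rho>))"
proof -
  obtain u where "f = (\<Sum>v\<in>power_sum_part ` partitions n. scale (u v) v)"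
    using assms unfolding homsym_def by (subst (asm) pseries.span_finite) auto
  moreover have "inj_on power_sum_part (partitions n)"
    using power_sum_part_basis(1) partitions_subset by (rule inj_on_subset)
  ultimately have "f = (\<Sum>\<rho>\<in>partitions n. scale (u (power_sum_part \<rho>)) (power_sum_part \<rho>))"
    by (simp add: sum.reindex)
  then show thesis by (rule that)
qed

lemma homsym_expansion:
  assumes "f \<in> homsym n"
  shows "f = (\<Sum>\<rho>\<in>partitions n. scale (power_sum_coeff f \<rho>) (power_sum_part \<rho>))"
proof -
  obtain c where f: "f = (\<Sum>\<rho>\<in>partitions n. scale (c \<rho>) (power_sum_part \<rho>))"
    by (rule homsym_cases[OF assms])
  have "power_sum_coeff f \<rho> = c \<rho>" if "\<rho> \<in> partitions n" for \<rho>
    unfolding f using that power_sum_coeff_sum[OF _ partitions_subset, of n \<rho> c] partitions_subset by auto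
  then show ?thesis by (subst f) (rule sum.cong, auto)
qed

lemma power_sum_coeff_eq_0:
  assumes "f \<in> homsym n" "is_partition \<rho>" "\<rho> \<notin> partitions n"
  shows "power_sum_coeff f \<rho> = 0"
proof -
  obtain c where "f = (\<Sum>\<rho>\<in>partitions n. scale (c \<rho>) (power_sum_part \<rho>))"
    by (rule homsym_cases[OF assms(1)])
  then show ?thesis using power_sum_coeff_sum[OF _ partitions_subset, of n \<rho> c] assms by simp
qed

text \<open>\<open>representation\<close> is linear on the span of the basis, hence the membership
  assumption.\<close>

lemma power_sum_coeff_lincomb:
  assumes "\<And>i. i \<in> I \<Longrightarrow> g i \<in> homsym n"
  shows "power_sum_coeff (\<Sum>i\<in>I. scale (c i) (g i)) \<rho> = (\<Sum>i\<in>I. c i * power_sum_coeff (g i) \<rho>)"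
proof -
  have "homsym n \<subseteq> pseries.span (power_sum_part ` Collect is_partition)"
    unfolding homsym_def by (rule pseries.span_mono) (use partitions_subset in auto)
  then have g: "g i \<in> pseries.span (power_sum_part ` Collect is_partition)" if "i \<in> I" for i
    using assms that by blast
  note ind = power_sum_part_basis(2)
  show ?thesis
    unfolding power_sum_coeff_def
    by (simp add: pseries.representation_sum[OF ind] pseries.representation_scale[OF ind] pseries.span_scale g)
qed

text \<open>\<open>n\<close> selects the graded piece, which keeps the sum finite; coordinates in
  other degrees are ignored.\<close>

definition hall :: "nat \<Rightarrow> pseries \<Rightarrow> pseries \<Rightarrow> rat" where
  "hall n f g = (\<Sum>\<rho>\<in>partitions n. power_sum_coeff f \<rho> * power_sum_coeff g \<rho> * of_nat (z_part \<rho>))"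

lemma hall_commute: "hall n f g = hall n g f"
  by (simp add: hall_def mult.commute)

lemma hall_lincomb_right:
  assumes "\<And>i. i \<in> I \<Longrightarrow> g i \<in> homsym n"
  shows "hall n f (\<Sum>i\<in>I. scale (c i) (g i)) = (\<Sum>i\<in>I. c i * hall n f (g i))"
proof -
  have "power_sum_coeff (\<Sum>i\<in>I. scale (c i) (g i)) \<rho> = (\<Sum>i\<in>I. c i * power_sum_coeff (g i) \<rho>)" for \<rho>
    by (rule power_sum_coeff_lincomb) (rule assms)
  then show ?thesis unfolding hall_def
    by (simp add: sum_distrib_left sum_distrib_right, subst sum.swap) (simp add: mult_ac)
qed

lemma hall_lincomb_left:
  assumes "\<And>i. i \<in> I \<Longrightarrow> g i \<in> homsym n"
  shows "hall n (\<Sum>i\<in>I. scale (c i) (g i)) f = (\<Sum>i\<in>I. c i * hall n (g i) f)"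
  unfolding hall_commute[of n _ f] by (rule hall_lincomb_right) (rule assms)

lemma z_part_pos: "is_partition \<rho> \<Longrightarrow> 0 < z_part \<rho>"
  unfolding zmset_mset[symmetric] by (rule zmset_pos) (auto simp: is_partition_def)

lemma hprod_homsym: "hprod m \<in> homsym (deg m)"
  unfolding hprod_expansion by (intro homsym_sum homsym_scale power_sum_part_homsym)

lemma power_sum_coeff_hprod:
  assumes "\<rho> \<in> partitions (deg m)"
  shows "power_sum_coeff (hprod m) \<rho> = coeff (power_sum_part \<rho>) m / of_nat (z_part \<rho>)"
  unfolding hprod_expansion
  by (subst power_sum_coeff_sum) (use assms partitions_subset in auto)

text \<open>The factor \<open>z_\<rho>\<close> of the Hall product cancels the denominator in
  \<open>hprod_expansion\<close>; what remains is the coefficient of \<open>m\<close> in the power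
  sum expansion of \<open>f\<close>.\<close>

lemma hall_hprod:
  assumes "f \<in> homsym (deg m)"
  shows "hall (deg m) (hprod m) f = coeff f m"
proof -
  have "hall (deg m) (hprod m) f = (\<Sum>\<rho>\<in>partitions (deg m). power_sum_coeff f \<rho> * coeff (power_sum_part \<rho>) m)"
    unfolding hall_def
  proof (rule sum.cong[OF refl])
    fix \<rho> assume \<rho>: "\<rho> \<in> partitions (deg m)"
    then have "z_part \<rho> \<noteq> 0" using z_part_pos partitions_subset by fastforce
    then show "power_sum_coeff (hprod m) \<rho> * power_sum_coeff f \<rho> * of_nat (z_part \<rho>) =
        power_sum_coeff f \<rho> * coeff (power_sum_part \<rho>) m"
      by (simp add: power_sum_coeff_hprod[OF \<rho>])
  qed
  also have "\<dots> = coeff (\<Sum>\<rho>\<in>partitions (deg m). scale (power_sum_coeff f \<rho>) (power_sum_part \<rho>)) m"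
    by simp
  also have "\<dots> = coeff f m" using homsym_expansion[OF assms] by simp
  finally show ?thesis .
qed

lemma coeff_pmset_deg: "0 \<notin># M \<Longrightarrow> coeff (pmset M) m \<noteq> 0 \<Longrightarrow> deg m = sum_mset M"
proof (induction M arbitrary: m)
  case (add k M)
  then have k: "0 < k" by (auto intro: gr0I)
  then have "(\<Sum>i | k \<le> Poly_Mapping.lookup m i. coeff (pmset M) (m - Poly_Mapping.single i k)) \<noteq> 0"
    using add.prems by (simp add: coeff_power_sum_mult)
  then obtain i where i: "k \<le> Poly_Mapping.lookup m i" "coeff (pmset M) (m - Poly_Mapping.single i k) \<noteq> 0"
    by (metis (mono_tags, lifting) mem_Collect_eq sum.neutral)
  then have "deg m - k = sum_mset M"
    using add by (simp flip: deg_minus_single)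
  then show ?case using i(1) lookup_le_deg[of m i] by simp
qed (auto simp: coeff_1 split: if_splits)

lemma homsym_coeff_eq_0:
  assumes "f \<in> homsym n" "deg m \<noteq> n"
  shows "coeff f m = 0"
proof -
  have "coeff (power_sum_part \<rho>) m = 0" if "\<rho> \<in> partitions n" for \<rho>
    using coeff_pmset_deg[of "mset \<rho>" m] that assms(2)
    by (auto simp: partitions_def is_partition_def pmset_mset sum_mset_sum_list)
  then have "coeff (\<Sum>\<rho>\<in>partitions n. scale (power_sum_coeff f \<rho>) (power_sum_part \<rho>)) m = 0" by simp
  then show ?thesis using homsym_expansion[OF assms(1)] by simp
qed

section \<open>Orthonormality of the Schur functions\<close>

lemma hprod_nth_schur:
  assumes "\<alpha> \<in> partitions n"
  shows "hprod (Poly_Mapping.nth \<alpha>) =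
    (\<Sum>lam\<in>partitions n. scale (coeff (schur lam) (Poly_Mapping.nth \<alpha>)) (schur lam))"
  using assms by (simp add: hprod_schur deg_nth partitions_def)

text \<open>By unitriangularity \<open>h_\<alpha>\<close> is \<open>s_\<alpha>\<close> plus
  multiples of Schur functions of smaller weight. Solving for \<open>s_\<alpha>\<close> puts it into
  the span of the power sums by induction on the weight, which proves its symmetry.\<close>

lemma schur_homsym:
  assumes "\<alpha> \<in> partitions n"
  shows "schur \<alpha> \<in> homsym n"
  using assms
proof (induction "weight (nth_default 0 \<alpha>)" arbitrary: \<alpha> rule: less_induct)
  case less
  let ?K = "\<lambda>lam. coeff (schur lam) (Poly_Mapping.nth \<alpha>)"
  have p: "is_partition \<alpha>" "sum_list \<alpha> = n" using less.prems by (auto simp: partitions_def)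
  have "hprod (Poly_Mapping.nth \<alpha>) =
      scale (?K \<alpha>) (schur \<alpha>) + (\<Sum>lam\<in>partitions n - {\<alpha>}. scale (?K lam) (schur lam))"
    by (simp add: hprod_nth_schur[OF less.prems] sum.remove[OF finite_partitions less.prems])
  then have "schur \<alpha> = hprod (Poly_Mapping.nth \<alpha>) - (\<Sum>lam\<in>partitions n - {\<alpha>}. scale (?K lam) (schur lam))"
    by (simp add: schur_unitriangular(1)[OF p(1) p(1)])
  moreover have H: "hprod (Poly_Mapping.nth \<alpha>) \<in> homsym n"
    using hprod_homsym[of "Poly_Mapping.nth \<alpha>"] by (simp add: deg_nth p)
  moreover have S: "scale (?K lam) (schur lam) \<in> homsym n" if lam: "lam \<in> partitions n - {\<alpha>}" for lam
  proof (cases "?K lam = 0")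
    case True
    then show ?thesis by (simp add: homsym_def pseries.span_zero)
  next
    case False
    then have "weight (nth_default 0 lam) < weight (nth_default 0 \<alpha>)"
      using schur_unitriangular(2)[of lam \<alpha>] lam p(1) by (auto simp: partitions_def)
    then show ?thesis using less.hyps lam by (blast intro: homsym_scale)
  qed
  ultimately show ?case by (simp only: homsym_diff homsym_sum)
qed

text \<open>Forward substitution: at \<open>\<alpha>\<close>, a term with
  \<open>lam \<noteq> \<alpha>\<close> and nonzero Kostka number has smaller weight, so
  \<open>a lam\<close> is already 0. This serves both orthonormality and linear
  independence.\<close>

lemma kostka_matrix_injective:
  fixes a :: "nat list \<Rightarrow> rat"
  assumes "finite R" "R \<subseteq> Collect is_partition"
    and "\<And>\<alpha>. \<alpha> \<in> R \<Longrightarrow> (\<Sum>lam\<in>R. a lam * coeff (schur lam) (Poly_Mapping.nth \<alpha>)) = 0" and "\<alpha> \<in> R"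
  shows "a \<alpha> = 0"
  using assms(4)
proof (induction "weight (nth_default 0 \<alpha>)" arbitrary: \<alpha> rule: less_induct)
  case less
  have \<alpha>: "is_partition \<alpha>" using less.prems assms(2) by auto
  have "0 = (\<Sum>lam\<in>R. a lam * coeff (schur lam) (Poly_Mapping.nth \<alpha>))"
    using assms(3)[OF less.prems] by simp
  also have "\<dots> = (\<Sum>lam\<in>R. if lam = \<alpha> then a \<alpha> else 0)"
  proof (rule sum.cong[OF refl])
    fix lam assume lam: "lam \<in> R"
    then have "is_partition lam" using assms(2) by auto
    note tri = schur_unitriangular[OF this \<alpha>]
    show "a lam * coeff (schur lam) (Poly_Mapping.nth \<alpha>) = (if lam = \<alpha> then a \<alpha> else 0)"
      using tri less.hyps[OF _ lam] by force
  qed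
  also have "\<dots> = a \<alpha>" using assms(1) less.prems by simp
  finally show ?case by simp
qed

lemma hall_schur:
  assumes "\<kappa> \<in> partitions n" "\<mu> \<in> partitions n"
  shows "hall n (schur \<kappa>) (schur \<mu>) = (if \<kappa> = \<mu> then 1 else 0)"
proof -
  \<comment> \<open>The deviation from orthonormality against the fixed \<open>\<mu>\<close>; it
    vanishes because the Kostka matrix annihilates it.\<close>
  define a where "a lam = hall n (schur lam) (schur \<mu>) - (if lam = \<mu> then 1 else 0)" for lam
  have "(\<Sum>lam\<in>partitions n. a lam * coeff (schur lam) (Poly_Mapping.nth \<alpha>)) = 0"
    if \<alpha>: "\<alpha> \<in> partitions n" for \<alpha>
  proof -
    have d: "deg (Poly_Mapping.nth \<alpha>) = n" using \<alpha> by (simp add: deg_nth partitions_def)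
    have "(\<Sum>lam\<in>partitions n. coeff (schur lam) (Poly_Mapping.nth \<alpha>) * hall n (schur lam) (schur \<mu>)) =
        hall n (hprod (Poly_Mapping.nth \<alpha>)) (schur \<mu>)"
      unfolding hprod_nth_schur[OF \<alpha>] by (rule hall_lincomb_left[symmetric]) (rule schur_homsym)
    also have "\<dots> = coeff (schur \<mu>) (Poly_Mapping.nth \<alpha>)"
      using hall_hprod[of "schur \<mu>" "Poly_Mapping.nth \<alpha>"] schur_homsym[OF assms(2)] by (simp add: d)
    also have "\<dots> = (\<Sum>lam\<in>partitions n. if lam = \<mu> then coeff (schur lam) (Poly_Mapping.nth \<alpha>) else 0)"
      using assms(2) by simp
    also have "\<dots> = (\<Sum>lam\<in>partitions n. coeff (schur lam) (Poly_Mapping.nth \<alpha>) * (if lam = \<mu> then 1 else 0))"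
      by (rule sum.cong) auto
    finally show ?thesis
      by (simp add: a_def left_diff_distrib right_diff_distrib sum_subtractf mult.commute)
  qed
  then have "a \<kappa> = 0"
    by (rule kostka_matrix_injective[OF finite_partitions partitions_subset _ assms(1)])
  then show ?thesis by (simp add: a_def)
qed

text \<open>Both sides have the same Hall product with every \<open>schur \<mu>\<close>, hence with
  every \<open>hprod m\<close> of degree \<open>n\<close>, and the latter are the coefficients. In
  other degrees both sides vanish.\<close>

lemma schur_expansion:
  assumes f: "f \<in> homsym n"
  shows "f = (\<Sum>\<kappa>\<in>partitions n. scale (hall n f (schur \<kappa>)) (schur \<kappa>))"
proof -
  define F where "F = (\<Sum>\<kappa>\<in>partitions n. scale (hall n f (schur \<kappa>)) (schur \<kappa>))"
  have F: "F \<in> homsym n" unfolding F_def by (intro homsym_sum homsym_scale schur_homsym)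
  have eq: "hall n (schur \<mu>) F = hall n (schur \<mu>) f" if \<mu>: "\<mu> \<in> partitions n" for \<mu>
  proof -
    have "hall n (schur \<mu>) F = (\<Sum>\<kappa>\<in>partitions n. hall n f (schur \<kappa>) * hall n (schur \<mu>) (schur \<kappa>))"
      unfolding F_def by (rule hall_lincomb_right) (rule schur_homsym)
    also have "\<dots> = (\<Sum>\<kappa>\<in>partitions n. if \<kappa> = \<mu> then hall n f (schur \<kappa>) else 0)"
      by (rule sum.cong) (auto simp: hall_schur \<mu>)
    also have "\<dots> = hall n (schur \<mu>) f" using \<mu> by (simp add: hall_commute)
    finally show ?thesis .
  qed
  have "coeff f m = coeff F m" for m
  proof (cases "deg m = n")
    case True
    have "hall n (hprod m) G = (\<Sum>lam\<in>partitions n. coeff (schur lam) m * hall n (schur lam) G)" for G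
      unfolding hprod_schur[of m] True by (rule hall_lincomb_left) (rule schur_homsym)
    then have "hall n (hprod m) f = hall n (hprod m) F" by (simp add: eq)
    then show ?thesis using hall_hprod[of f m] hall_hprod[of F m] f F True by simp
  next
    case False
    then show ?thesis by (simp add: homsym_coeff_eq_0[OF f] homsym_coeff_eq_0[OF F])
  qed
  then show ?thesis unfolding F_def[symmetric] by (rule pseries_eqI)
qed

lemma schur_basis:
  shows "inj_on schur (Collect is_partition)"
    and "pseries.independent (schur ` Collect is_partition)"
proof -
  have "c \<alpha> = 0" if R: "finite R" "R \<subseteq> Collect is_partition" "(\<Sum>lam\<in>R. scale (c lam) (schur lam)) = 0" "\<alpha> \<in> R"
    for R c \<alpha>
  proof (rule kostka_matrix_injective[OF R(1,2) _ R(4)])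
    fix \<beta>
    have "coeff (\<Sum>lam\<in>R. scale (c lam) (schur lam)) (Poly_Mapping.nth \<beta>) = 0" by (simp add: R(3))
    then show "(\<Sum>lam\<in>R. c lam * coeff (schur lam) (Poly_Mapping.nth \<beta>)) = 0" by simp
  qed
  note * = this
  show "inj_on schur (Collect is_partition)" "pseries.independent (schur ` Collect is_partition)"
    by (rule pseries_family_independent; use * in blast)+
qed

text \<open>Links the coordinates that define the Littlewood-Richardson and Kronecker coefficients
  to the Hall product.\<close>

lemma schur_coeff_eq_hall:
  assumes "f \<in> homsym n" "\<kappa> \<in> partitions n"
  shows "schur_coeff f \<kappa> = hall n f (schur \<kappa>)"
proof -
  have "schur_coeff f \<kappa> = schur_coeff (\<Sum>\<kappa>\<in>partitions n. scale (hall n f (schur \<kappa>)) (schur \<kappa>)) \<kappa>"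
    using schur_expansion[OF assms(1)] by simp
  also have "\<dots> = hall n f (schur \<kappa>)"
    unfolding schur_coeff_def using assms(2) partitions_subset
    by (subst representation_family[OF schur_basis]) auto
  finally show ?thesis .
qed

lemma schur_coeff_expansion:
  assumes "f \<in> homsym n"
  shows "f = (\<Sum>\<kappa>\<in>partitions n. scale (schur_coeff f \<kappa>) (schur \<kappa>))"
  by (subst schur_expansion[OF assms]) (simp add: schur_coeff_eq_hall[OF assms])

lemma schur_coeff_lincomb:
  assumes "\<And>i. i \<in> I \<Longrightarrow> g i \<in> homsym n" "\<kappa> \<in> partitions n"
  shows "schur_coeff (\<Sum>i\<in>I. scale (c i) (g i)) \<kappa> = (\<Sum>i\<in>I. c i * schur_coeff (g i) \<kappa>)"
proof -
  have "(\<Sum>i\<in>I. scale (c i) (g i)) \<in> homsym n" using assms(1) by (intro homsym_sum homsym_scale)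
  then have "schur_coeff (\<Sum>i\<in>I. scale (c i) (g i)) \<kappa> = hall n (\<Sum>i\<in>I. scale (c i) (g i)) (schur \<kappa>)"
    by (rule schur_coeff_eq_hall) (rule assms)
  also have "\<dots> = (\<Sum>i\<in>I. c i * hall n (g i) (schur \<kappa>))"
    by (rule hall_lincomb_left) (rule assms)
  also have "\<dots> = (\<Sum>i\<in>I. c i * schur_coeff (g i) \<kappa>)"
    by (rule sum.cong[OF refl]) (simp add: schur_coeff_eq_hall[OF assms])
  finally show ?thesis .
qed

section \<open>Kronecker product with a product of symmetric functions\<close>

lemma power_sum_part_mult:
  assumes "\<sigma> \<in> partitions a" "\<tau> \<in> partitions b"
  obtains \<rho> where "\<rho> \<in> partitions (a + b)" "power_sum_part \<sigma> * power_sum_part \<tau> = power_sum_part \<rho>"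
proof
  let ?\<rho> = "part_of_mset (mset \<sigma> + mset \<tau>)"
  have 0: "0 \<notin># mset \<sigma> + mset \<tau>" using assms by (auto simp: partitions_def is_partition_def)
  have "sum_list ?\<rho> = sum_mset (mset ?\<rho>)" by (simp only: sum_mset_sum_list)
  then show "?\<rho> \<in> partitions (a + b)"
    using assms is_partition_part_of_mset[OF 0] by (simp add: partitions_def sum_mset_sum_list)
  show "power_sum_part \<sigma> * power_sum_part \<tau> = power_sum_part ?\<rho>"
    unfolding pmset_mset[symmetric] by (simp add: pmset_union)
qed

lemma homsym_mult:
  assumes "f \<in> homsym a" "g \<in> homsym b"
  shows "f * g \<in> homsym (a + b)"
proof -
  have "(\<Sum>\<sigma>\<in>partitions a. scale (power_sum_coeff f \<sigma>) (power_sum_part \<sigma>)) *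
      (\<Sum>\<tau>\<in>partitions b. scale (power_sum_coeff g \<tau>) (power_sum_part \<tau>)) \<in> homsym (a + b)"
    unfolding sum_product
  proof (intro homsym_sum)
    fix \<sigma> \<tau> assume "\<sigma> \<in> partitions a" "\<tau> \<in> partitions b"
    from power_sum_part_mult[OF this] have "power_sum_part \<sigma> * power_sum_part \<tau> \<in> homsym (a + b)"
      by (metis power_sum_part_homsym)
    then show "scale (power_sum_coeff f \<sigma>) (power_sum_part \<sigma>) * scale (power_sum_coeff g \<tau>) (power_sum_part \<tau>)
        \<in> homsym (a + b)" by (simp add: homsym_scale)
  qed
  then show ?thesis using homsym_expansion assms by metis
qed

text \<open>The index set of the definition depends on the supports of \<open>f\<close> and
  \<open>g\<close>; over the fixed set \<open>partitions n\<close> bilinearity is visible.\<close>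

lemma kronecker_product_eq:
  assumes "f \<in> homsym n" "g \<in> homsym n"
  shows "kronecker_product f g = (\<Sum>\<rho>\<in>partitions n.
    scale (power_sum_coeff f \<rho> * power_sum_coeff g \<rho> * of_nat (z_part \<rho>)) (power_sum_part \<rho>))"
  unfolding kronecker_product_def
proof (rule sum.mono_neutral_left)
  show "{\<rho>. is_partition \<rho> \<and> power_sum_coeff f \<rho> \<noteq> 0 \<and> power_sum_coeff g \<rho> \<noteq> 0} \<subseteq> partitions n"
    using power_sum_coeff_eq_0[OF assms(1)] by blast
  show "\<forall>\<rho>\<in>partitions n - {\<rho>. is_partition \<rho> \<and> power_sum_coeff f \<rho> \<noteq> 0 \<and> power_sum_coeff g \<rho> \<noteq> 0}.
      scale (power_sum_coeff f \<rho> * power_sum_coeff g \<rho> * of_nat (z_part \<rho>)) (power_sum_part \<rho>) = 0"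
    using partitions_subset by fastforce
qed simp

lemma kronecker_product_homsym:
  "f \<in> homsym n \<Longrightarrow> g \<in> homsym n \<Longrightarrow> kronecker_product f g \<in> homsym n"
  by (simp add: kronecker_product_eq homsym_sum homsym_scale power_sum_part_homsym)

lemma kronecker_product_lincomb:
  assumes "f \<in> homsym n" "\<And>i. i \<in> I \<Longrightarrow> g i \<in> homsym n"
  shows "kronecker_product f (\<Sum>i\<in>I. scale (c i) (g i)) = (\<Sum>i\<in>I. scale (c i) (kronecker_product f (g i)))"
proof -
  have G: "(\<Sum>i\<in>I. scale (c i) (g i)) \<in> homsym n" using assms(2) by (intro homsym_sum homsym_scale)
  have pc: "power_sum_coeff (\<Sum>i\<in>I. scale (c i) (g i)) \<rho> = (\<Sum>i\<in>I. c i * power_sum_coeff (g i) \<rho>)" for \<rho>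
    by (rule power_sum_coeff_lincomb) (rule assms(2))
  have "kronecker_product f (\<Sum>i\<in>I. scale (c i) (g i)) = (\<Sum>\<rho>\<in>partitions n. \<Sum>i\<in>I.
      scale (c i * (power_sum_coeff f \<rho> * power_sum_coeff (g i) \<rho> * of_nat (z_part \<rho>))) (power_sum_part \<rho>))"
    unfolding kronecker_product_eq[OF assms(1) G] pc
    by (simp add: sum_distrib_left sum_distrib_right pseries.scale_sum_left mult_ac)
  also have "\<dots> = (\<Sum>i\<in>I. \<Sum>\<rho>\<in>partitions n.
      scale (c i * (power_sum_coeff f \<rho> * power_sum_coeff (g i) \<rho> * of_nat (z_part \<rho>))) (power_sum_part \<rho>))"
    by (rule sum.swap)
  also have "\<dots> = (\<Sum>i\<in>I. scale (c i) (kronecker_product f (g i)))"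
    by (rule sum.cong[OF refl])
       (simp add: kronecker_product_eq[OF assms(1) assms(2)] pseries.scale_sum_right)
  finally show ?thesis .
qed

lemma power_sum_coeff_power_sum_part:
  assumes "\<rho> \<in> partitions n" "\<sigma> \<in> partitions n"
  shows "power_sum_coeff (power_sum_part \<rho>) \<sigma> = (if \<sigma> = \<rho> then 1 else 0)"
  using power_sum_coeff_sum[of "{\<rho>}" \<sigma> "\<lambda>_. 1"] assms by (auto simp: partitions_def)

text \<open>Only the coordinate \<open>f_\<rho>\<close> survives, and
  \<open>f_\<rho> * z_\<rho>\<close> is the Hall product of \<open>f\<close> with
  \<open>p_\<rho>\<close>: Kronecker multiplication by \<open>f\<close> is diagonal on power
  sums.\<close>

lemma kronecker_product_power_sum_part:
  assumes "f \<in> homsym n" "\<rho> \<in> partitions n"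
  shows "kronecker_product f (power_sum_part \<rho>) = scale (hall n f (power_sum_part \<rho>)) (power_sum_part \<rho>)"
proof -
  have "kronecker_product f (power_sum_part \<rho>) = (\<Sum>\<sigma>\<in>partitions n. if \<sigma> = \<rho> then
      scale (power_sum_coeff f \<sigma> * of_nat (z_part \<sigma>)) (power_sum_part \<sigma>) else 0)"
    unfolding kronecker_product_eq[OF assms(1) power_sum_part_homsym[OF assms(2)]]
    by (rule sum.cong) (auto simp: power_sum_coeff_power_sum_part[OF assms(2)] assms(2))
  also have "\<dots> = scale (power_sum_coeff f \<rho> * of_nat (z_part \<rho>)) (power_sum_part \<rho>)"
    using assms(2) by simp
  also have "power_sum_coeff f \<rho> * of_nat (z_part \<rho>) =
      (\<Sum>\<sigma>\<in>partitions n. if \<sigma> = \<rho> then power_sum_coeff f \<sigma> * of_nat (z_part \<sigma>) else 0)"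
    using assms(2) by simp
  also have "\<dots> = hall n f (power_sum_part \<rho>)"
    unfolding hall_def by (rule sum.cong) (auto simp: power_sum_coeff_power_sum_part[OF assms(2)] assms(2))
  finally show ?thesis .
qed

text \<open>Expand \<open>f\<close> and \<open>g\<close> in Schur functions; the Hall product of
  \<open>schur lam\<close> with \<open>schur \<theta> * schur \<delta>\<close> is the
  Littlewood-Richardson coefficient.\<close>

lemma hall_schur_mult:
  assumes lam: "lam \<in> partitions (a + b)" and f: "f \<in> homsym a" and g: "g \<in> homsym b"
  shows "hall (a + b) (schur lam) (f * g) = (\<Sum>\<theta>\<in>partitions a. \<Sum>\<delta>\<in>partitions b.
    lr_coeff \<theta> \<delta> lam * hall a (schur \<theta>) f * hall b (schur \<delta>) g)"
proof -
  have sm: "schur \<theta> * schur \<delta> \<in> homsym (a + b)" if "\<theta> \<in> partitions a" "\<delta> \<in> partitions b" for \<theta> \<delta>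
    using that by (intro homsym_mult schur_homsym)
  have "f * g = (\<Sum>\<theta>\<in>partitions a. scale (hall a f (schur \<theta>)) (schur \<theta>)) *
      (\<Sum>\<delta>\<in>partitions b. scale (hall b g (schur \<delta>)) (schur \<delta>))"
    using schur_expansion[OF f] schur_expansion[OF g] by simp
  also have "\<dots> = (\<Sum>(\<theta>, \<delta>)\<in>partitions a \<times> partitions b.
      scale (hall a f (schur \<theta>) * hall b g (schur \<delta>)) (schur \<theta> * schur \<delta>))"
    by (simp add: sum_product sum.cartesian_product case_prod_unfold mult.commute)
  finally have "hall (a + b) (schur lam) (f * g) = (\<Sum>(\<theta>, \<delta>)\<in>partitions a \<times> partitions b.
      hall a f (schur \<theta>) * hall b g (schur \<delta>) * hall (a + b) (schur lam) (schur \<theta> * schur \<delta>))"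
    using hall_lincomb_right[of "partitions a \<times> partitions b" "\<lambda>(\<theta>, \<delta>). schur \<theta> * schur \<delta>" "a + b" "schur lam"
        "\<lambda>(\<theta>, \<delta>). hall a f (schur \<theta>) * hall b g (schur \<delta>)"] sm
    by (auto simp: case_prod_unfold)
  also have "\<dots> = (\<Sum>(\<theta>, \<delta>)\<in>partitions a \<times> partitions b.
      lr_coeff \<theta> \<delta> lam * hall a (schur \<theta>) f * hall b (schur \<delta>) g)"
    by (rule sum.cong[OF refl])
       (auto simp: lr_coeff_def schur_coeff_eq_hall[OF sm lam] hall_commute[of _ "schur _"] mult_ac)
  finally show ?thesis by (simp add: sum.cartesian_product)
qed

text \<open>
  Both sides are bilinear in \<open>f\<close> and \<open>g\<close>. On power sums the Kronecker product with
  \<open>h\<close> is multiplication by the Hall product with \<open>h\<close>, so that the statement becomes \<open>hall_schur_mult\<close>.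
\<close>

lemma kronecker_product_schur_mult:
  assumes lam: "lam \<in> partitions (a + b)" and f: "f \<in> homsym a" and g: "g \<in> homsym b"
  shows "kronecker_product (schur lam) (f * g) = (\<Sum>\<theta>\<in>partitions a. \<Sum>\<delta>\<in>partitions b.
    scale (lr_coeff \<theta> \<delta> lam) (kronecker_product (schur \<theta>) f * kronecker_product (schur \<delta>) g))"
proof -
  let ?p = power_sum_part
  let ?I = "partitions a \<times> partitions b"
  let ?c = "\<lambda>(\<sigma>, \<tau>). power_sum_coeff f \<sigma> * power_sum_coeff g \<tau>"
  have base: "kronecker_product (schur lam) (?p \<sigma> * ?p \<tau>) = (\<Sum>\<theta>\<in>partitions a. \<Sum>\<delta>\<in>partitions b.
      scale (lr_coeff \<theta> \<delta> lam) (kronecker_product (schur \<theta>) (?p \<sigma>) * kronecker_product (schur \<delta>) (?p \<tau>)))"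
    if \<sigma>\<tau>: "\<sigma> \<in> partitions a" "\<tau> \<in> partitions b" for \<sigma> \<tau>
  proof -
    obtain \<rho> where \<rho>: "\<rho> \<in> partitions (a + b)" "?p \<sigma> * ?p \<tau> = ?p \<rho>"
      by (rule power_sum_part_mult[OF \<sigma>\<tau>])
    have "kronecker_product (schur lam) (?p \<sigma> * ?p \<tau>) =
        scale (hall (a + b) (schur lam) (?p \<sigma> * ?p \<tau>)) (?p \<sigma> * ?p \<tau>)"
      unfolding \<rho>(2) by (rule kronecker_product_power_sum_part[OF schur_homsym[OF lam] \<rho>(1)])
    also have "\<dots> = (\<Sum>\<theta>\<in>partitions a. \<Sum>\<delta>\<in>partitions b.
        scale (lr_coeff \<theta> \<delta> lam * hall a (schur \<theta>) (?p \<sigma>) * hall b (schur \<delta>) (?p \<tau>)) (?p \<sigma> * ?p \<tau>))"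
      by (simp add: hall_schur_mult[OF lam power_sum_part_homsym[OF \<sigma>\<tau>(1)] power_sum_part_homsym[OF \<sigma>\<tau>(2)]]
          pseries.scale_sum_left)
    also have "\<dots> = (\<Sum>\<theta>\<in>partitions a. \<Sum>\<delta>\<in>partitions b.
        scale (lr_coeff \<theta> \<delta> lam) (kronecker_product (schur \<theta>) (?p \<sigma>) * kronecker_product (schur \<delta>) (?p \<tau>)))"
    proof (rule sum.cong[OF refl], rule sum.cong[OF refl])
      fix \<theta> \<delta> assume \<theta>: "\<theta> \<in> partitions a" and \<delta>: "\<delta> \<in> partitions b"
      show "scale (lr_coeff \<theta> \<delta> lam * hall a (schur \<theta>) (?p \<sigma>) * hall b (schur \<delta>) (?p \<tau>)) (?p \<sigma> * ?p \<tau>) =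
          scale (lr_coeff \<theta> \<delta> lam) (kronecker_product (schur \<theta>) (?p \<sigma>) * kronecker_product (schur \<delta>) (?p \<tau>))"
        by (simp add: kronecker_product_power_sum_part[OF schur_homsym[OF \<theta>] \<sigma>\<tau>(1)]
            kronecker_product_power_sum_part[OF schur_homsym[OF \<delta>] \<sigma>\<tau>(2)] mult_ac)
    qed
    finally show ?thesis .
  qed
  have "f * g = (\<Sum>\<sigma>\<in>partitions a. scale (power_sum_coeff f \<sigma>) (?p \<sigma>)) *
      (\<Sum>\<tau>\<in>partitions b. scale (power_sum_coeff g \<tau>) (?p \<tau>))"
    using homsym_expansion[OF f] homsym_expansion[OF g] by simp
  also have "\<dots> = (\<Sum>x\<in>?I. scale (?c x) (?p (fst x) * ?p (snd x)))"
    by (simp add: sum_product sum.cartesian_product case_prod_unfold mult.commute)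
  finally have "kronecker_product (schur lam) (f * g) =
      (\<Sum>x\<in>?I. scale (?c x) (kronecker_product (schur lam) (?p (fst x) * ?p (snd x))))"
    by (simp only:) (rule kronecker_product_lincomb,
        auto intro!: schur_homsym lam homsym_mult power_sum_part_homsym)
  also have "\<dots> = (\<Sum>x\<in>?I. \<Sum>\<theta>\<in>partitions a. \<Sum>\<delta>\<in>partitions b. scale (lr_coeff \<theta> \<delta> lam)
      (scale (?c x) (kronecker_product (schur \<theta>) (?p (fst x)) * kronecker_product (schur \<delta>) (?p (snd x)))))"
    by (rule sum.cong[OF refl]) (auto simp: base pseries.scale_sum_right mult_ac)
  also have "\<dots> = (\<Sum>\<theta>\<in>partitions a. \<Sum>\<delta>\<in>partitions b. \<Sum>x\<in>?I. scale (lr_coeff \<theta> \<delta> lam)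
      (scale (?c x) (kronecker_product (schur \<theta>) (?p (fst x)) * kronecker_product (schur \<delta>) (?p (snd x)))))"
    by (subst sum.swap, rule sum.cong[OF refl], rule sum.swap)
  also have "\<dots> = (\<Sum>\<theta>\<in>partitions a. \<Sum>\<delta>\<in>partitions b.
    scale (lr_coeff \<theta> \<delta> lam) (kronecker_product (schur \<theta>) f * kronecker_product (schur \<delta>) g))"
  proof (rule sum.cong[OF refl], rule sum.cong[OF refl])
    fix \<theta> \<delta> assume \<theta>: "\<theta> \<in> partitions a" and \<delta>: "\<delta> \<in> partitions b"
    have kf: "kronecker_product (schur \<theta>) f =
        (\<Sum>\<sigma>\<in>partitions a. scale (power_sum_coeff f \<sigma>) (kronecker_product (schur \<theta>) (?p \<sigma>)))"
      by (subst homsym_expansion[OF f], rule kronecker_product_lincomb)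
         (auto intro: schur_homsym \<theta> power_sum_part_homsym)
    have kg: "kronecker_product (schur \<delta>) g =
        (\<Sum>\<tau>\<in>partitions b. scale (power_sum_coeff g \<tau>) (kronecker_product (schur \<delta>) (?p \<tau>)))"
      by (subst homsym_expansion[OF g], rule kronecker_product_lincomb)
         (auto intro: schur_homsym \<delta> power_sum_part_homsym)
    show "(\<Sum>x\<in>?I. scale (lr_coeff \<theta> \<delta> lam)
        (scale (?c x) (kronecker_product (schur \<theta>) (?p (fst x)) * kronecker_product (schur \<delta>) (?p (snd x))))) =
      scale (lr_coeff \<theta> \<delta> lam) (kronecker_product (schur \<theta>) f * kronecker_product (schur \<delta>) g)"
      unfolding kf kg
      by (simp add: sum_product sum.cartesian_product case_prod_unfold pseries.scale_sum_right mult_ac)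
  qed
  finally show ?thesis .
qed

text \<open>A power of a single variable arises only by taking that variable from every
  factor.\<close>

lemma coeff_power_sum_part_single:
  "\<forall>k\<in>set \<rho>. 0 < k \<Longrightarrow> coeff (power_sum_part \<rho>) (Poly_Mapping.single 0 (sum_list \<rho>)) = 1"
proof (induction \<rho>)
  case Nil
  then show ?case by (simp add: power_sum_part_def coeff_1)
next
  case (Cons k \<rho>)
  let ?s = "Poly_Mapping.single (0 :: nat)"
  have "{i. k \<le> Poly_Mapping.lookup (?s (k + sum_list \<rho>)) i} = {0}"
    using Cons.prems by (auto simp: lookup_single when_def split: if_splits)
  moreover have "?s (k + sum_list \<rho>) - ?s k = ?s (sum_list \<rho>)"
    by (rule poly_mapping_eqI) (simp add: lookup_minus lookup_single when_def)
  ultimately show ?case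
    using Cons by (simp add: power_sum_part_def coeff_power_sum_mult)
qed

lemma hprod_single: "hprod (Poly_Mapping.single i n) = hsym n"
  by (cases "n = 0") (simp_all add: hprod_def hsym_0)

lemma hsym_homsym: "hsym n \<in> homsym n"
  using hprod_homsym[of "Poly_Mapping.single 0 n"] by (simp add: hprod_single)

text \<open>\<open>hsym n\<close> corresponds to the trivial character: its coordinates are
  \<open>1 / z_\<rho>\<close>, which cancel the factor \<open>z_\<rho>\<close> of the Kronecker
  product.\<close>

lemma kronecker_product_hsym:
  assumes "f \<in> homsym n"
  shows "kronecker_product f (hsym n) = f"
proof -
  have "kronecker_product f (hsym n) = (\<Sum>\<rho>\<in>partitions n. scale (power_sum_coeff f \<rho>) (power_sum_part \<rho>))"
    unfolding kronecker_product_eq[OF assms hsym_homsym]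
  proof (rule sum.cong[OF refl])
    fix \<rho> assume \<rho>: "\<rho> \<in> partitions n"
    then have "power_sum_coeff (hsym n) \<rho> = 1 / of_nat (z_part \<rho>)"
      using power_sum_coeff_hprod[of \<rho> "Poly_Mapping.single 0 n"] coeff_power_sum_part_single[of \<rho>]
      by (auto simp: hprod_single partitions_def is_partition_def)
    moreover have "z_part \<rho> \<noteq> 0" using z_part_pos \<rho> partitions_subset by fastforce
    ultimately show "scale (power_sum_coeff f \<rho> * power_sum_coeff (hsym n) \<rho> * of_nat (z_part \<rho>)) (power_sum_part \<rho>) =
        scale (power_sum_coeff f \<rho>) (power_sum_part \<rho>)" by simp
  qed
  then show ?thesis using homsym_expansion[OF assms] by simp
qed

section \<open>Pieri's rule for hooks\<close>

lemma horizontal_strip_hook_iff: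
  assumes "1 \<le> x"
  shows "horizontal_strip (nth_default 0 (x # replicate (c + 1) 1)) f \<longleftrightarrow>
    x \<le> f 0 \<and> 1 \<le> f 1 \<and> f 1 \<le> x \<and> (\<forall>i<c. f (i + 2) = 1) \<and> f (c + 2) \<le> 1 \<and> (\<forall>i\<ge>c + 3. f i = 0)"
    (is "?L \<longleftrightarrow> ?R")
proof -
  define h where "h = nth_default 0 (x # replicate (c + 1) 1)"
  have h: "h i = (if i = 0 then x else if i < c + 2 then 1 else 0)" for i
    by (cases i) (simp_all add: h_def nth_default_def nth_Cons')
  show ?thesis
    unfolding h_def[symmetric]
  proof
    assume "horizontal_strip h f"
    then have hs: "h i \<le> f i" "f (Suc i) \<le> h i" for i by (auto simp: horizontal_strip_def)
    \<comment> \<open>Rows 2 to \<open>c + 1\<close> of \<open>f\<close> are squeezed between two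
      hook rows of length 1.\<close>
    have "f (i + 2) = 1" if "i < c" for i
      using hs(1)[of "i + 2"] hs(2)[of "i + 1"] that by (simp add: h split: if_splits)
    moreover have "f i = 0" if "c + 3 \<le> i" for i
      using hs(2)[of "i - 1"] that by (simp add: h split: if_splits)
    ultimately show ?R
      using hs(1)[of 0] hs(2)[of 0] hs(1)[of 1] hs(2)[of "c + 1"] by (simp add: h split: if_splits)
  next
    assume R: ?R
    have "h i \<le> f i \<and> f (Suc i) \<le> h i" for i
    proof -
      consider "i = 0" | "i = 1" | l where "i = l + 2" "l < c" | "i = c + 2" | "c + 3 \<le> i"
      proof -
        have "i = 0 \<or> i = 1 \<or> (i = (i - 2) + 2 \<and> i - 2 < c) \<or> i = c + 2 \<or> c + 3 \<le> i" by linarith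
        then show thesis using that by blast
      qed
      then show ?thesis
      proof cases
        case 2
        then show ?thesis using R by (cases "c = 0") (auto simp: h numeral_2_eq_2 dest: spec[of _ 0])
      next
        case 3
        \<comment> \<open>Row \<open>Suc i\<close> is either another row forced to have length 1 or
          row \<open>c + 2\<close>, whose length is at most 1.\<close>
        then have "f (Suc i) \<le> 1" using R
          by (cases "Suc l < c") (auto dest: spec[of _ "Suc l"] simp: less_Suc_eq, metis Suc_lessI add_2_eq_Suc')
        then show ?thesis using R 3 by (simp add: h)
      next
        case 4
        then show ?thesis using R by (simp add: h)
      qed (use R in \<open>simp_all add: h\<close>)
    qed
    then show "horizontal_strip h f" by (simp add: horizontal_strip_def)
  qed
qed

lemma sz_near_hook:
  assumes "\<forall>i<c. f (i + 2) = 1" "\<forall>i\<ge>c + 3. f i = 0"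
  shows "sz f = f 0 + f 1 + c + f (c + 2)"
proof -
  have "sz f = sum f {..<Suc (Suc (Suc c))}" by (rule sz_eq_sum) (use assms in simp)
  also have "\<dots> = f 0 + (f 1 + ((\<Sum>i<c. f (i + 2)) + f (c + 2)))"
    by (subst sum.lessThan_Suc_shift, subst sum.lessThan_Suc_shift, subst sum.lessThan_Suc) simp
  also have "(\<Sum>i<c. f (i + 2)) = c" using assms(1) by simp
  finally show ?thesis by simp
qed

lemma sorted_wrt_ge_replicate: "sorted_wrt (\<ge>) (replicate k (x :: nat))"
  by (induction k) auto

lemma hook_partition:
  assumes "1 \<le> x"
  shows "x # replicate k 1 \<in> partitions (x + k)"
  using assms by (auto simp: partitions_def is_partition_def sum_list_replicate sorted_wrt_ge_replicate)

lemma near_hook_partition: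
  assumes "b \<le> a" "1 \<le> b"
  shows "a # b # replicate c 1 \<in> partitions (a + b + c)"
  using assms by (auto simp: partitions_def is_partition_def sum_list_replicate sorted_wrt_ge_replicate)

text \<open>
  By Pieri's rule the first product runs over the shapes \<open>(f 0, f 1, 1\<^sup>c)\<close> or \<open>(f 0, f 1, 1\<^sup>c, 1)\<close> of size
  \<open>a + b + c\<close> with \<open>f 0 \<ge> a \<ge> f 1\<close>; the second one has exactly those with \<open>f 1 < b\<close>.
\<close>

lemma schur_near_hook:
  assumes ab: "b \<le> a" and b: "2 \<le> b"
  shows "schur (a # b # replicate c 1) =
    hsym (b - 1) * schur (a # replicate (c + 1) 1) - hsym a * schur ((b - 1) # replicate (c + 1) 1)"
proof -
  let ?N = "a + b + c"
  let ?\<kappa> = "a # b # replicate c 1"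
  let ?P = "\<lambda>x. {lam. lam \<in> partitions ?N \<and> horizontal_strip (nth_default 0 (x # replicate (c + 1) 1)) (nth_default 0 lam)}"
  have \<kappa>: "?\<kappa> \<in> partitions ?N" using near_hook_partition[of b a c] ab b by simp
  have k: "nth_default 0 ?\<kappa> i = (if i = 0 then a else if i = 1 then b else if i < c + 2 then 1 else 0)" for i
    by (cases i; cases "i - 1") (auto simp: nth_default_def nth_Cons')
  have iff: "lam \<in> ?P a \<longleftrightarrow> lam = ?\<kappa> \<or> lam \<in> ?P (b - 1)" for lam
  proof (cases "lam \<in> partitions ?N")
    case lam: True
    define f where "f = nth_default 0 lam"
    have f: "sz f = ?N" using lam partition_fun(3)[of lam] by (simp add: f_def partitions_def)
    have ka: "horizontal_strip (nth_default 0 (a # replicate (c + 1) 1)) (nth_default 0 ?\<kappa>)"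
      using ab b by (subst horizontal_strip_hook_iff) (simp_all only: k, auto)
    have a1: "1 \<le> a" and b1: "1 \<le> b - 1" using ab b by auto
    \<comment> \<open>Here \<open>f 0 \<ge> a\<close>, \<open>f 1 \<ge> b\<close> and
      \<open>c\<close> rows of length 1 already make up the size \<open>a + b + c\<close>, so there
      is equality everywhere.\<close>
    have eq: "lam = ?\<kappa>" if h: "horizontal_strip (nth_default 0 (a # replicate (c + 1) 1)) f" "\<not> f 1 \<le> b - 1"
    proof -
      note h' = h(1)[unfolded horizontal_strip_hook_iff[OF a1]]
      have "f 0 = a" "f 1 = b" "f (c + 2) = 0"
        using sz_near_hook[of c f] f h' h(2) by auto
      moreover have "f i = 1" if "i < c + 2" "i \<noteq> 0" "i \<noteq> 1" for i
      proof -
        have "i - 2 < c" "i - 2 + 2 = i" using that by auto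
        then show ?thesis using h' by metis
      qed
      moreover have "f i = 0" if "\<not> i < c + 2" for i
        using h' \<open>f (c + 2) = 0\<close> that by (cases "i = c + 2") auto
      ultimately have "f i = nth_default 0 ?\<kappa> i" for i
        unfolding k by auto
      then have "nth_default 0 lam = nth_default 0 ?\<kappa>" by (simp add: f_def fun_eq_iff)
      then show ?thesis using partition_fun_inj lam \<kappa> by (simp only: partitions_def mem_Collect_eq)
    qed
    \<comment> \<open>For the smaller hook the strip condition gives only
      \<open>b - 1 \<le> f 0\<close>; the bound \<open>a \<le> f 0\<close> follows from the size,
      since \<open>f 1 \<le> b - 1\<close> and \<open>f (c + 2) \<le> 1\<close>.\<close>
    have "horizontal_strip (nth_default 0 ((b - 1) # replicate (c + 1) 1)) f \<longleftrightarrow>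
        horizontal_strip (nth_default 0 (a # replicate (c + 1) 1)) f \<and> f 1 \<le> b - 1"
      unfolding horizontal_strip_hook_iff[OF a1] horizontal_strip_hook_iff[OF b1]
      using sz_near_hook[of c f] f ab b by auto
    then show ?thesis using eq ka lam unfolding f_def by auto
  qed (use \<kappa> in auto)
  have notin: "?\<kappa> \<notin> ?P (b - 1)"
  proof
    assume "?\<kappa> \<in> ?P (b - 1)"
    then have "nth_default 0 ?\<kappa> 1 \<le> b - 1"
      using b by (subst (asm) mem_Collect_eq, subst (asm) horizontal_strip_hook_iff) auto
    then show False unfolding k using b by simp
  qed
  have "?P a = insert ?\<kappa> (?P (b - 1))" using iff by blast
  then have "(\<Sum>lam\<in>?P a. schur lam) = schur ?\<kappa> + (\<Sum>lam\<in>?P (b - 1). schur lam)"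
    using notin by (simp only: sum.insert finite_subset[OF _ finite_partitions[of ?N]]) (rule sum.insert, auto)
  moreover have "sum_list (a # replicate (c + 1) 1) + (b - 1) = ?N"
    "sum_list ((b - 1) # replicate (c + 1) 1) + a = ?N"
    using b by (simp_all add: sum_list_replicate)
  moreover have "is_partition (a # replicate (c + 1) 1)"
    using hook_partition[of a "c + 1"] ab b unfolding partitions_def by auto
  moreover have "is_partition ((b - 1) # replicate (c + 1) 1)"
    using hook_partition[of "b - 1" "c + 1"] b unfolding partitions_def by auto
  ultimately show ?thesis
    using pieri[of "a # replicate (c + 1) 1" "b - 1"] pieri[of "(b - 1) # replicate (c + 1) 1" a]
    by (simp only: add_diff_cancel)
qed

section \<open>Assembly of the formula\<close>

lemma kronecker_product_schur_expansion:
  assumes "\<theta> \<in> partitions n" "\<mu> \<in> partitions n"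
  shows "kronecker_product (schur \<theta>) (schur \<mu>) =
    (\<Sum>\<eta>\<in>partitions n. scale (kronecker_coeff \<theta> \<mu> \<eta>) (schur \<eta>))"
  unfolding kronecker_coeff_def
  by (intro schur_coeff_expansion kronecker_product_homsym schur_homsym assms)

text \<open>Since \<open>hsym q\<close> is neutral for the Kronecker product,
  \<open>kronecker_product_schur_mult\<close> leaves the terms
  \<open>(s_\<theta> * s_\<mu>) s_\<delta>\<close>. Expanding the first factor in the
  \<open>s_\<eta>\<close> and taking the coordinate at \<open>s_\<nu>\<close> yields the three
  coefficients.\<close>

lemma schur_coeff_kronecker_product_mult:
  assumes lam: "lam \<in> partitions (p + q)" and \<nu>: "\<nu> \<in> partitions (p + q)" and \<mu>: "\<mu> \<in> partitions p"
  shows "schur_coeff (kronecker_product (schur lam) (schur \<mu> * hsym q)) \<nu> =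
    (\<Sum>\<eta>\<in>partitions p. \<Sum>\<delta>\<in>partitions q. \<Sum>\<theta>\<in>partitions p.
      lr_coeff \<eta> \<delta> \<nu> * kronecker_coeff \<theta> \<mu> \<eta> * lr_coeff \<theta> \<delta> lam)"
proof -
  let ?I = "partitions p \<times> partitions q \<times> partitions p"
  have "kronecker_product (schur lam) (schur \<mu> * hsym q) =
      (\<Sum>\<theta>\<in>partitions p. \<Sum>\<delta>\<in>partitions q. \<Sum>\<eta>\<in>partitions p.
        scale (lr_coeff \<theta> \<delta> lam * kronecker_coeff \<theta> \<mu> \<eta>) (schur \<eta> * schur \<delta>))"
    unfolding kronecker_product_schur_mult[OF lam schur_homsym[OF \<mu>] hsym_homsym]
  proof (rule sum.cong[OF refl], rule sum.cong[OF refl])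
    fix \<theta> \<delta> assume "\<theta> \<in> partitions p" "\<delta> \<in> partitions q"
    then show "scale (lr_coeff \<theta> \<delta> lam) (kronecker_product (schur \<theta>) (schur \<mu>) * kronecker_product (schur \<delta>) (hsym q)) =
        (\<Sum>\<eta>\<in>partitions p. scale (lr_coeff \<theta> \<delta> lam * kronecker_coeff \<theta> \<mu> \<eta>) (schur \<eta> * schur \<delta>))"
      by (simp add: kronecker_product_hsym[OF schur_homsym] kronecker_product_schur_expansion[OF _ \<mu>]
          sum_distrib_right pseries.scale_sum_right)
  qed
  also have "\<dots> = (\<Sum>\<delta>\<in>partitions q. \<Sum>\<theta>\<in>partitions p. \<Sum>\<eta>\<in>partitions p.
        scale (lr_coeff \<theta> \<delta> lam * kronecker_coeff \<theta> \<mu> \<eta>) (schur \<eta> * schur \<delta>))"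
    by (rule sum.swap)
  also have "\<dots> = (\<Sum>\<delta>\<in>partitions q. \<Sum>\<eta>\<in>partitions p. \<Sum>\<theta>\<in>partitions p.
        scale (lr_coeff \<theta> \<delta> lam * kronecker_coeff \<theta> \<mu> \<eta>) (schur \<eta> * schur \<delta>))"
    by (rule sum.cong[OF refl], rule sum.swap)
  also have "\<dots> = (\<Sum>\<eta>\<in>partitions p. \<Sum>\<delta>\<in>partitions q. \<Sum>\<theta>\<in>partitions p.
        scale (lr_coeff \<theta> \<delta> lam * kronecker_coeff \<theta> \<mu> \<eta>) (schur \<eta> * schur \<delta>))"
    by (rule sum.swap)
  \<comment> \<open>The triple sum is flattened to a single index, the form in which
    \<open>schur_coeff_lincomb\<close> applies.\<close>
  also have "\<dots> = (\<Sum>(\<eta>, \<delta>, \<theta>)\<in>?I. scale (lr_coeff \<theta> \<delta> lam * kronecker_coeff \<theta> \<mu> \<eta>) (schur \<eta> * schur \<delta>))"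
    by (simp only: sum.cartesian_product)
  also have "\<dots> = (\<Sum>x\<in>?I. scale (lr_coeff (snd (snd x)) (fst (snd x)) lam * kronecker_coeff (snd (snd x)) \<mu> (fst x))
      (schur (fst x) * schur (fst (snd x))))"
    by (simp only: case_prod_unfold)
  finally have "schur_coeff (kronecker_product (schur lam) (schur \<mu> * hsym q)) \<nu> =
      (\<Sum>x\<in>?I. lr_coeff (snd (snd x)) (fst (snd x)) lam * kronecker_coeff (snd (snd x)) \<mu> (fst x) *
        schur_coeff (schur (fst x) * schur (fst (snd x))) \<nu>)"
    by (simp only:) (rule schur_coeff_lincomb[OF _ \<nu>], clarsimp, intro homsym_mult schur_homsym)
  also have "\<dots> = (\<Sum>(\<eta>, \<delta>, \<theta>)\<in>?I.
      lr_coeff \<eta> \<delta> \<nu> * kronecker_coeff \<theta> \<mu> \<eta> * lr_coeff \<theta> \<delta> lam)"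
    by (simp add: case_prod_unfold lr_coeff_def mult_ac)
  finally show ?thesis by (simp only: sum.cartesian_product)
qed

lemma lr_coeff_commute: "lr_coeff \<mu> \<nu> \<kappa> = lr_coeff \<nu> \<mu> \<kappa>"
  by (simp add: lr_coeff_def mult.commute)

theorem theorem4p1:
  fixes n a b c :: nat and lam \<nu> :: "nat list"
  assumes "0 < n"
    and "lam \<in> partitions n"
    and "\<nu> \<in> partitions n"
    and "b \<le> a" and "2 \<le> b"
    and "a + b + c = n"
  shows "kronecker_coeff lam (a # b # replicate c 1) \<nu> =
      (\<Sum>\<eta>\<in>partitions (n - (b - 1)). \<Sum>\<delta>\<in>partitions (b - 1). \<Sum>\<theta>\<in>partitions (n - (b - 1)).
         lr_coeff \<eta> \<delta> \<nu> * kronecker_coeff \<theta> (a # replicate (c + 1) 1) \<eta> * lr_coeff \<theta> \<delta> lam)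
    - (\<Sum>\<eta>\<in>partitions a. \<Sum>\<delta>\<in>partitions (n - a). \<Sum>\<theta>\<in>partitions (n - a).
         lr_coeff \<eta> \<delta> \<nu> * kronecker_coeff \<theta> ((b - 1) # replicate (c + 1) 1) \<delta> * lr_coeff \<eta> \<theta> lam)"
proof -
  let ?A = "a # replicate (c + 1) 1" and ?B = "(b - 1) # replicate (c + 1) 1"
  let ?k = "kronecker_product (schur lam)"
  \<comment> \<open>The sizes of the two hooks; the truncated differences are exact because
    \<open>b - 1\<close> and \<open>a\<close> are at most \<open>n\<close>.\<close>
  have nA: "n - (b - 1) = a + (c + 1)" "n = n - (b - 1) + (b - 1)"
    and nB: "n - a = b - 1 + (c + 1)" "n = n - a + a"
    using assms by auto
  have A: "?A \<in> partitions (n - (b - 1))"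
    unfolding nA(1) by (rule hook_partition) (use assms in simp)
  have B: "?B \<in> partitions (n - a)"
    unfolding nB(1) by (rule hook_partition) (use assms in simp)
  define f where "f = schur ?A * hsym (b - 1)"
  define g where "g = schur ?B * hsym a"
  have f: "f \<in> homsym n" and g: "g \<in> homsym n"
    using homsym_mult[OF schur_homsym[OF A] hsym_homsym[of "b - 1"]]
      homsym_mult[OF schur_homsym[OF B] hsym_homsym[of a]]
    by (simp_all only: f_def g_def nA(2)[symmetric] nB(2)[symmetric])
  \<comment> \<open>The difference is written as a sum over two indices with coefficients 1 and -1,
    so that the linearity rules for \<open>kronecker_product\<close> and \<open>schur_coeff\<close>
    apply to it.\<close>
  have fg: "schur (a # b # replicate c 1) = (\<Sum>i\<in>{True, False}. scale (if i then 1 else -1) (if i then f else g))"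
    unfolding schur_near_hook[OF assms(4,5)] by (simp add: f_def g_def mult.commute pseries.scale_minus_left)
  have lam: "schur lam \<in> homsym n" by (rule schur_homsym[OF assms(2)])
  have "?k (schur (a # b # replicate c 1)) =
      (\<Sum>i\<in>{True, False}. scale (if i then 1 else -1) (?k (if i then f else g)))"
    unfolding fg by (rule kronecker_product_lincomb[OF lam]) (simp add: f g)
  then have "kronecker_coeff lam (a # b # replicate c 1) \<nu> =
      (\<Sum>i\<in>{True, False}. (if i then 1 else -1) * schur_coeff (?k (if i then f else g)) \<nu>)"
    unfolding kronecker_coeff_def
    by (simp only:) (rule schur_coeff_lincomb[OF _ assms(3)], simp add: kronecker_product_homsym lam f g)
  also have "\<dots> = schur_coeff (?k f) \<nu> - schur_coeff (?k g) \<nu>" by simp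
  also have "schur_coeff (?k f) \<nu> =
      (\<Sum>\<eta>\<in>partitions (n - (b - 1)). \<Sum>\<delta>\<in>partitions (b - 1). \<Sum>\<theta>\<in>partitions (n - (b - 1)).
         lr_coeff \<eta> \<delta> \<nu> * kronecker_coeff \<theta> ?A \<eta> * lr_coeff \<theta> \<delta> lam)"
    unfolding f_def
    by (rule schur_coeff_kronecker_product_mult[OF _ _ A]) (use assms(2,3) nA(2) in simp_all)
  also have "schur_coeff (?k g) \<nu> =
      (\<Sum>\<delta>\<in>partitions (n - a). \<Sum>\<eta>\<in>partitions a. \<Sum>\<theta>\<in>partitions (n - a).
         lr_coeff \<delta> \<eta> \<nu> * kronecker_coeff \<theta> ?B \<delta> * lr_coeff \<theta> \<eta> lam)"
    unfolding g_def
    by (rule schur_coeff_kronecker_product_mult[OF _ _ B]) (use assms(2,3) nB(2) in simp_all)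
  \<comment> \<open>In this product the hook has size \<open>n - a\<close>, so \<open>\<eta>\<close>
    and \<open>\<delta>\<close> have exchanged their roles; commutativity of the
    Littlewood-Richardson coefficients restores the stated form.\<close>
  also have "\<dots> = (\<Sum>\<eta>\<in>partitions a. \<Sum>\<delta>\<in>partitions (n - a). \<Sum>\<theta>\<in>partitions (n - a).
         lr_coeff \<eta> \<delta> \<nu> * kronecker_coeff \<theta> ?B \<delta> * lr_coeff \<eta> \<theta> lam)"
    by (subst sum.swap) (simp only: lr_coeff_commute[of _ _ \<nu>] lr_coeff_commute[of _ _ lam])
  finally show ?thesis .
qed

end
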